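(* Let $G$ be a locally compact abelian group with compact open subgroup $H\subseteq G$, let $\mathcal{D}\subseteq\widehat{G}$ be a set of coset representatives in $\widehat{G}$ for $\widehat{G}/H^{\perp}$, let $A_1\in\operatorname{Aut}G$ be an automorphism that is expansive with respect to $H$, and set $\mathcal{A}=\{A_1^n: n\in\mathbb{Z}\}$. Fix an integer $M\ge 0$ and put $W=(A_1^{*})^M H^{\perp}$. Fix an integer $N\ge 1$ and let $T_j: W\to (A_1^{*}W)\setminus W$, $j=1,\ldots,N$, be measurable injective functions such that $$\forall\gamma\in W,\quad T_j(\gamma)-\gamma+\theta_{\mathcal{D}}(\gamma)\in\mathcal{D}\cap[(A_1^{*}W)\setminus W].$$ Let $\Omega_{1,0},\ldots,\Omega_{N,0}\subseteq W$ be measurable sets, each of which is $(\tau,\mathcal{D})$-congruent to $H^{\perp}$, and for which there is an integer $\ell\ge 0$ such that $$(A_1^{*})^{-\ell}H^{\perp}\subseteq\widetilde{\Omega}_0=\bigcup_{j=1}^N\Omega_{j,0}.$$ Assume that for every pair of distinct $j,k\in\{1,\ldots,N\}$, either $$T_jW\cap T_kW=\emptyset,\qquad\text{or}\qquad T_j=T_k\ \text{ and }\ \Omega_{j,0}\cap\Omega_{k,0}=\emptyset .$$ Define sets recursively as follows. For $1\le j\le N$, $$\Lambda'_{j,1}=\Omega_{j,0}\cap\Big[\bigcup_{n\ge1}(A_1^{*})^{-n}\widetilde{\Omega}_0\Big],\quad \Lambda''_{j,1}=\Omega_{j,0}\cap\Big[\bigcup_{k=1}^{j-1}\Omega_{k,0}\Big],$$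 $$\Lambda_{j,1}=\Lambda'_{j,1}\cup\Lambda''_{j,1},\quad \Omega_{j,1}=(\Omega_{j,0}\setminus\Lambda_{j,1})\cup T_j\Lambda_{j,1}.$$ For $m\ge1$ and $1\le j\le N$, with $\widetilde{\Omega}_m=\bigcup_{k=1}^N\Omega_{k,m}$, $$\Lambda_{j,m+1}=\Omega_{j,m}\cap\Big[\bigcup_{n\ge1}(A_1^{*})^{-n}\widetilde{\Omega}_m\Big],\quad \Omega_{j,m+1}=(\Omega_{j,m}\setminus\Lambda_{j,m+1})\cup T_j\Lambda_{j,m+1}$$ (one always has $\Lambda_{j,m}\subseteq\Omega_{j,0}\subseteq W$, so these definitions make sense). Finally, for $1\le j\le N$, $$\Lambda_j=\bigcup_{m\ge1}\Lambda_{j,m},\qquad \Omega_j=(\Omega_{j,0}\setminus\Lambda_j)\cup T_j\Lambda_j .$$ Then $\{\Omega_1,\ldots,\Omega_N\}$ is a wavelet collection of sets (with respect to $\mathcal{D}$ and $\mathcal{A}$).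
   Context: Notation. $\widehat{G}$ is the dual group of $G$ and $(x,\gamma)$ denotes the duality pairing. $H^{\perp}=\{\gamma\in\widehat{G}: (x,\gamma)=1 \text{ for all } x\in H\}$, a compact open subgroup of $\widehat{G}$. $\mu$ and $\nu$ are the Haar measures on $G$ and $\widehat{G}$ normalized by $\mu(H)=1$, $\nu(H^{\perp})=1$; the Fourier transform $\hat f(\gamma)=\int_G f(x)\overline{(x,\gamma)}\,d\mu(x)$ extends to an isometry of $L^2(G)$ onto $L^2(\widehat{G})$; $\check{F}$ denotes the inverse Fourier transform of $F$. $\operatorname{Aut}G$ is the group of homeomorphic automorphisms of $G$. For $A\in\operatorname{Aut}G$, the modulus $|A|>0$ is defined by $\mu(AU)=|A|\mu(U)$ for measurable $U$, and the adjoint $A^{*}\in\operatorname{Aut}\widehat{G}$ by $(Ax,\gamma)=(x,A^{*}\gamma)$. For $s\in G$, $[s]=s+H\in G/H$. Expansiveness. $A\in\operatorname{Aut}G$ is expansive with respect to $H$ if $H\subsetneq AH$ and $\bigcap_{n\le0}A^nH=\{0\}$. Translations and dilations. A set of coset representatives $\mathcal{D}$ contains exactly one element of each coset of $H^{\perp}$ in $\widehat{G}$. For $\gamma\in\widehat{G}$, $\theta_{\mathcal{D}}(\gamma)$ is the unique element of $\mathcal{D}\cap(\gamma+H^{\perp})$, and $\eta(\gamma)=\gamma-\theta_{\mathcal{D}}(\gamma)\in H^{\perp}$. For $[s]\in G/H$ let $w_{[s]}(\gamma)=\overline{(s,\eta(\gamma))}$ (this depends only on $[s]$ and $\mathcal{D}$).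 The operator $\tau_{[s]}=\tau_{[s],\mathcal{D}}$ on $L^2(G)$ is defined by $\widehat{\tau_{[s]}f}=\hat f\,w_{[s]}$. For $A\in\operatorname{Aut}G$, $\delta_Af(x)=|A|^{1/2}f(Ax)$. Wavelets. For $\psi_1,\ldots,\psi_N\in L^2(G)$ put $\psi_{j,A,[s]}=\delta_A\tau_{[s]}\psi_j$. $\{\psi_1,\ldots,\psi_N\}$ is a set of wavelet generators for $L^2(G)$ with respect to $\mathcal{D}$ and $\mathcal{A}$ if the family $\{\psi_{j,A,[s]}:1\le j\le N,\ A\in\mathcal{A},\ [s]\in G/H\}$ is an orthonormal basis of $L^2(G)$. Measurable sets $\Omega_1,\ldots,\Omega_N\subseteq\widehat{G}$ form a wavelet collection of sets if, with $\psi_j=\check{\mathbf{1}}_{\Omega_j}$, $\{\psi_1,\ldots,\psi_N\}$ is a set of wavelet generators for $L^2(G)$. Congruence. Subsets $V,V'\subseteq\widehat{G}$ are $(\tau,\mathcal{D})$-congruent if there are a finite or countable index set $I\subseteq\mathbb{Z}$, partitions $\{V_n:n\in I\}$ of $V$ and $\{V'_n:n\in I\}$ of $V'$ into measurable subsets, and sequences $\{\sigma_n\}_{n\in I},\{\sigma'_n\}_{n\in I}\subseteq\mathcal{D}$ such that for all $n\in I$: $V_n\subseteq\sigma_n+H^{\perp}$ and $V_n=V'_n-\sigma'_n+\sigma_n$. *)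

theory Defs
  imports "HOL-Analysis.Analysis"
begin

section \<open>The dual group\<close>

typedef (overloaded) ('a::topological_ab_group_add) dual =
  "{\<phi>. continuous_on UNIV (\<phi> :: 'a \<Rightarrow> complex) \<and>
      (\<forall>x. cmod (\<phi> x) = 1) \<and> (\<forall>x y. \<phi> (x + y) = \<phi> x * \<phi> y)}"
  morphisms dual_apply Dual
  by (rule exI[of _ "\<lambda>_. 1"]) auto

abbreviation pairing :: "'a::topological_ab_group_add \<Rightarrow> 'a dual \<Rightarrow> complex"
  where "pairing x \<gamma> \<equiv> dual_apply \<gamma> x"

lemma dual_apply_continuous: "continuous_on UNIV (dual_apply \<gamma>)"
  and norm_dual_apply: "cmod (dual_apply \<gamma> x) = 1"
  and dual_apply_add: "dual_apply \<gamma> (x + y) = dual_apply \<gamma> x * dual_apply \<gamma> y"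
  using dual_apply[of \<gamma>] by auto

lemma dual_apply_nonzero: "dual_apply \<gamma> x \<noteq> 0"
  using norm_dual_apply[of \<gamma> x] by auto

instantiation dual :: (topological_ab_group_add) ab_group_add
begin

definition "0 = Dual (\<lambda>_. 1)"
definition "\<gamma> + \<gamma>' = Dual (\<lambda>x. dual_apply \<gamma> x * dual_apply \<gamma>' x)"
definition "- \<gamma> = Dual (\<lambda>x. cnj (dual_apply \<gamma> x))"
definition "\<gamma> - \<gamma>' = (\<gamma> :: 'a dual) + - \<gamma>'"

lemma dual_apply_zero: "dual_apply 0 x = 1"
  unfolding zero_dual_def by (subst Dual_inverse) auto

lemma dual_apply_plus: "dual_apply (\<gamma> + \<gamma>') x = dual_apply \<gamma> x * dual_apply \<gamma>' x"
  unfolding plus_dual_def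
  by (subst Dual_inverse)
    (auto intro!: continuous_intros simp: dual_apply_continuous norm_mult norm_dual_apply dual_apply_add)

lemma dual_apply_uminus: "dual_apply (- \<gamma>) x = cnj (dual_apply \<gamma> x)"
  unfolding uminus_dual_def
  by (subst Dual_inverse)
    (auto intro!: continuous_intros simp: dual_apply_continuous norm_dual_apply dual_apply_add)

instance
proof
  fix a b c :: "'a dual"
  show "a + b + c = a + (b + c)"
    by (simp add: dual_apply_inject[symmetric] fun_eq_iff dual_apply_plus mult.assoc)
  show "a + b = b + a"
    by (simp add: dual_apply_inject[symmetric] fun_eq_iff dual_apply_plus mult.commute)
  show "0 + a = a"
    by (simp add: dual_apply_inject[symmetric] fun_eq_iff dual_apply_plus dual_apply_zero)
  have "cnj (dual_apply a x) * dual_apply a x = 1" for x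
    using complex_norm_square[of "dual_apply a x"] by (simp add: norm_dual_apply mult.commute)
  then show "- a + a = 0"
    by (simp add: dual_apply_inject[symmetric] fun_eq_iff dual_apply_plus dual_apply_zero
        dual_apply_uminus)
  show "a - b = a + - b"
    by (simp add: minus_dual_def)
qed

end

text \<open>The dual group carries the compact-open topology.\<close>

instantiation dual :: (topological_ab_group_add) topological_space
begin

definition open_dual :: "'a dual set \<Rightarrow> bool" where
  "open_dual = generate_topology
     {{\<gamma>. dual_apply \<gamma> ` K \<subseteq> U} | K U. compact K \<and> open U}"

instance
  by standard (auto simp: open_dual_def intro: generate_topology.intros)

end


section \<open>Subgroups, cosets and automorphisms\<close>

definition add_subgroup :: "'a::ab_group_add set \<Rightarrow> bool" where
  "add_subgroup H \<longleftrightarrow> 0 \<in> H \<and> (\<forall>x\<in>H. \<forall>y\<in>H. x + y \<in> H) \<and> (\<forall>x\<in>H. - x \<in> H)"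

definition compact_open_subgroup :: "'a::{ab_group_add,topological_space} set \<Rightarrow> bool" where
  "compact_open_subgroup H \<longleftrightarrow> add_subgroup H \<and> compact H \<and> open H"

definition coset :: "'a::ab_group_add set \<Rightarrow> 'a \<Rightarrow> 'a set" where
  "coset H x = (+) x ` H"

definition annihilator :: "'a::topological_ab_group_add set \<Rightarrow> 'a dual set" where
  "annihilator H = {\<gamma>. \<forall>x\<in>H. pairing x \<gamma> = 1}"

definition Aut :: "('a::{ab_group_add,topological_space} \<Rightarrow> 'a) set" where
  "Aut = {A. Modules.additive A \<and> homeomorphism UNIV UNIV A (inv A)}"

definition int_pow :: "('a \<Rightarrow> 'a) \<Rightarrow> int \<Rightarrow> 'a \<Rightarrow> 'a" where
  "int_pow A n = (if n \<ge> 0 then A ^^ nat n else inv A ^^ nat (- n))"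

definition adjoint_aut ::
    "('a::topological_ab_group_add \<Rightarrow> 'a) \<Rightarrow> 'a dual \<Rightarrow> 'a dual" where
  "adjoint_aut A \<gamma> = Dual (\<lambda>x. pairing (A x) \<gamma>)"

lemma pairing_adjoint:
  assumes "A \<in> Aut"
  shows "pairing x (adjoint_aut A \<gamma>) = pairing (A x) \<gamma>"
proof -
  have "continuous_on UNIV A" and "Modules.additive A"
    using assms by (auto simp: Aut_def homeomorphism_def)
  then have "continuous_on UNIV (\<lambda>x. dual_apply \<gamma> (A x))"
    by (intro continuous_on_compose2[OF dual_apply_continuous]) auto
  with \<open>Modules.additive A\<close> show ?thesis
    unfolding adjoint_aut_def
    by (subst Dual_inverse) (auto simp: norm_dual_apply Modules.additive.add dual_apply_add)
qed

definition expansive ::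
    "'a::{ab_group_add,topological_space} set \<Rightarrow> ('a \<Rightarrow> 'a) \<Rightarrow> bool" where
  "expansive H A \<longleftrightarrow> A \<in> Aut \<and> H \<subset> A ` H \<and> (\<Inter>n\<in>{..0}. int_pow A n ` H) = {0}"


section \<open>Haar measure\<close>

text \<open>
  A nonzero translation-invariant Radon measure on the Borel sets. The groups need not be
  second countable or sigma-compact, so regularity is not automatic.
\<close>

definition haar_measure :: "'a::{ab_group_add,topological_space} measure \<Rightarrow> bool" where
  "haar_measure M \<longleftrightarrow>
     sets M = sets borel \<and>
     emeasure M UNIV \<noteq> 0 \<and>
     (\<forall>K. compact K \<longrightarrow> emeasure M K < \<infinity>) \<and>
     (\<forall>x. \<forall>E\<in>sets borel. emeasure M ((+) x ` E) = emeasure M E) \<and>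
     (\<forall>E\<in>sets borel. emeasure M E = (INF U\<in>{U. open U \<and> E \<subseteq> U}. emeasure M U)) \<and>
     (\<forall>U. open U \<longrightarrow> emeasure M U = (SUP K\<in>{K. compact K \<and> K \<subseteq> U}. emeasure M K))"

definition modulus :: "'a measure \<Rightarrow> ('a \<Rightarrow> 'a) \<Rightarrow> real" where
  "modulus \<mu> A =
     (THE c. c > 0 \<and> (\<forall>U\<in>sets \<mu>. emeasure \<mu> (A ` U) = ennreal c * emeasure \<mu> U))"


section \<open>Square-integrable functions and the Fourier transform\<close>

text \<open>
  Elements of \<open>L\<^sup>2\<close> are represented by functions; operators on \<open>L\<^sup>2\<close> return some representative
  of the almost-everywhere class, and all notions below are insensitive to that choice.
\<close>

definition L2 :: "'a measure \<Rightarrow> ('a \<Rightarrow> complex) set" where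
  "L2 M = {f \<in> borel_measurable M. integrable M (\<lambda>x. (cmod (f x))\<^sup>2)}"

definition l2_inner :: "'a measure \<Rightarrow> ('a \<Rightarrow> complex) \<Rightarrow> ('a \<Rightarrow> complex) \<Rightarrow> complex" where
  "l2_inner M f g = (LINT x|M. f x * cnj (g x))"

definition l2_norm :: "'a measure \<Rightarrow> ('a \<Rightarrow> complex) \<Rightarrow> real" where
  "l2_norm M f = sqrt (LINT x|M. (cmod (f x))\<^sup>2)"

definition l2_orthonormal_basis ::
    "'a measure \<Rightarrow> 'i set \<Rightarrow> ('i \<Rightarrow> 'a \<Rightarrow> complex) \<Rightarrow> bool" where
  "l2_orthonormal_basis M I e \<longleftrightarrow>
     (\<forall>i\<in>I. e i \<in> L2 M) \<and>
     (\<forall>i\<in>I. \<forall>j\<in>I. l2_inner M (e i) (e j) = (if i = j then 1 else 0)) \<and>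
     (\<forall>f\<in>L2 M. \<forall>\<epsilon>>0. \<exists>S c. finite S \<and> S \<subseteq> I \<and>
        l2_norm M (\<lambda>x. f x - (\<Sum>i\<in>S. c i * e i x)) < \<epsilon>)"

definition fourier_L1 ::
    "'a::topological_ab_group_add measure \<Rightarrow> ('a \<Rightarrow> complex) \<Rightarrow> 'a dual \<Rightarrow> complex" where
  "fourier_L1 \<mu> f \<gamma> = (LINT x|\<mu>. f x * cnj (pairing x \<gamma>))"

text \<open>
  The graph of the extension by continuity of the Fourier transform from \<open>L\<^sup>1 \<inter> L\<^sup>2\<close> to \<open>L\<^sup>2\<close>.
\<close>

definition plancherel ::
    "'a::topological_ab_group_add measure \<Rightarrow> 'a dual measure \<Rightarrow>
      ('a \<Rightarrow> complex) \<Rightarrow> ('a dual \<Rightarrow> complex) \<Rightarrow> bool" where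
  "plancherel \<mu> \<nu> f F \<longleftrightarrow> f \<in> L2 \<mu> \<and> F \<in> L2 \<nu> \<and>
     (\<exists>g. (\<forall>n::nat. integrable \<mu> (g n) \<and> g n \<in> L2 \<mu> \<and> fourier_L1 \<mu> (g n) \<in> L2 \<nu>) \<and>
        (\<lambda>n. l2_norm \<mu> (\<lambda>x. g n x - f x)) \<longlonglongrightarrow> 0 \<and>
        (\<lambda>n. l2_norm \<nu> (\<lambda>\<gamma>. fourier_L1 \<mu> (g n) \<gamma> - F \<gamma>)) \<longlonglongrightarrow> 0)"

definition fourier ::
    "'a::topological_ab_group_add measure \<Rightarrow> 'a dual measure \<Rightarrow>
      ('a \<Rightarrow> complex) \<Rightarrow> 'a dual \<Rightarrow> complex" where
  "fourier \<mu> \<nu> f = (SOME F. plancherel \<mu> \<nu> f F)"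

definition inverse_fourier ::
    "'a::topological_ab_group_add measure \<Rightarrow> 'a dual measure \<Rightarrow>
      ('a dual \<Rightarrow> complex) \<Rightarrow> 'a \<Rightarrow> complex" where
  "inverse_fourier \<mu> \<nu> F = (SOME f. plancherel \<mu> \<nu> f F)"


section \<open>Translations, dilations and wavelets\<close>

definition coset_representatives :: "'a::ab_group_add set \<Rightarrow> 'a set \<Rightarrow> bool" where
  "coset_representatives K D \<longleftrightarrow> (\<forall>\<gamma>. \<exists>!\<sigma>. \<sigma> \<in> D \<inter> coset K \<gamma>)"

definition theta :: "'a::ab_group_add set \<Rightarrow> 'a set \<Rightarrow> 'a \<Rightarrow> 'a" where
  "theta K D \<gamma> = (THE \<sigma>. \<sigma> \<in> D \<inter> coset K \<gamma>)"

definition eta :: "'a::ab_group_add set \<Rightarrow> 'a set \<Rightarrow> 'a \<Rightarrow> 'a" where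
  "eta K D \<gamma> = \<gamma> - theta K D \<gamma>"

text \<open>
  The argument \<open>C\<close> of the following weight is a coset \<open>[s] = s + H\<close>; lemma
  \<open>translation_weight_coset\<close> states that the value does not depend on the chosen \<open>s\<close>.
\<close>

definition translation_weight ::
    "'a::topological_ab_group_add set \<Rightarrow> 'a dual set \<Rightarrow> 'a set \<Rightarrow> 'a dual \<Rightarrow> complex" where
  "translation_weight H D C \<gamma> = cnj (pairing (SOME s. s \<in> C) (eta (annihilator H) D \<gamma>))"

lemma eta_annihilator:
  assumes "coset_representatives (annihilator H) D"
  shows "eta (annihilator H) D \<gamma> \<in> annihilator H"
proof -
  have "theta (annihilator H) D \<gamma> \<in> D \<inter> coset (annihilator H) \<gamma>"
    unfolding theta_def using assms unfolding coset_representatives_def by (metis (no_types, lifting) theI')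
  then obtain k where "k \<in> annihilator H" "eta (annihilator H) D \<gamma> = - k"
    by (auto simp: coset_def eta_def)
  then show ?thesis
    by (auto simp: annihilator_def dual_apply_uminus)
qed

lemma translation_weight_coset:
  assumes "add_subgroup H" and "coset_representatives (annihilator H) D"
  shows "translation_weight H D (coset H s) \<gamma> = cnj (pairing s (eta (annihilator H) D \<gamma>))"
proof -
  have "s \<in> coset H s"
    using assms(1) by (force simp: coset_def add_subgroup_def)
  then have "(SOME t. t \<in> coset H s) \<in> coset H s"
    by (rule someI)
  then obtain h where "h \<in> H" "(SOME t. t \<in> coset H s) = s + h"
    by (auto simp: coset_def)
  with eta_annihilator[OF assms(2), of \<gamma>] show ?thesis
    by (simp add: translation_weight_def dual_apply_add annihilator_def)
qed

definition translate ::
    "'a::topological_ab_group_add set \<Rightarrow> 'a dual set \<Rightarrow> 'a measure \<Rightarrow> 'a dual measure \<Rightarrow>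
      'a set \<Rightarrow> ('a \<Rightarrow> complex) \<Rightarrow> 'a \<Rightarrow> complex" where
  "translate H D \<mu> \<nu> C f =
     inverse_fourier \<mu> \<nu> (\<lambda>\<gamma>. fourier \<mu> \<nu> f \<gamma> * translation_weight H D C \<gamma>)"

definition dilate :: "'a measure \<Rightarrow> ('a \<Rightarrow> 'a) \<Rightarrow> ('a \<Rightarrow> complex) \<Rightarrow> 'a \<Rightarrow> complex" where
  "dilate \<mu> A f x = of_real (sqrt (modulus \<mu> A)) * f (A x)"

definition wavelet_generators ::
    "'a::topological_ab_group_add set \<Rightarrow> 'a dual set \<Rightarrow> ('a \<Rightarrow> 'a) set \<Rightarrow>
      'a measure \<Rightarrow> 'a dual measure \<Rightarrow> nat \<Rightarrow> (nat \<Rightarrow> 'a \<Rightarrow> complex) \<Rightarrow> bool" where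
  "wavelet_generators H D \<A> \<mu> \<nu> N \<psi> \<longleftrightarrow>
     (\<forall>j\<in>{1..N}. \<psi> j \<in> L2 \<mu>) \<and>
     l2_orthonormal_basis \<mu> ({1..N} \<times> \<A> \<times> range (coset H))
       (\<lambda>(j, A, C). dilate \<mu> A (translate H D \<mu> \<nu> C (\<psi> j)))"

definition wavelet_collection ::
    "'a::topological_ab_group_add set \<Rightarrow> 'a dual set \<Rightarrow> ('a \<Rightarrow> 'a) set \<Rightarrow>
      'a measure \<Rightarrow> 'a dual measure \<Rightarrow> nat \<Rightarrow> (nat \<Rightarrow> 'a dual set) \<Rightarrow> bool" where
  "wavelet_collection H D \<A> \<mu> \<nu> N \<Omega> \<longleftrightarrow>
     (\<forall>j\<in>{1..N}. \<Omega> j \<in> sets \<nu> \<and> indicator (\<Omega> j) \<in> L2 \<nu>) \<and>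
     wavelet_generators H D \<A> \<mu> \<nu> N (\<lambda>j. inverse_fourier \<mu> \<nu> (indicator (\<Omega> j)))"

text \<open>
  Here \<open>K\<close> plays the role of the annihilator of \<open>H\<close>. Every index set of integers is
  finite or countable; allowing empty pieces in the partitions is immaterial, since they can be
  dropped from the index set.
\<close>

definition congruent_sets ::
    "'a::{ab_group_add,topological_space} set \<Rightarrow> 'a set \<Rightarrow> 'a set \<Rightarrow> 'a set \<Rightarrow> bool" where
  "congruent_sets K D V V' \<longleftrightarrow>
     (\<exists>(I::int set) P P' \<sigma> \<sigma>'.
        disjoint_family_on P I \<and> (\<Union>n\<in>I. P n) = V \<and>
        disjoint_family_on P' I \<and> (\<Union>n\<in>I. P' n) = V' \<and>
        (\<forall>n\<in>I. P n \<in> sets borel \<and> P' n \<in> sets borel \<and> \<sigma> n \<in> D \<and> \<sigma>' n \<in> D \<and>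
           P n \<subseteq> coset K (\<sigma> n) \<and> P n = (\<lambda>\<gamma>. \<gamma> - \<sigma>' n + \<sigma> n) ` P' n))"


section \<open>The iterative construction\<close>

definition contractions :: "('b \<Rightarrow> 'b) \<Rightarrow> 'b set \<Rightarrow> 'b set" where
  "contractions B S = (\<Union>n\<in>{1..}. int_pow B (- int n) ` S)"

text \<open>
  \<open>B\<close> is the adjoint automorphism, \<open>\<Omega>0\<close> the initial family. The first step also removes the
  overlap with the earlier sets. \<open>Lambda_step\<close> is only meaningful for indices \<open>\<ge> 1\<close>; its value at
  \<open>0\<close> is a dummy.
\<close>

fun Omega_step ::
    "('b \<Rightarrow> 'b) \<Rightarrow> nat \<Rightarrow> (nat \<Rightarrow> 'b \<Rightarrow> 'b) \<Rightarrow> (nat \<Rightarrow> 'b set) \<Rightarrow> nat \<Rightarrow> nat \<Rightarrow> 'b set"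
  and Lambda_step ::
    "('b \<Rightarrow> 'b) \<Rightarrow> nat \<Rightarrow> (nat \<Rightarrow> 'b \<Rightarrow> 'b) \<Rightarrow> (nat \<Rightarrow> 'b set) \<Rightarrow> nat \<Rightarrow> nat \<Rightarrow> 'b set"
where
  "Omega_step B N T \<Omega>0 0 j = \<Omega>0 j"
| "Omega_step B N T \<Omega>0 (Suc m) j =
     (Omega_step B N T \<Omega>0 m j - Lambda_step B N T \<Omega>0 (Suc m) j)
     \<union> T j ` Lambda_step B N T \<Omega>0 (Suc m) j"
| "Lambda_step B N T \<Omega>0 0 j = {}"
| "Lambda_step B N T \<Omega>0 (Suc 0) j =
     (\<Omega>0 j \<inter> contractions B (\<Union>k\<in>{1..N}. \<Omega>0 k)) \<union> (\<Omega>0 j \<inter> (\<Union>k\<in>{1..<j}. \<Omega>0 k))"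
| "Lambda_step B N T \<Omega>0 (Suc (Suc m)) j =
     Omega_step B N T \<Omega>0 (Suc m) j
     \<inter> contractions B (\<Union>k\<in>{1..N}. Omega_step B N T \<Omega>0 (Suc m) k)"

definition Lambda_limit ::
    "('b \<Rightarrow> 'b) \<Rightarrow> nat \<Rightarrow> (nat \<Rightarrow> 'b \<Rightarrow> 'b) \<Rightarrow> (nat \<Rightarrow> 'b set) \<Rightarrow> nat \<Rightarrow> 'b set" where
  "Lambda_limit B N T \<Omega>0 j = (\<Union>m\<in>{1..}. Lambda_step B N T \<Omega>0 m j)"

definition Omega_limit ::
    "('b \<Rightarrow> 'b) \<Rightarrow> nat \<Rightarrow> (nat \<Rightarrow> 'b \<Rightarrow> 'b) \<Rightarrow> (nat \<Rightarrow> 'b set) \<Rightarrow> nat \<Rightarrow> 'b set" where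
  "Omega_limit B N T \<Omega>0 j =
     (\<Omega>0 j - Lambda_limit B N T \<Omega>0 j) \<union> T j ` Lambda_limit B N T \<Omega>0 j"

end

theory Submission
  imports Defs
begin

text \<open>
  Write \<open>K\<close> for the annihilator of \<open>H\<close> and \<open>B\<close> for the adjoint of \<open>A1\<close>. The functions
  \<open>1\<^bsub>s+H\<^esub>(x) (x,\<sigma>)\<close> and their transforms, which are unimodular multiples of
  \<open>1\<^bsub>\<sigma>+K\<^esub>(\<gamma>) (-s,\<gamma>)\<close>, have the same Gram matrix and are total: by Stone-Weierstrass the
  characters are dense in the continuous functions on \<open>H\<close> and on \<open>K\<close>, and regularity passes from
  continuous functions to \<open>L\<^sup>2\<close>. Hence \<open>F\<close> is the transform of \<open>f\<close> if and only if their
  coefficients with respect to these families agree, which yields the Plancherel theorem. Stone-Weierstrass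
  also gives the uniqueness of Haar measure, and with it the modulus.

  On the dual side the wavelets are dilates of \<open>1\<^bsub>\<Omega>\<^esub>(\<gamma>) (-s,\<eta>(\<gamma>))\<close>. They form an orthonormal
  basis if \<open>\<eta>\<close> maps each \<open>\<Omega>\<close> bijectively (hence preserving measure) onto \<open>K\<close> and the sets
  \<open>B\<^sup>n \<Omega>\<close> tile the dual group up to a null set.

  The maps \<open>T j\<close> preserve \<open>\<eta>\<close>, so exchanging \<open>\<Lambda>\<close> for \<open>T j ` \<Lambda>\<close> keeps the bijection. The removed
  points are exactly those that would make two dilates overlap, and images under \<open>T j\<close> lie outside \<open>W\<close>
  and are never removed. Off a null set every orbit of \<open>B\<close> leaves all the sets for good, and the last
  point of the orbit that lies in some intermediate set stays in the limit.
\<close>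

section \<open>Square-integrable functions\<close>

text \<open>Both transforms are defined by choice, so nothing is known about them until a partner
  function is shown to exist, and the groups may fail to be sigma-compact. The compact open
  subgroups deal with both obstacles. A Borel set of finite measure meets only countably many
  cosets, and for \<open>x\<close> in a coset of \<open>H\<close> and \<open>\<gamma>\<close> in a
  coset of \<open>K\<close> the pairing splits into simple factors, so that the transform of a
  function living on one coset is explicit and no integrals are interchanged. Inverse transforms are
  needed only for functions that vanish off a compact set, because every limit set lies in the
  compact image of \<open>W\<close> under \<open>B\<close>. Points of the group are separated
  because expansiveness supplies open subgroups with intersection 0. A character trivial on an open
  subgroup is built algebraically by Zorn's lemma, continuity being automatic. The same separation
  shows that the image of \<open>K\<close> under \<open>B\<close> contains a second coset of
  \<open>K\<close>, so \<open>B\<close> at least doubles measure. Hence a \<open>B\<close>-invariant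
  Borel subset of \<open>K\<close> is null, and this is the null set that the tiling omits.\<close>

lemma borel_measurable_cnj [measurable (raw)]:
  "f \<in> borel_measurable M \<Longrightarrow> (\<lambda>x. cnj (f x)) \<in> borel_measurable M"
  by (rule borel_measurable_continuous_on[OF continuous_on_cnj[OF continuous_on_id]])

lemma L2_measurable: "f \<in> L2 M \<Longrightarrow> f \<in> borel_measurable M"
  and L2_integrable: "f \<in> L2 M \<Longrightarrow> integrable M (\<lambda>x. (cmod (f x))\<^sup>2)"
  and L2I: "f \<in> borel_measurable M \<Longrightarrow> integrable M (\<lambda>x. (cmod (f x))\<^sup>2) \<Longrightarrow> f \<in> L2 M"
  by (auto simp: L2_def)

lemma L2_dominated:
  assumes f: "f \<in> L2 M" and g: "g \<in> borel_measurable M"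
    and le: "\<And>x. x \<in> space M \<Longrightarrow> cmod (g x) \<le> c * cmod (f x)"
  shows "g \<in> L2 M"
proof (rule L2I[OF g])
  show "integrable M (\<lambda>x. (cmod (g x))\<^sup>2)"
  proof (rule Bochner_Integration.integrable_bound)
    show "integrable M (\<lambda>x. c\<^sup>2 * (cmod (f x))\<^sup>2)"
      using L2_integrable[OF f] by simp
    show "(\<lambda>x. (cmod (g x))\<^sup>2) \<in> borel_measurable M"
      using g by measurable
    have "(cmod (g x))\<^sup>2 \<le> c\<^sup>2 * (cmod (f x))\<^sup>2" if "x \<in> space M" for x
      using power_mono[OF le[OF that], of 2] by (simp add: power_mult_distrib)
    then show "AE x in M. norm ((cmod (g x))\<^sup>2) \<le> norm (c\<^sup>2 * (cmod (f x))\<^sup>2)"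
      by (auto intro!: AE_I2)
  qed
qed

lemma L2_zero: "(\<lambda>_. 0) \<in> L2 M"
  by (rule L2I) auto

lemma L2_cmult: "f \<in> L2 M \<Longrightarrow> (\<lambda>x. c * f x) \<in> L2 M"
  by (rule L2_dominated[where c = "cmod c"]) (auto simp: norm_mult dest: L2_measurable)

lemma L2_mult_bounded:
  assumes "f \<in> L2 M" "g \<in> borel_measurable M" "\<And>x. cmod (g x) \<le> 1"
  shows "(\<lambda>x. f x * g x) \<in> L2 M"
  using assms by (intro L2_dominated[OF assms(1), where c = 1])
    (auto simp: norm_mult mult_left_le dest: L2_measurable)

lemma L2_add:
  assumes f: "f \<in> L2 M" and g: "g \<in> L2 M"
  shows "(\<lambda>x. f x + g x) \<in> L2 M"
proof (rule L2I)
  note [measurable] = L2_measurable[OF f] L2_measurable[OF g]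
  show "(\<lambda>x. f x + g x) \<in> borel_measurable M"
    by measurable
  show "integrable M (\<lambda>x. (cmod (f x + g x))\<^sup>2)"
  proof (rule Bochner_Integration.integrable_bound)
    show "integrable M (\<lambda>x. 2 * (cmod (f x))\<^sup>2 + 2 * (cmod (g x))\<^sup>2)"
      using L2_integrable[OF f] L2_integrable[OF g] by simp
    have "(cmod (f x + g x))\<^sup>2 \<le> 2 * (cmod (f x))\<^sup>2 + 2 * (cmod (g x))\<^sup>2" for x
    proof -
      have "(cmod (f x + g x))\<^sup>2 \<le> (cmod (f x) + cmod (g x))\<^sup>2"
        by (intro power_mono norm_triangle_ineq) auto
      also have "\<dots> \<le> 2 * (cmod (f x))\<^sup>2 + 2 * (cmod (g x))\<^sup>2"
        using zero_le_power2[of "cmod (f x) - cmod (g x)"]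
        by (simp add: power2_sum power2_diff)
      finally show ?thesis .
    qed
    then show "AE x in M. norm ((cmod (f x + g x))\<^sup>2) \<le> norm (2 * (cmod (f x))\<^sup>2 + 2 * (cmod (g x))\<^sup>2)"
      by (auto intro!: AE_I2)
  qed measurable
qed

lemma L2_diff:
  assumes "f \<in> L2 M" "g \<in> L2 M"
  shows "(\<lambda>x. f x - g x) \<in> L2 M"
  using L2_add[OF assms(1) L2_cmult[OF assms(2), of "-1"]] by simp

lemma L2_sum:
  assumes "\<And>i. i \<in> S \<Longrightarrow> f i \<in> L2 M"
  shows "(\<lambda>x. \<Sum>i\<in>S. f i x) \<in> L2 M"
proof (cases "finite S")
  case True
  then show ?thesis
    using assms by (induction S) (auto intro: L2_zero L2_add)
qed (simp add: L2_zero)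

lemma L2_combination:
  assumes "\<And>i. i \<in> S \<Longrightarrow> f i \<in> L2 M"
  shows "(\<lambda>x. \<Sum>i\<in>S. c i * f i x) \<in> L2 M"
  by (intro L2_sum L2_cmult assms)

lemma L2_indicator:
  assumes "A \<in> sets M" "emeasure M A < \<infinity>"
  shows "(indicator A :: 'a \<Rightarrow> complex) \<in> L2 M"
proof (rule L2I)
  have "(\<lambda>x. (cmod (indicator A x))\<^sup>2) = (indicator A :: 'a \<Rightarrow> real)"
    by (auto simp: indicator_def fun_eq_iff)
  then show "integrable M (\<lambda>x. (cmod (indicator A x))\<^sup>2)"
    using assms by simp
qed (use assms in auto)

lemma L2_cong_AE:
  assumes "f \<in> L2 M" "g \<in> borel_measurable M" "AE x in M. f x = g x"
  shows "g \<in> L2 M"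
proof (rule L2I[OF assms(2)])
  have "AE x in M. (cmod (f x))\<^sup>2 = (cmod (g x))\<^sup>2"
    using assms(3) by eventually_elim simp
  then show "integrable M (\<lambda>x. (cmod (g x))\<^sup>2)"
    using L2_integrable[OF assms(1)] L2_measurable[OF assms(1)] assms(2)
    by (subst integrable_cong_AE[symmetric, where f = "\<lambda>x. (cmod (f x))\<^sup>2"]) auto
qed

lemma integrable_L2_inner:
  assumes f: "f \<in> L2 M" and g: "g \<in> L2 M"
  shows "integrable M (\<lambda>x. f x * cnj (g x))"
proof (rule Bochner_Integration.integrable_bound)
  note [measurable] = L2_measurable[OF f] L2_measurable[OF g]
  show "integrable M (\<lambda>x. (cmod (f x))\<^sup>2 + (cmod (g x))\<^sup>2)"
    using L2_integrable[OF f] L2_integrable[OF g] by simp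
  show "(\<lambda>x. f x * cnj (g x)) \<in> borel_measurable M"
    by measurable
  have "cmod (f x) * cmod (g x) \<le> (cmod (f x))\<^sup>2 + (cmod (g x))\<^sup>2" for x
  proof -
    have "0 \<le> cmod (f x) * cmod (g x)"
      by simp
    then show ?thesis
      using zero_le_power2[of "cmod (f x) - cmod (g x)"] unfolding power2_diff by linarith
  qed
  then show "AE x in M. norm (f x * cnj (g x)) \<le> norm ((cmod (f x))\<^sup>2 + (cmod (g x))\<^sup>2)"
    by (auto intro!: AE_I2 simp: norm_mult)
qed

section \<open>Inner product, norm and the Cauchy-Schwarz inequality\<close>

lemma l2_inner_commute: "l2_inner M g f = cnj (l2_inner M f g)"
  proof -
  have "cnj (l2_inner M f g) = (LINT x|M. cnj (f x * cnj (g x)))"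
    unfolding l2_inner_def by (simp only: Bochner_Integration.integral_cnj)
  then show ?thesis
    by (simp add: l2_inner_def mult.commute)
qed

lemma l2_inner_add_left:
  "f \<in> L2 M \<Longrightarrow> g \<in> L2 M \<Longrightarrow> h \<in> L2 M \<Longrightarrow>
    l2_inner M (\<lambda>x. f x + g x) h = l2_inner M f h + l2_inner M g h"
  unfolding l2_inner_def by (simp add: distrib_right integrable_L2_inner)

lemma l2_inner_cmult_left: "l2_inner M (\<lambda>x. c * f x) h = c * l2_inner M f h"
  unfolding l2_inner_def by (simp add: mult.assoc)

lemma l2_inner_diff_left:
  "f \<in> L2 M \<Longrightarrow> g \<in> L2 M \<Longrightarrow> h \<in> L2 M \<Longrightarrow>
    l2_inner M (\<lambda>x. f x - g x) h = l2_inner M f h - l2_inner M g h"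
  unfolding l2_inner_def by (simp add: left_diff_distrib integrable_L2_inner)

lemma l2_inner_combination_left:
  assumes "\<And>i. i \<in> S \<Longrightarrow> f i \<in> L2 M" "h \<in> L2 M"
  shows "l2_inner M (\<lambda>x. \<Sum>i\<in>S. c i * f i x) h = (\<Sum>i\<in>S. c i * l2_inner M (f i) h)"
proof (cases "finite S")
  case True
  then show ?thesis
    using assms
  proof (induction S)
    case (insert i S)
    have "l2_inner M (\<lambda>x. c i * f i x + (\<Sum>i\<in>S. c i * f i x)) h =
        c i * l2_inner M (f i) h + l2_inner M (\<lambda>x. \<Sum>i\<in>S. c i * f i x) h"
      using insert by (subst l2_inner_add_left) (auto intro!: L2_cmult L2_combination simp: l2_inner_cmult_left)
    then show ?case
      using insert by simp
  qed (simp add: l2_inner_def)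
qed (simp add: l2_inner_def)

lemma l2_inner_combination_right:
  assumes "\<And>i. i \<in> S \<Longrightarrow> f i \<in> L2 M" "h \<in> L2 M"
  shows "l2_inner M h (\<lambda>x. \<Sum>i\<in>S. c i * f i x) = (\<Sum>i\<in>S. cnj (c i) * l2_inner M h (f i))"
  by (subst l2_inner_commute, subst l2_inner_combination_left)
    (use assms in \<open>auto simp: l2_inner_commute[of M h]\<close>)

lemma l2_inner_diff_right:
  "f \<in> L2 M \<Longrightarrow> g \<in> L2 M \<Longrightarrow> h \<in> L2 M \<Longrightarrow>
    l2_inner M h (\<lambda>x. f x - g x) = l2_inner M h f - l2_inner M h g"
  by (subst (1 2 3) l2_inner_commute) (simp add: l2_inner_diff_left)

lemma l2_inner_cmult_right: "l2_inner M h (\<lambda>x. c * f x) = cnj c * l2_inner M h f"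
  by (subst (1 2) l2_inner_commute) (simp add: l2_inner_cmult_left)

lemma l2_inner_cong_AE:
  assumes "f \<in> borel_measurable M" "f' \<in> borel_measurable M" "g \<in> borel_measurable M" "g' \<in> borel_measurable M"
    "AE x in M. f x = f' x" "AE x in M. g x = g' x"
  shows "l2_inner M f g = l2_inner M f' g'"
  unfolding l2_inner_def
proof (rule integral_cong_AE)
  show "AE x in M. f x * cnj (g x) = f' x * cnj (g' x)"
    using assms(5,6) by eventually_elim simp
qed (use assms in measurable)

lemma l2_norm_nonneg [simp]: "0 \<le> l2_norm M f"
  by (simp add: l2_norm_def)

lemma l2_norm_power2: "(l2_norm M f)\<^sup>2 = (LINT x|M. (cmod (f x))\<^sup>2)"
  by (simp add: l2_norm_def)

lemma l2_inner_self: "l2_inner M f f = of_real ((l2_norm M f)\<^sup>2)"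
  unfolding l2_norm_power2 l2_inner_def
  by (simp add: complex_norm_square[symmetric] del: of_real_power)

lemma l2_norm_cmult: "l2_norm M (\<lambda>x. c * f x) = cmod c * l2_norm M f"
  by (simp add: l2_norm_def norm_mult power_mult_distrib real_sqrt_mult)

lemma l2_norm_minus_commute: "l2_norm M (\<lambda>x. f x - g x) = l2_norm M (\<lambda>x. g x - f x)"
  by (simp add: l2_norm_def norm_minus_commute)

lemma l2_norm_eq_0D:
  assumes "f \<in> L2 M" "l2_norm M f = 0"
  shows "AE x in M. f x = 0"
proof -
  have "(LINT x|M. (cmod (f x))\<^sup>2) = 0"
    using assms(2) by (simp add: l2_norm_def)
  then have "AE x in M. (cmod (f x))\<^sup>2 = 0"
    using L2_integrable[OF assms(1)] by (subst integral_nonneg_eq_0_iff_AE[symmetric]) auto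
  then show ?thesis
    by simp
qed

lemma l2_norm_add_power2:
  assumes "f \<in> L2 M" "g \<in> L2 M"
  shows "(l2_norm M (\<lambda>x. f x + g x))\<^sup>2 = (l2_norm M f)\<^sup>2 + 2 * Re (l2_inner M f g) + (l2_norm M g)\<^sup>2"
proof -
  have eq: "(cmod (f x + g x))\<^sup>2 = (cmod (f x))\<^sup>2 + 2 * Re (f x * cnj (g x)) + (cmod (g x))\<^sup>2" for x
    by (simp add: cmod_power2 power2_sum algebra_simps)
  have "Re (l2_inner M f g) = (LINT x|M. Re (f x * cnj (g x)))"
    unfolding l2_inner_def by (rule integral_Re[symmetric]) (rule integrable_L2_inner[OF assms])
  moreover have "integrable M (\<lambda>x. Re (f x * cnj (g x)))"
    by (rule integrable_Re) (rule integrable_L2_inner[OF assms])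
  ultimately show ?thesis
    unfolding l2_norm_power2 eq using L2_integrable[OF assms(1)] L2_integrable[OF assms(2)] 
    by (simp del: times_complex.sel)
qed

lemma l2_Cauchy_Schwarz:
  assumes f: "f \<in> L2 M" and g: "g \<in> L2 M"
  shows "cmod (l2_inner M f g) \<le> l2_norm M f * l2_norm M g"
proof (cases "l2_norm M g = 0")
  case True
  have "AE x in M. g x = 0"
    by (rule l2_norm_eq_0D[OF g True])
  then have "l2_inner M f g = l2_inner M f (\<lambda>_. 0)"
    using f g by (intro l2_inner_cong_AE) (auto dest: L2_measurable)
  then show ?thesis
    by (simp add: l2_inner_def)
next
  case False
  define z where "z = l2_inner M f g"
  define b where "b = (l2_norm M g)\<^sup>2"
  have b: "b > 0"
    using False by (simp add: b_def)
  \<comment> \<open>The multiple of \<open>g\<close> that minimises the norm of \<open>f\<close>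
    plus a multiple of \<open>g\<close>; nonnegativity of that minimum is the inequality.\<close>
  define h where "h = (\<lambda>x. (- z / b) * g x)"
  have h: "h \<in> L2 M"
    unfolding h_def by (rule L2_cmult[OF g])
  have "0 \<le> (l2_norm M (\<lambda>x. f x + h x))\<^sup>2"
    by simp
  also have "\<dots> = (l2_norm M f)\<^sup>2 + 2 * Re (cnj (- z / b) * z) + (cmod (- z / b))\<^sup>2 * b"
    unfolding l2_norm_add_power2[OF f h]
    by (simp only: h_def l2_inner_cmult_right l2_norm_cmult z_def b_def power_mult_distrib)
  also have "Re (cnj (- z / b) * z) = - ((cmod z)\<^sup>2 / b)"
    using b complex_norm_square[of z] by (simp add: complex_eq_iff cmod_power2 field_simps flip: power2_eq_square)
  also have "(cmod (- z / b))\<^sup>2 * b = (cmod z)\<^sup>2 / b"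
    using b by (simp add: norm_divide power_divide power2_eq_square)
  finally have "(cmod z)\<^sup>2 \<le> (l2_norm M f)\<^sup>2 * b"
    using b by (simp add: field_simps)
  then have "(cmod z)\<^sup>2 \<le> (l2_norm M f * l2_norm M g)\<^sup>2"
    by (simp add: b_def power_mult_distrib)
  then show ?thesis
    unfolding z_def by (rule power2_le_imp_le) simp
qed

lemma l2_norm_triangle:
  assumes "f \<in> L2 M" "g \<in> L2 M"
  shows "l2_norm M (\<lambda>x. f x + g x) \<le> l2_norm M f + l2_norm M g"
proof (rule power2_le_imp_le)
  have "Re (l2_inner M f g) \<le> l2_norm M f * l2_norm M g"
    using l2_Cauchy_Schwarz[OF assms] complex_Re_le_cmod order_trans by blast
  then show "(l2_norm M (\<lambda>x. f x + g x))\<^sup>2 \<le> (l2_norm M f + l2_norm M g)\<^sup>2"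
    unfolding l2_norm_add_power2[OF assms] power2_sum by simp
qed simp

lemma l2_norm_diff_triangle:
  assumes "f \<in> L2 M" "g \<in> L2 M" "h \<in> L2 M"
  shows "l2_norm M (\<lambda>x. f x - h x) \<le> l2_norm M (\<lambda>x. f x - g x) + l2_norm M (\<lambda>x. g x - h x)"
  using l2_norm_triangle[OF L2_diff[OF assms(1,2)] L2_diff[OF assms(2,3)]] by simp

lemma l2_norm_triangle_diff:
  assumes "f \<in> L2 M" "g \<in> L2 M"
  shows "\<bar>l2_norm M f - l2_norm M g\<bar> \<le> l2_norm M (\<lambda>x. f x - g x)"
  using l2_norm_triangle[OF L2_diff[OF assms] assms(2)]
    l2_norm_triangle[OF L2_diff[OF assms(2,1)] assms(1)] l2_norm_minus_commute[of M f g]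
  by simp

subsection \<open>Approximation by finite linear combinations\<close>

text \<open>Phrased for a set of functions and not for an indexed family, so that repetitions do not
  matter; \<open>l2_closed_span_approx\<close> returns to indices.\<close>

definition l2_closed_span :: "'a measure \<Rightarrow> ('a \<Rightarrow> complex) set \<Rightarrow> ('a \<Rightarrow> complex) set" where
  "l2_closed_span M B = {f \<in> L2 M. \<forall>\<epsilon>>0. \<exists>S c. finite S \<and> S \<subseteq> B \<and>
     l2_norm M (\<lambda>x. f x - (\<Sum>b\<in>S. c b * b x)) < \<epsilon>}"

text \<open>Half of the error goes to the approximant \<open>g\<close> and half to its own
  approximating combination: the closed span is closed.\<close>

lemma l2_closed_spanI:
  assumes "f \<in> L2 M"
    and "\<And>\<epsilon>. \<epsilon> > 0 \<Longrightarrow> \<exists>g\<in>l2_closed_span M B. l2_norm M (\<lambda>x. f x - g x) < \<epsilon>"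
    and B: "B \<subseteq> L2 M"
  shows "f \<in> l2_closed_span M B"
proof -
  have "\<exists>S c. finite S \<and> S \<subseteq> B \<and> l2_norm M (\<lambda>x. f x - (\<Sum>b\<in>S. c b * b x)) < \<epsilon>"
    if pos: "\<epsilon> > 0" for \<epsilon> :: real
  proof -
    obtain g where g: "g \<in> l2_closed_span M B" "l2_norm M (\<lambda>x. f x - g x) < \<epsilon> / 2"
      using assms(2)[OF half_gt_zero[OF pos]] by blast
    from g(1) obtain S c where S: "finite S" "S \<subseteq> B"
      "l2_norm M (\<lambda>x. g x - (\<Sum>b\<in>S. c b * b x)) < \<epsilon> / 2" and gL: "g \<in> L2 M"
      unfolding l2_closed_span_def using half_gt_zero[OF pos] by blast
    have "l2_norm M (\<lambda>x. f x - (\<Sum>b\<in>S. c b * b x)) < \<epsilon>"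
      using l2_norm_diff_triangle[OF assms(1) gL, of "\<lambda>x. \<Sum>b\<in>S. c b * b x"] S g B
      by (force intro!: L2_combination)
    then show ?thesis
      using S by blast
  qed
  then show ?thesis
    using assms(1) by (auto simp: l2_closed_span_def)
qed

lemma l2_closed_span_base:
  assumes "b \<in> B" "b \<in> L2 M"
  shows "b \<in> l2_closed_span M B"
proof -
  have "\<exists>S c. finite S \<and> S \<subseteq> B \<and> l2_norm M (\<lambda>x. b x - (\<Sum>b\<in>S. c b * b x)) < \<epsilon>"
    if pos: "\<epsilon> > 0" for \<epsilon>
    using pos assms by (intro exI[of _ "{b}"] exI[of _ "\<lambda>_. 1"]) (auto simp: l2_norm_def)
  then show ?thesis
    using assms by (auto simp: l2_closed_span_def)
qed

lemma l2_closed_span_L2: "f \<in> l2_closed_span M B \<Longrightarrow> f \<in> L2 M"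
  by (simp add: l2_closed_span_def)

lemma l2_closed_span_cmult:
  assumes f: "f \<in> l2_closed_span M B"
  shows "(\<lambda>x. k * f x) \<in> l2_closed_span M B"
proof -
  have "\<exists>S c. finite S \<and> S \<subseteq> B \<and> l2_norm M (\<lambda>x. k * f x - (\<Sum>b\<in>S. c b * b x)) < \<epsilon>"
    if pos: "\<epsilon> > 0" for \<epsilon> :: real
  proof -
    have pos': "\<epsilon> / (cmod k + 1) > 0"
      using pos by (simp add: add_nonneg_pos)
    obtain S c where S: "finite S" "S \<subseteq> B"
      "l2_norm M (\<lambda>x. f x - (\<Sum>b\<in>S. c b * b x)) < \<epsilon> / (cmod k + 1)"
      using f pos' unfolding l2_closed_span_def by blast
    have "l2_norm M (\<lambda>x. k * f x - (\<Sum>b\<in>S. (k * c b) * b x)) =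
        cmod k * l2_norm M (\<lambda>x. f x - (\<Sum>b\<in>S. c b * b x))"
      by (subst l2_norm_cmult[symmetric]) (simp add: right_diff_distrib sum_distrib_left mult.assoc)
    also have "\<dots> \<le> (cmod k + 1) * l2_norm M (\<lambda>x. f x - (\<Sum>b\<in>S. c b * b x))"
      by (simp add: mult_right_mono)
    also have "\<dots> < \<epsilon>"
      using S(3) pos_less_divide_eq[of "cmod k + 1"] by (simp add: add_nonneg_pos mult.commute)
    finally show ?thesis
      using S by (intro exI[of _ S] exI[of _ "\<lambda>b. k * c b"]) auto
  qed
  then show ?thesis
    using f by (auto simp: l2_closed_span_def L2_cmult)
qed

lemma l2_closed_span_add:
  assumes f: "f \<in> l2_closed_span M B" and g: "g \<in> l2_closed_span M B" and B: "B \<subseteq> L2 M"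
  shows "(\<lambda>x. f x + g x) \<in> l2_closed_span M B"
proof -
  have "\<exists>S c. finite S \<and> S \<subseteq> B \<and> l2_norm M (\<lambda>x. f x + g x - (\<Sum>b\<in>S. c b * b x)) < \<epsilon>"
    if pos: "\<epsilon> > 0" for \<epsilon> :: real
  proof -
    obtain S c where S: "finite S" "S \<subseteq> B" "l2_norm M (\<lambda>x. f x - (\<Sum>b\<in>S. c b * b x)) < \<epsilon> / 2"
      using f half_gt_zero[OF pos] unfolding l2_closed_span_def by blast
    obtain T d where T: "finite T" "T \<subseteq> B" "l2_norm M (\<lambda>x. g x - (\<Sum>b\<in>T. d b * b x)) < \<epsilon> / 2"
      using g half_gt_zero[OF pos] unfolding l2_closed_span_def by blast
    define e where "e b = (if b \<in> S then c b else 0) + (if b \<in> T then d b else 0)" for b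
    have e: "(\<Sum>b\<in>S \<union> T. e b * b x) = (\<Sum>b\<in>S. c b * b x) + (\<Sum>b\<in>T. d b * b x)" for x
    proof -
      have "(\<Sum>b\<in>S \<union> T. (if b \<in> S then c b else 0) * b x) = (\<Sum>b\<in>S. c b * b x)"
        using S T by (intro sum.mono_neutral_cong_right) auto
      moreover have "(\<Sum>b\<in>S \<union> T. (if b \<in> T then d b else 0) * b x) = (\<Sum>b\<in>T. d b * b x)"
        using S T by (intro sum.mono_neutral_cong_right) auto
      ultimately show ?thesis
        by (simp add: e_def distrib_right sum.distrib)
    qed
    have L: "(\<lambda>x. f x - (\<Sum>b\<in>S. c b * b x)) \<in> L2 M" "(\<lambda>x. g x - (\<Sum>b\<in>T. d b * b x)) \<in> L2 M"
      using S T B l2_closed_span_L2[OF f] l2_closed_span_L2[OF g] by (auto intro!: L2_diff L2_combination)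
    have "l2_norm M (\<lambda>x. f x + g x - (\<Sum>b\<in>S \<union> T. e b * b x)) < \<epsilon>"
      using l2_norm_triangle[OF L] S(3) T(3) unfolding e by (simp add: algebra_simps)
    then show ?thesis
      using S T by (intro exI[of _ "S \<union> T"] exI[of _ e]) auto
  qed
  moreover have "(\<lambda>x. f x + g x) \<in> L2 M"
    using f g by (auto intro!: L2_add dest: l2_closed_span_L2)
  ultimately show ?thesis
    by (auto simp: l2_closed_span_def)
qed

lemma l2_closed_span_sum:
  assumes "\<And>i. i \<in> I \<Longrightarrow> f i \<in> l2_closed_span M B" "B \<subseteq> L2 M"
  shows "(\<lambda>x. \<Sum>i\<in>I. f i x) \<in> l2_closed_span M B"
proof (cases "finite I")
  case True
  have zero: "(\<lambda>x. 0) \<in> l2_closed_span M B"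
    unfolding l2_closed_span_def
    by (auto simp: L2_zero l2_norm_def intro!: exI[of _ "{}"])
  show ?thesis
    using True assms by (induction I) (auto intro: l2_closed_span_add zero)
next
  case False
  then show ?thesis
    unfolding l2_closed_span_def
    by (auto simp: L2_zero l2_norm_def intro!: exI[of _ "{}"])
qed

text \<open>The factor 2 is what approximation by simple functions delivers. It leaves
  \<open>cmod (f x - s i x) \<le> 3 * cmod (f x)\<close>, whence the majorant with constant
  9.\<close>

lemma l2_dominated_tendsto:
  assumes f: "f \<in> L2 M" and s: "\<And>i::nat. s i \<in> borel_measurable M"
    and lim: "AE x in M. (\<lambda>i. s i x) \<longlonglongrightarrow> f x"
    and bound: "\<And>i x. x \<in> space M \<Longrightarrow> cmod (s i x) \<le> 2 * cmod (f x)"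
  shows "(\<lambda>i. l2_norm M (\<lambda>x. f x - s i x)) \<longlonglongrightarrow> 0"
proof -
  note [measurable] = L2_measurable[OF f] s
  have "(\<lambda>i. LINT x|M. (cmod (f x - s i x))\<^sup>2) \<longlonglongrightarrow> (LINT x|M. 0)"
  proof (rule integral_dominated_convergence)
    show "integrable M (\<lambda>x. 9 * (cmod (f x))\<^sup>2)"
      using L2_integrable[OF f] by simp
    show "AE x in M. (\<lambda>i. (cmod (f x - s i x))\<^sup>2) \<longlonglongrightarrow> 0"
      using lim
    proof eventually_elim
      case (elim x)
      then have "(\<lambda>i. (cmod (f x - s i x))\<^sup>2) \<longlonglongrightarrow> (cmod (f x - f x))\<^sup>2"
        by (intro tendsto_intros)
      then show ?case
        by simp
    qed
    show "AE x in M. norm ((cmod (f x - s i x))\<^sup>2) \<le> 9 * (cmod (f x))\<^sup>2" for i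
    proof (rule AE_I2)
      fix x assume x: "x \<in> space M"
      have "cmod (f x - s i x) \<le> 3 * cmod (f x)"
        using norm_triangle_ineq4[of "f x" "s i x"] bound[OF x, of i] by simp
      then show "norm ((cmod (f x - s i x))\<^sup>2) \<le> 9 * (cmod (f x))\<^sup>2"
        using power_mono[of "cmod (f x - s i x)" "3 * cmod (f x)" 2] by (simp add: power_mult_distrib)
    qed
  qed auto
  then have "(\<lambda>i. sqrt (LINT x|M. (cmod (f x - s i x))\<^sup>2)) \<longlonglongrightarrow> sqrt (LINT x|M. 0)"
    by (rule tendsto_real_sqrt)
  then show ?thesis
    by (simp add: l2_norm_def)
qed

lemma l2_closed_span_limit:
  assumes f: "f \<in> L2 M" and s: "\<And>i::nat. s i \<in> l2_closed_span M B" and B: "B \<subseteq> L2 M"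
    and lim: "AE x in M. (\<lambda>i. s i x) \<longlonglongrightarrow> f x"
    and bound: "\<And>i x. x \<in> space M \<Longrightarrow> cmod (s i x) \<le> 2 * cmod (f x)"
  shows "f \<in> l2_closed_span M B"
proof (rule l2_closed_spanI[OF f _ B])
  fix \<epsilon> :: real assume "\<epsilon> > 0"
  have "(\<lambda>i. l2_norm M (\<lambda>x. f x - s i x)) \<longlonglongrightarrow> 0"
    using s by (intro l2_dominated_tendsto f lim bound L2_measurable l2_closed_span_L2)
  then have "\<forall>\<^sub>F i in sequentially. l2_norm M (\<lambda>x. f x - s i x) < \<epsilon>"
    using \<open>\<epsilon> > 0\<close> by (rule order_tendstoD)
  then show "\<exists>g\<in>l2_closed_span M B. l2_norm M (\<lambda>x. f x - g x) < \<epsilon>"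
    using s eventually_happens'[OF sequentially_bot] by blast
qed

text \<open>Simple functions tending to \<open>f\<close> under the bound
  \<open>2 * cmod (f x)\<close> are combinations of indicators of their level sets, so only such
  indicators have to be approximated.\<close>

lemma l2_closed_span_indicators:
  assumes ind: "\<And>A. A \<in> sets M \<Longrightarrow> emeasure M A < \<infinity> \<Longrightarrow> indicator A \<in> l2_closed_span M B"
    and B: "B \<subseteq> L2 M" and f: "f \<in> L2 M"
  shows "f \<in> l2_closed_span M B"
proof -
  from borel_measurable_implies_sequence_metric[OF L2_measurable[OF f], of 0]
  obtain s where s0: "\<forall>i. simple_function M (s i)"
    "\<forall>x\<in>space M. (\<lambda>i. s i x) \<longlonglongrightarrow> f x"
    "\<forall>i. \<forall>x\<in>space M. dist (s i x) 0 \<le> 2 * dist (f x) 0"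
    by blast
  then have s: "\<And>i. simple_function M (s i)"
    "\<And>x. x \<in> space M \<Longrightarrow> (\<lambda>i. s i x) \<longlonglongrightarrow> f x"
    "\<And>i x. x \<in> space M \<Longrightarrow> cmod (s i x) \<le> 2 * cmod (f x)"
    by (auto simp: dist_norm)
  have meas: "s i \<in> borel_measurable M" for i
    by (rule borel_measurable_simple_function) (rule s(1))
  have sL: "s i \<in> L2 M" for i
    by (rule L2_dominated[OF f meas s(3)])
  \<comment> \<open>Off the space \<open>s i\<close> may take any value, so the combination of
    indicators is a separate function that agrees with it on the space.\<close>
  define r where "r i x = (\<Sum>y\<in>s i ` space M. y * indicator (s i -` {y} \<inter> space M) x)" for i x
  have r_eq: "r i x = s i x" if "x \<in> space M" for i x
    unfolding r_def using simple_function_indicator_representation_banach[OF s(1) that, of i]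
    by (subst sum.cong[OF refl, where h = "\<lambda>y. indicator (s i -` {y} \<inter> space M) x *\<^sub>R y"])
      (simp_all add: scaleR_conv_of_real indicator_def)
  have level: "(\<lambda>x. y * indicator (s i -` {y} \<inter> space M) x) \<in> l2_closed_span M B" for y i
  proof (cases "y = 0")
    case True
    have "(\<lambda>_. 0) = (\<lambda>x. 0 * indicator {} x :: complex)"
      by simp
    then show ?thesis
      using l2_closed_span_cmult[OF ind[of "{}"], of 0] True by simp
  next
    case False
    let ?A = "s i -` {y} \<inter> space M"
    have A: "?A \<in> sets M"
      using meas[of i] by measurable
    \<comment> \<open>The level set of a nonzero value \<open>y\<close> has finite measure, since
      its indicator is at most \<open>cmod (s i x) / cmod y\<close>.\<close>
    have "(\<lambda>x. indicator ?A x :: complex) \<in> L2 M"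
    proof (rule L2_dominated[OF sL[of i], of _ "1 / cmod y"])
      show "indicator ?A \<in> borel_measurable M"
        using A by auto
    qed (use False in \<open>auto simp: indicator_def\<close>)
    then have "integrable M (\<lambda>x. (cmod (indicator ?A x))\<^sup>2)"
      by (rule L2_integrable)
    moreover have "(\<lambda>x. (cmod (indicator ?A x))\<^sup>2) = (indicator ?A :: 'a \<Rightarrow> real)"
      by (auto simp: indicator_def fun_eq_iff)
    ultimately have "emeasure M ?A < \<infinity>"
      using A by (simp add: integrable_indicator_iff)
    with A show ?thesis
      by (intro l2_closed_span_cmult ind)
  qed
  have r: "r i \<in> l2_closed_span M B" for i
    unfolding r_def by (intro l2_closed_span_sum level B)
  show ?thesis
  proof (rule l2_closed_span_limit[OF f r B])
    show "AE x in M. (\<lambda>i. r i x) \<longlonglongrightarrow> f x"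
      using s(2) by (intro AE_I2) (simp add: r_eq)
  qed (simp add: r_eq s(3))
qed

lemma sum_indicator_disjoint:
  assumes "finite I" and "disjoint_family_on Y I"
  shows "(\<Sum>i\<in>I. indicator (Y i) x * (c :: complex)) = (if x \<in> (\<Union>i\<in>I. Y i) then c else 0)"
proof (cases "x \<in> (\<Union>i\<in>I. Y i)")
  case True
  then obtain k where k: "k \<in> I" "x \<in> Y k"
    by blast
  have "x \<notin> Y i" if "i \<in> I" "i \<noteq> k" for i
    using assms(2) k that by (auto simp: disjoint_family_on_def)
  then have "(\<Sum>i\<in>I. indicator (Y i) x * c) = (\<Sum>i\<in>{k}. indicator (Y i) x * c)"
    using assms(1) k(1) by (intro sum.mono_neutral_right) auto
  then show ?thesis
    using True k by simp
qed (auto intro!: sum.neutral)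

section \<open>Cosets\<close>

lemma coset_iff: "y \<in> coset S x \<longleftrightarrow> y - x \<in> S"
  by (force simp: coset_def)

lemma add_subgroup_zero: "add_subgroup S \<Longrightarrow> 0 \<in> S"
  and add_subgroup_add: "add_subgroup S \<Longrightarrow> x \<in> S \<Longrightarrow> y \<in> S \<Longrightarrow> x + y \<in> S"
  and add_subgroup_uminus: "add_subgroup S \<Longrightarrow> x \<in> S \<Longrightarrow> - x \<in> S"
  by (auto simp: add_subgroup_def)

lemma add_subgroup_diff: "add_subgroup S \<Longrightarrow> x \<in> S \<Longrightarrow> y \<in> S \<Longrightarrow> x - y \<in> S"
  using add_subgroup_add[of S x "- y"] add_subgroup_uminus[of S y] by simp

lemma coset_self: "add_subgroup S \<Longrightarrow> x \<in> coset S x"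
  by (simp add: coset_iff add_subgroup_zero)

lemma coset_zero: "coset S 0 = S"
  by (auto simp: coset_iff)

lemma coset_eq:
  assumes S: "add_subgroup S" and y: "y \<in> coset S x"
  shows "coset S y = coset S x"
proof (intro set_eqI)
  fix z
  have "z - x = (z - y) + (y - x)" "z - y = (z - x) - (y - x)"
    by simp_all
  then show "z \<in> coset S y \<longleftrightarrow> z \<in> coset S x"
    using y add_subgroup_add[OF S] add_subgroup_diff[OF S] unfolding coset_iff by metis
qed

lemma coset_eq_iff: "add_subgroup S \<Longrightarrow> coset S y = coset S x \<longleftrightarrow> y - x \<in> S"
  using coset_eq coset_self coset_iff by metis

lemma coset_disjoint: "add_subgroup S \<Longrightarrow> coset S x \<noteq> coset S y \<Longrightarrow> coset S x \<inter> coset S y = {}"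
  using coset_eq by blast

lemma disjoint_cosets:
  assumes "add_subgroup S" and F: "F \<subseteq> range (coset S)"
  shows "disjoint_family_on (\<lambda>C. C) F"
  unfolding disjoint_family_on_def
proof (intro ballI impI)
  fix C D assume "C \<in> F" "D \<in> F" "C \<noteq> D"
  moreover from this obtain x y where "C = coset S x" "D = coset S y"
    using F by blast
  ultimately show "C \<inter> D = {}"
    using coset_disjoint[OF assms(1)] by blast
qed

section \<open>Haar measure on groups with a compact open subgroup\<close>

text \<open>Trigonometric polynomials, when \<open>X\<close> consists of characters. The linear span
  is generated inductively, so that a linear identity checked on characters extends by
  induction.\<close>

inductive_set trig :: "('g \<Rightarrow> complex) set \<Rightarrow> ('g \<Rightarrow> complex) set" for X where
  base: "\<phi> \<in> X \<Longrightarrow> \<phi> \<in> trig X"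
| add: "p \<in> trig X \<Longrightarrow> q \<in> trig X \<Longrightarrow> (\<lambda>x. p x + q x) \<in> trig X"
| cmult: "p \<in> trig X \<Longrightarrow> (\<lambda>x. c * p x) \<in> trig X"

definition coset_waves :: "'g::ab_group_add set \<Rightarrow> ('g \<Rightarrow> complex) set \<Rightarrow> ('g \<Rightarrow> complex) set" where
  "coset_waves S X = {\<lambda>x. indicator (coset S a) x * \<phi> x | a \<phi>. \<phi> \<in> X}"

text \<open>One interface for both groups: \<open>X\<close> is the set of characters on the original
  group and the set of evaluations on the dual. Continuity is asked of single translations, which is
  what \<open>continuous_on_dual_plus\<close> provides for the dual.\<close>

locale haar_group =
  fixes M :: "'g::{ab_group_add,t2_space} measure" and S :: "'g set" and X :: "('g \<Rightarrow> complex) set"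
  assumes haar: "haar_measure M"
    and compact_open: "compact_open_subgroup S"
    and emeasure_S: "emeasure M S = 1"
    and continuous_plus: "\<And>a::'g. continuous_on UNIV ((+) a)"
    and X_continuous: "\<And>\<phi>. \<phi> \<in> X \<Longrightarrow> continuous_on UNIV \<phi>"
    and X_norm: "\<And>\<phi> x. \<phi> \<in> X \<Longrightarrow> cmod (\<phi> x) = 1"
    and X_plus: "\<And>\<phi> x y. \<phi> \<in> X \<Longrightarrow> \<phi> (x + y) = \<phi> x * \<phi> y"
    and X_one: "(\<lambda>_. 1) \<in> X"
    and X_mult: "\<And>\<phi> \<psi>. \<phi> \<in> X \<Longrightarrow> \<psi> \<in> X \<Longrightarrow> (\<lambda>x. \<phi> x * \<psi> x) \<in> X"
    and X_cnj: "\<And>\<phi>. \<phi> \<in> X \<Longrightarrow> (\<lambda>x. cnj (\<phi> x)) \<in> X"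
    and X_separates: "\<And>x y. x \<noteq> y \<Longrightarrow> \<exists>\<phi>\<in>X. \<phi> x \<noteq> \<phi> y"
begin

lemma sets_M [simp, measurable_cong]: "sets M = sets borel"
  using haar by (simp add: haar_measure_def)

lemma space_M [simp]: "space M = UNIV"
  using sets_eq_imp_space_eq[OF sets_M] by simp

lemma subgroup_S: "add_subgroup S"
  using compact_open by (simp add: compact_open_subgroup_def)

lemma plus_image: "(+) (a::'g) ` E = (+) (- a) -` E"
  by (force simp: image_iff)

lemma open_plus: "open E \<Longrightarrow> open ((+) (a::'g) ` E)"
  unfolding plus_image by (rule open_vimage[OF _ continuous_plus])

lemma open_coset: "open (coset S a)"
  using compact_open by (auto simp: coset_def compact_open_subgroup_def intro: open_plus)

lemma compact_coset: "compact (coset S a)"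
  using compact_open continuous_on_subset[OF continuous_plus subset_UNIV]
  by (auto simp: coset_def compact_open_subgroup_def intro!: compact_continuous_image)

lemma coset_sets [measurable, simp]: "coset S a \<in> sets borel"
  using open_coset by auto

lemma S_sets [measurable, simp]: "S \<in> sets borel"
  using coset_sets[of 0] by (simp add: coset_zero)

lemma emeasure_plus:
  assumes "E \<in> sets borel"
  shows "emeasure M ((+) a ` E) = emeasure M E"
  using haar assms by (simp add: haar_measure_def)

lemma emeasure_coset [simp]: "emeasure M (coset S a) = 1"
  by (simp add: coset_def emeasure_plus emeasure_S)

lemma plus_measurable [measurable]: "(+) (a::'g) \<in> borel_measurable borel"
  by (rule borel_measurable_continuous_onI[OF continuous_plus])

lemma distr_plus: "distr M M ((+) a) = M"
proof (rule measure_eqI)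
  fix E assume "E \<in> sets (distr M M ((+) a))"
  then have E: "E \<in> sets borel"
    by simp
  have "emeasure (distr M M ((+) a)) E = emeasure M ((+) (- a) ` E)"
    using E unfolding plus_image by (subst emeasure_distr) auto
  then show "emeasure (distr M M ((+) a)) E = emeasure M E"
    using emeasure_plus[OF E, of "- a"] by (simp only:)
qed simp

lemma integral_plus:
  fixes f :: "'g \<Rightarrow> 'b::{banach,second_countable_topology}"
  assumes "f \<in> borel_measurable borel"
  shows "(LINT x|M. f (a + x)) = (LINT x|M. f x)"
  using assms by (subst (2) distr_plus[of a, symmetric], subst integral_distr) auto

section \<open>Positivity on open sets, regularity, and the number of cosets met\<close>

lemma compact_finite_cosets:
  assumes "compact C"
  obtains F where "finite F" "F \<subseteq> range (coset S)" "C \<subseteq> \<Union>F"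
proof -
  have "C \<subseteq> \<Union>(range (coset S))"
    using coset_self[OF subgroup_S] by blast
  then show ?thesis
    using compactE[OF assms, of "range (coset S)"] open_coset that by (metis imageE)
qed

lemma emeasure_compact: "compact C \<Longrightarrow> emeasure M C < \<infinity>"
  using haar by (simp add: haar_measure_def)

text \<open>If \<open>U\<close> were null, finitely many of its translates would cover the compact
  \<open>S\<close>, which has measure 1.\<close>

lemma emeasure_open_pos:
  assumes "open U" "U \<noteq> {}"
  shows "emeasure M U > 0"
proof (rule ccontr)
  assume "\<not> emeasure M U > 0"
  then have null: "emeasure M U = 0"
    by simp
  obtain u where u: "u \<in> U"
    using assms(2) by blast
  have "S \<subseteq> \<Union>(range (\<lambda>x. (+) x ` U))"
  proof
    fix s assume "s \<in> S"
    have "s = (s - u) + u"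
      by simp
    then show "s \<in> \<Union>(range (\<lambda>x. (+) x ` U))"
      using u by blast
  qed
  moreover have "compact S"
    using compact_open by (simp add: compact_open_subgroup_def)
  ultimately obtain F where F: "F \<subseteq> range (\<lambda>x. (+) x ` U)" "finite F" "S \<subseteq> \<Union>F"
    using open_plus[OF assms(1)] by (elim compactE[of S "range (\<lambda>x. (+) x ` U)"]) auto
  have null_F: "V \<in> null_sets M" if "V \<in> F" for V
    using F(1) that assms(1) open_plus[OF assms(1)] null emeasure_plus[of U]
    by (auto intro!: null_setsI)
  have "\<Union>F \<in> null_sets M"
    using null_sets_UN'[of F "\<lambda>V. V" M] null_F F(2) by (auto simp: countable_finite)
  then have "emeasure M S \<le> 0"
    using emeasure_mono[OF F(3), of M] by (simp only: null_setsD1 null_setsD2)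
  then show False
    using emeasure_S by simp
qed

lemma outer_approx:
  assumes "E \<in> sets borel" "emeasure M E < \<infinity>" "\<epsilon> > 0"
  obtains U where "open U" "E \<subseteq> U" "emeasure M U < emeasure M E + ennreal \<epsilon>"
proof -
  have "emeasure M E = (INF U\<in>{U. open U \<and> E \<subseteq> U}. emeasure M U)"
    using haar assms(1) unfolding haar_measure_def by blast
  moreover have "emeasure M E < emeasure M E + ennreal \<epsilon>"
    using assms by (simp add: ennreal_add_left_cancel_less[of _ 0, simplified] top_unique less_top)
  ultimately have "(INF U\<in>{U. open U \<and> E \<subseteq> U}. emeasure M U) < emeasure M E + ennreal \<epsilon>"
    by simp
  then show ?thesis
    using that unfolding INF_less_iff by blast
qed

lemma inner_approx:
  assumes "open U" "c < emeasure M U"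
  obtains C where "compact C" "C \<subseteq> U" "c < emeasure M C"
proof -
  have "emeasure M U = (SUP K\<in>{K. compact K \<and> K \<subseteq> U}. emeasure M K)"
    using haar assms(1) unfolding haar_measure_def by blast
  with assms(2) have "c < (SUP K\<in>{K. compact K \<and> K \<subseteq> U}. emeasure M K)"
    by simp
  then show ?thesis
    using that unfolding less_SUP_iff by blast
qed

text \<open>\<open>E\<close> may meet a coset in a null set, so it is first enclosed in an open
  \<open>U\<close> of finite measure, which meets a coset either not at all or in a nonempty open
  set, of positive measure. These positive measures have bounded finite sums, hence only countably
  many of them occur.\<close>

lemma countable_cosets:
  assumes E: "E \<in> sets borel" "emeasure M E < \<infinity>"
  shows "countable {C \<in> range (coset S). E \<inter> C \<noteq> {}}"
proof -
  obtain U where U: "open U" "E \<subseteq> U" "emeasure M U < emeasure M E + ennreal 1"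
    by (rule outer_approx[OF E zero_less_one])
  have fin: "emeasure M U < \<infinity>"
    using U(3) E(2) by (intro order.strict_trans[OF U(3)]) (simp add: less_top[symmetric])
  have [measurable]: "U \<in> sets borel"
    using U(1) by auto
  let ?R = "range (coset S)"
  have "(\<lambda>C. measure M (U \<inter> C)) summable_on ?R"
  proof (rule nonneg_bdd_above_summable_on)
    have "sum (\<lambda>C. measure M (U \<inter> C)) F \<le> measure M U" if F: "F \<subseteq> ?R" "finite F" for F
    proof -
      have sub: "U \<inter> C \<in> fmeasurable M" if "C \<in> F" for C
      proof (rule fmeasurableI)
        show "emeasure M (U \<inter> C) < \<infinity>"
          by (rule order.strict_trans1[OF emeasure_mono fin]) auto
        show "U \<inter> C \<in> sets M"
          using that F(1) by auto
      qed
      have "sum (\<lambda>C. measure M (U \<inter> C)) F = measure M (\<Union>C\<in>F. U \<inter> C)"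
      proof (rule measure_UNION'[symmetric])
        show "pairwise (\<lambda>C D. disjnt (U \<inter> C) (U \<inter> D)) F"
          using disjoint_cosets[OF subgroup_S F(1)]
          by (fastforce simp: pairwise_def disjnt_def disjoint_family_on_def)
      qed (use F sub in auto)
      also have "\<dots> \<le> measure M U"
      proof (rule measure_mono_fmeasurable)
        show "(\<Union>C\<in>F. U \<inter> C) \<in> sets M"
          using sub[THEN fmeasurableD] F(2) by (intro sets.finite_UN) auto
      qed (use fin in \<open>auto intro: fmeasurableI\<close>)
      finally show ?thesis .
    qed
    then show "bdd_above (sum (\<lambda>C. measure M (U \<inter> C)) ` {F. F \<subseteq> ?R \<and> finite F})"
      by (intro bdd_aboveI[of _ "measure M U"]) auto
  qed simp
  then have "countable {C \<in> ?R. measure M (U \<inter> C) \<noteq> 0}"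
    by (rule summable_countable_real)
  moreover have "{C \<in> ?R. E \<inter> C \<noteq> {}} \<subseteq> {C \<in> ?R. measure M (U \<inter> C) \<noteq> 0}"
  proof
    fix C assume "C \<in> {C \<in> ?R. E \<inter> C \<noteq> {}}"
    then obtain a x where C: "C = coset S a" and x: "x \<in> E" "x \<in> coset S a"
      by blast
    have "emeasure M (U \<inter> coset S a) > 0"
      using x U open_coset by (intro emeasure_open_pos) auto
    moreover have "emeasure M (U \<inter> coset S a) < \<infinity>"
      by (rule order.strict_trans1[OF emeasure_mono fin]) auto
    ultimately have "measure M (U \<inter> C) \<noteq> 0"
      unfolding C by (auto simp: measure_def enn2real_eq_0_iff)
    then show "C \<in> {C \<in> ?R. measure M (U \<inter> C) \<noteq> 0}"
      using C by blast
  qed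
  ultimately show ?thesis
    by (rule countable_subset[rotated])
qed

text \<open>Each level set \<open>E n\<close> has finite measure and thus meets only countably many
  cosets. Off their union the function vanishes identically, and not just almost everywhere.\<close>

lemma integrable_countable_cosets:
  fixes f :: "'g \<Rightarrow> 'b::{banach,second_countable_topology}"
  assumes f: "integrable M f"
  shows "countable {C \<in> range (coset S). \<exists>x\<in>C. f x \<noteq> 0}"
proof -
  define E where "E n = {x. 1 / real (Suc n) \<le> norm (f x)}" for n
  have [measurable]: "f \<in> borel_measurable borel"
    using borel_measurable_integrable[OF f] by simp
  have E [measurable]: "E n \<in> sets borel" for n
    unfolding E_def by measurable
  have "emeasure M (E n) < \<infinity>" for n
  proof -
    have "integrable M (\<lambda>x. indicator (E n) x :: real)"
    proof (rule Bochner_Integration.integrable_bound)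
      show "integrable M (\<lambda>x. real (Suc n) * norm (f x))"
        using f by simp
      show "AE x in M. norm (indicator (E n) x :: real) \<le> norm (real (Suc n) * norm (f x))"
        by (intro AE_I2) (auto simp: E_def indicator_def divide_simps mult.commute)
    qed simp
    then show ?thesis
      by (simp add: integrable_indicator_iff)
  qed
  then have "countable (\<Union>n. {C \<in> range (coset S). E n \<inter> C \<noteq> {}})"
    by (intro countable_UN countable_cosets E) auto
  moreover have "{C \<in> range (coset S). \<exists>x\<in>C. f x \<noteq> 0} \<subseteq> (\<Union>n. {C \<in> range (coset S). E n \<inter> C \<noteq> {}})"
  proof
    fix C assume "C \<in> {C \<in> range (coset S). \<exists>x\<in>C. f x \<noteq> 0}"
    then obtain x where x: "C \<in> range (coset S)" "x \<in> C" "f x \<noteq> 0"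
      by blast
    then obtain n where "inverse (real (Suc n)) < norm (f x)"
      using reals_Archimedean[of "norm (f x)"] by auto
    then have "x \<in> E n \<inter> C"
      using x by (simp add: E_def inverse_eq_divide)
    then show "C \<in> (\<Union>n. {C \<in> range (coset S). E n \<inter> C \<noteq> {}})"
      using x(1) by blast
  qed
  ultimately show ?thesis
    by (rule countable_subset[rotated])
qed


section \<open>Stone-Weierstrass and density of the characters on cosets\<close>

lemma trig_X_mult:
  assumes "\<phi> \<in> X" "q \<in> trig X"
  shows "(\<lambda>x. \<phi> x * q x) \<in> trig X"
  using assms(2)
proof induction
  case (add p q)
  then show ?case
    using trig.add by (simp add: distrib_left)
next
  case (cmult p c)
  then have "(\<lambda>x. c * (\<phi> x * p x)) \<in> trig X"
    by (intro trig.cmult)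
  then show ?case
    by (simp add: mult.left_commute)
qed (use assms(1) in \<open>auto intro: trig.base X_mult\<close>)

lemma trig_mult:
  assumes "p \<in> trig X" "q \<in> trig X"
  shows "(\<lambda>x. p x * q x) \<in> trig X"
  using assms(1)
proof induction
  case (add p p')
  then show ?case
    using trig.add by (simp add: distrib_right)
next
  case (cmult p c)
  then have "(\<lambda>x. c * (p x * q x)) \<in> trig X"
    by (intro trig.cmult)
  then show ?case
    by (simp add: mult.assoc)
qed (use assms(2) in \<open>auto intro: trig_X_mult\<close>)

lemma trig_const: "(\<lambda>_. c) \<in> trig X"
  using trig.cmult[OF trig.base[OF X_one], of c] by simp

lemma trig_continuous: "p \<in> trig X \<Longrightarrow> continuous_on UNIV p"
  by (induction rule: trig.induct) (auto intro: continuous_intros X_continuous)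

lemma trig_measurable: "p \<in> trig X \<Longrightarrow> p \<in> borel_measurable borel"
  by (rule borel_measurable_continuous_onI[OF trig_continuous])

lemma X_measurable: "\<phi> \<in> X \<Longrightarrow> \<phi> \<in> borel_measurable borel"
  by (rule trig_measurable[OF trig.base])

text \<open>\<open>X_cnj\<close> puts the real and imaginary parts of characters among the real
  members of the span, and one of the two separates any given pair of points.\<close>

lemma function_ring_trig:
  assumes "compact C"
  shows "function_ring_on {g. (\<lambda>x. complex_of_real (g x)) \<in> trig X} C"
proof
  fix g assume "g \<in> {g. (\<lambda>x. complex_of_real (g x)) \<in> trig X}"
  then have "continuous_on C (\<lambda>x. Re (complex_of_real (g x)))"
    by (intro continuous_on_Re continuous_on_subset[OF trig_continuous]) auto
  then show "continuous_on C g"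
    by simp
next
  fix x y :: 'g assume "x \<noteq> y"
  then obtain \<phi> where \<phi>: "\<phi> \<in> X" "\<phi> x \<noteq> \<phi> y"
    using X_separates by blast
  have re: "(\<lambda>x. (1 / 2) * \<phi> x + (1 / 2) * cnj (\<phi> x)) \<in> trig X"
    using \<phi> by (intro trig.add trig.cmult trig.base X_cnj)
  have im: "(\<lambda>x. (- \<i> / 2) * \<phi> x + (\<i> / 2) * cnj (\<phi> x)) \<in> trig X"
    using \<phi> by (intro trig.add trig.cmult trig.base X_cnj)
  have "(1 / 2) * \<phi> x + (1 / 2) * cnj (\<phi> x) = complex_of_real (Re (\<phi> x))"
    "(- \<i> / 2) * \<phi> x + (\<i> / 2) * cnj (\<phi> x) = complex_of_real (Im (\<phi> x))" for x
    by (auto simp: complex_eq_iff)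
  then have "(\<lambda>x. Re (\<phi> x)) \<in> {g. (\<lambda>x. complex_of_real (g x)) \<in> trig X}"
    "(\<lambda>x. Im (\<phi> x)) \<in> {g. (\<lambda>x. complex_of_real (g x)) \<in> trig X}"
    using re im by simp_all
  moreover have "Re (\<phi> x) \<noteq> Re (\<phi> y) \<or> Im (\<phi> x) \<noteq> Im (\<phi> y)"
    using \<phi>(2) by (auto simp: complex_eq_iff)
  ultimately show "\<exists>g\<in>{g. (\<lambda>x. complex_of_real (g x)) \<in> trig X}. g x \<noteq> g y"
    by (elim disjE) (rule bexI, assumption+)+
qed (use assms in \<open>auto intro: trig.add trig_mult trig_const\<close>)

text \<open>\<open>two\<close> is the approximate Urysohn lemma inside the proof of the
  Stone-Weierstrass theorem. It is applied to \<open>C\<close> and the complement of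
  \<open>U\<close> in the compact coset, and combines with regularity directly.\<close>

lemma trig_Urysohn:
  assumes "compact C" "C \<subseteq> U" "open U" "U \<subseteq> coset S a" "0 < e" "e < 1"
  obtains g where "(\<lambda>x. complex_of_real (g x)) \<in> trig X"
    "\<And>x. x \<in> coset S a \<Longrightarrow> 0 \<le> g x" "\<And>x. x \<in> coset S a \<Longrightarrow> g x \<le> 1"
    "\<And>x. x \<in> coset S a \<Longrightarrow> x \<notin> U \<Longrightarrow> g x < e" "\<And>x. x \<in> C \<Longrightarrow> g x > 1 - e"
proof -
  interpret function_ring_on "{g. (\<lambda>x. complex_of_real (g x)) \<in> trig X}" "coset S a"
    by (rule function_ring_trig[OF compact_coset])
  have "\<exists>g\<in>{g. (\<lambda>x. complex_of_real (g x)) \<in> trig X}. g ` coset S a \<subseteq> {0..1} \<and>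
      (\<forall>x\<in>coset S a - U. g x < e) \<and> (\<forall>x\<in>C. g x > 1 - e)"
    using assms compact_imp_closed[OF compact_coset] compact_imp_closed[OF assms(1)]
    by (intro two) auto
  then show ?thesis
    using that by (force simp: image_subset_iff)
qed

lemma coset_waves_L2: "coset_waves S X \<subseteq> L2 M"
proof
  fix f assume "f \<in> coset_waves S X"
  then obtain a \<phi> where f: "f = (\<lambda>x. indicator (coset S a) x * \<phi> x)" "\<phi> \<in> X"
    by (auto simp: coset_waves_def)
  show "f \<in> L2 M"
    unfolding f(1) using f(2) X_measurable[OF f(2)]
    by (intro L2_mult_bounded L2_indicator) (auto simp: X_norm)
qed

lemma trig_closed_span:
  assumes "p \<in> trig X"
  shows "(\<lambda>x. indicator (coset S a) x * p x) \<in> l2_closed_span M (coset_waves S X)"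
  using assms
proof induction
  case (base \<phi>)
  then have "(\<lambda>x. indicator (coset S a) x * \<phi> x) \<in> coset_waves S X"
    by (auto simp: coset_waves_def)
  then show ?case
    using coset_waves_L2 by (intro l2_closed_span_base) auto
next
  case (add p q)
  then show ?case
    using l2_closed_span_add[OF _ _ coset_waves_L2] by (simp add: distrib_left)
next
  case (cmult p c)
  then have "(\<lambda>x. c * (indicator (coset S a) x * p x)) \<in> l2_closed_span M (coset_waves S X)"
    by (intro l2_closed_span_cmult)
  then show ?case
    by (simp add: mult.left_commute)
qed

lemma indicator_coset_closed_span:
  assumes E: "E \<in> sets borel" "E \<subseteq> coset S a"
  shows "indicator E \<in> l2_closed_span M (coset_waves S X)"
proof (rule l2_closed_spanI[OF _ _ coset_waves_L2])
  have fin: "emeasure M F < \<infinity>" if "F \<subseteq> coset S a" for F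
    using emeasure_mono[OF that, of M] by (simp add: order.strict_trans1[of _ 1])
  show EL: "indicator E \<in> L2 M"
    using E fin by (intro L2_indicator) auto
  fix \<epsilon> :: real assume "\<epsilon> > 0"
  \<comment> \<open>Three terms of size at most \<open>e\<close> will bound the squared error, so
    \<open>3 * e\<close> has to stay below \<open>\<epsilon>\<^sup>2\<close>; the cap at
    \<open>1 / 2\<close> keeps \<open>e\<close> below 1.\<close>
  define e where "e = min (1 / 2) (\<epsilon>\<^sup>2 / 4)"
  have e: "0 < e" "e < 1" "3 * e < \<epsilon>\<^sup>2"
    using \<open>\<epsilon> > 0\<close> by (auto simp: e_def min_def)
  obtain U0 where U0: "open U0" "E \<subseteq> U0" "emeasure M U0 < emeasure M E + ennreal e"
    by (rule outer_approx[OF E(1) fin[OF E(2)] e(1)])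
  define U where "U = U0 \<inter> coset S a"
  have U: "open U" "E \<subseteq> U" "U \<subseteq> coset S a" "emeasure M U < emeasure M E + ennreal e"
    using U0 E open_coset order.strict_trans1[OF emeasure_mono U0(3), of U] by (auto simp: U_def)
  have Us [measurable]: "U \<in> sets borel"
    using U(1) by auto
  \<comment> \<open>Inner regularity is available for open sets only, so \<open>C\<close> exhausts
    \<open>U\<close> and not \<open>E\<close>. Where \<open>C\<close> leaves \<open>E\<close>, the
    error is charged to \<open>U - E\<close>.\<close>
  obtain C where C: "compact C" "C \<subseteq> U" "emeasure M U \<le> emeasure M C + ennreal e"
  proof (cases "emeasure M U = 0")
    case True
    then show ?thesis
      using that[of "{}"] by simp
  next
    case False
    then have "emeasure M U - ennreal e < emeasure M U"
      using fin[OF U(3)] e(1) by (intro ennreal_between) (auto simp: zero_less_iff_neq_zero)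
    then obtain C where C: "compact C" "C \<subseteq> U" "emeasure M U - ennreal e < emeasure M C"
      by (rule inner_approx[OF U(1)])
    then have "emeasure M U \<le> emeasure M C + ennreal e"
      by (metis ennreal_minus_le_iff add.commute less_imp_le top_greatest)
    then show ?thesis
      using that C by blast
  qed
  have Cs [measurable]: "C \<in> sets borel"
    using compact_imp_closed[OF C(1)] by auto
  have E' [measurable]: "E \<in> sets borel"
    by (rule E(1))
  have sub: "C \<subseteq> coset S a"
    using C(2) U(3) by blast
  have meas: "measure M (U - E) \<le> e" "measure M (U - C) \<le> e"
  proof -
    have "measure M U \<le> measure M E + e"
      using U(4) fin[OF U(3)] fin[OF E(2)] e(1)
      by (simp add: emeasure_eq_ennreal_measure less_top[symmetric] ennreal_plus[symmetric] 
          ennreal_less_iff del: ennreal_plus)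
    then show "measure M (U - E) \<le> e"
      using U(2) fin[OF U(3)] fin[OF E(2)] by (subst measure_Diff) auto
    have "measure M U \<le> measure M C + e"
      using C(3) fin[OF U(3)] fin[OF sub] e(1)
      by (simp add: emeasure_eq_ennreal_measure less_top[symmetric] ennreal_plus[symmetric]
          del: ennreal_plus)
    then show "measure M (U - C) \<le> e"
      using C(2) fin[OF U(3)] fin[OF sub] by (subst measure_Diff) auto
  qed
  obtain g where g: "(\<lambda>x. complex_of_real (g x)) \<in> trig X"
    "\<And>x. x \<in> coset S a \<Longrightarrow> 0 \<le> g x" "\<And>x. x \<in> coset S a \<Longrightarrow> g x \<le> 1"
    "\<And>x. x \<in> coset S a \<Longrightarrow> x \<notin> U \<Longrightarrow> g x < e" "\<And>x. x \<in> C \<Longrightarrow> g x > 1 - e"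
    using trig_Urysohn[OF C(1,2) U(1,3) e(1,2)] by blast
  define p where "p x = indicator (coset S a) x * complex_of_real (g x)" for x
  have p: "p \<in> l2_closed_span M (coset_waves S X)"
    unfolding p_def by (rule trig_closed_span[OF g(1)])
  have pL: "p \<in> L2 M"
    by (rule l2_closed_span_L2[OF p])
  \<comment> \<open>Inside the coset the deviation \<open>t\<close> is at most \<open>e\<close> on
    the intersection of \<open>C\<close> and \<open>E\<close> and off \<open>U\<close>, and at most
    1 on the two small sets that remain.\<close>
  have bound: "(cmod (indicator E x - p x))\<^sup>2 \<le>
      e * indicator (coset S a) x + indicator (U - E) x + indicator (U - C) x" for x
  proof (cases "x \<in> coset S a")
    case True
    define t where "t = \<bar>indicator E x - g x\<bar>"
    have eq: "(cmod (indicator E x - p x))\<^sup>2 = t\<^sup>2"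
      unfolding t_def p_def using True
      by (simp add: indicator_def norm_of_real flip: of_real_diff split: if_splits)
        (metis norm_of_real of_real_1 of_real_diff power2_abs)
    have t: "0 \<le> t" "t \<le> 1"
      using g(2,3)[OF True] by (auto simp: t_def indicator_def)
    have "t\<^sup>2 \<le> t"
      using t by (simp add: power2_eq_square mult_left_le)
    moreover have "t \<le> e" if "x \<in> C" "x \<in> E"
      using g(5)[OF that(1)] g(2,3)[OF True] that by (simp add: t_def)
    moreover have "t \<le> e" if "x \<notin> U"
      using g(4)[OF True that] g(2)[OF True] that U(2) by (auto simp: t_def indicator_def)
    ultimately show ?thesis
      unfolding eq using True t e(1) C(2) U(2) by (auto simp: indicator_def)
  next
    case False
    then show ?thesis
      using U(2,3) E(2) by (auto simp: p_def indicator_def)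
  qed
  have "(l2_norm M (\<lambda>x. indicator E x - p x))\<^sup>2 \<le>
      (LINT x|M. e * indicator (coset S a) x + indicator (U - E) x + indicator (U - C) x)"
    unfolding l2_norm_power2
  proof (rule integral_mono)
    show "integrable M (\<lambda>x. (cmod (indicator E x - p x))\<^sup>2)"
      by (rule L2_integrable[OF L2_diff[OF EL pL]])
    have "emeasure M (U - E) < \<infinity>" "emeasure M (U - C) < \<infinity>"
      using U(3) by (intro fin; blast)+
    then show "integrable M (\<lambda>x. e * indicator (coset S a) x + indicator (U - E) x + indicator (U - C) x :: real)"
      by (intro Bochner_Integration.integrable_add integrable_mult_right integrable_real_indicator) auto
  qed (rule bound)
  also have "\<dots> = e * measure M (coset S a) + measure M (U - E) + measure M (U - C)"
  proof -
    have "emeasure M (U - E) < \<infinity>" "emeasure M (U - C) < \<infinity>"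
      using U(3) by (intro fin; blast)+
    then show ?thesis
      by (subst Bochner_Integration.integral_add Bochner_Integration.integral_add;
        (intro Bochner_Integration.integrable_add integrable_mult_right integrable_real_indicator)?; simp?)+
  qed
  also have "\<dots> \<le> 3 * e"
    using meas by (simp add: measure_def)
  finally have "(l2_norm M (\<lambda>x. indicator E x - p x))\<^sup>2 < \<epsilon>\<^sup>2"
    using e(3) by linarith
  then have "l2_norm M (\<lambda>x. indicator E x - p x) < \<epsilon>"
    using \<open>\<epsilon> > 0\<close> by (simp add: power2_less_imp_less)
  then show "\<exists>g\<in>l2_closed_span M (coset_waves S X). l2_norm M (\<lambda>x. indicator E x - g x) < \<epsilon>"
    using p by blast
qed

text \<open>A set of finite measure meets countably many cosets, so its indicator is a dominated
  limit of finite sums of pieces that lie in one coset each.\<close>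

theorem coset_waves_dense:
  assumes "f \<in> L2 M"
  shows "f \<in> l2_closed_span M (coset_waves S X)"
proof (rule l2_closed_span_indicators[OF _ coset_waves_L2 assms])
  fix E assume E: "E \<in> sets M" "emeasure M E < \<infinity>"
  let ?CC = "{C \<in> range (coset S). E \<inter> C \<noteq> {}}"
  have count: "countable ?CC"
    using E by (intro countable_cosets) auto
  \<comment> \<open>The first \<open>n\<close> cosets of an enumeration. The later intersection with
    \<open>?CC\<close> guards the case that \<open>?CC\<close> is empty, where
    \<open>from_nat_into\<close> is unspecified.\<close>
  define F where "F n = from_nat_into ?CC ` {..<n}" for n
  define s where "s n x = (\<Sum>C\<in>F n \<inter> ?CC. indicator (E \<inter> C) x :: complex)" for n x
  have s_eq: "s n x = indicator (E \<inter> \<Union>(F n \<inter> ?CC)) x" for n x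
  proof -
    have "disjoint_family_on (\<lambda>C. C) (F n \<inter> ?CC)"
      by (rule disjoint_cosets[OF subgroup_S]) blast
    then have disj: "disjoint_family_on (\<lambda>C. E \<inter> C) (F n \<inter> ?CC)"
      unfolding disjoint_family_on_def by blast
    have "s n x = (\<Sum>C\<in>F n \<inter> ?CC. indicator (E \<inter> C) x * 1)"
      by (simp only: s_def mult_1_right)
    also have "\<dots> = indicator (E \<inter> \<Union>(F n \<inter> ?CC)) x"
      by (subst sum_indicator_disjoint[OF _ disj]) (simp_all add: F_def indicator_def)
    finally show ?thesis .
  qed
  show "indicator E \<in> l2_closed_span M (coset_waves S X)"
  proof (rule l2_closed_span_limit[OF _ _ coset_waves_L2])
    show "indicator E \<in> L2 M"
      by (rule L2_indicator[OF E])
    show "s n \<in> l2_closed_span M (coset_waves S X)" for n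
      unfolding s_def using E
      by (intro l2_closed_span_sum coset_waves_L2) (auto intro!: indicator_coset_closed_span)
    have "(\<lambda>n. s n x) \<longlonglongrightarrow> indicator E x" for x
    proof (cases "x \<in> E")
      case True
      then have "coset S x \<in> ?CC"
        using coset_self[OF subgroup_S] by blast
      then obtain k where k: "from_nat_into ?CC k = coset S x"
        using from_nat_into_surj[OF count] by blast
      have "s n x = indicator E x" if "n > k" for n
        unfolding s_eq F_def using True that k \<open>coset S x \<in> ?CC\<close> coset_self[OF subgroup_S, of x]
        by (auto simp: indicator_def intro!: bexI[of _ "coset S x"] image_eqI[of _ _ k])
      then show ?thesis
        by (intro tendsto_eventually eventually_mono[OF eventually_gt_at_top[of k]])
    next
      case False
      then show ?thesis
        by (simp add: s_eq)
    qed
    then show "AE x in M. (\<lambda>n. s n x) \<longlonglongrightarrow> indicator E x"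
      by simp
    show "cmod (s n x) \<le> 2 * cmod (indicator E x)" for n x
      unfolding s_eq by (auto simp: indicator_def)
  qed
qed

end

lemma integral_indicator_complex:
  "A \<in> sets M \<Longrightarrow> (LINT x|M. indicator A x :: complex) = of_real (measure M A)"
proof -
  assume A: "A \<in> sets M"
  have "(LINT x|M. indicator A x :: complex) = (LINT x|M. complex_of_real (indicator A x))"
    by (intro Bochner_Integration.integral_cong) (auto simp: indicator_def)
  then show ?thesis
    using A by (simp add: integral_complex_of_real)
qed

section \<open>Integrals of characters and uniqueness of Haar measure\<close>

context haar_group
begin

text \<open>Translating by an \<open>s\<close> in \<open>S\<close> multiplies the integral over
  \<open>S\<close> by \<open>\<phi> s\<close>, so it vanishes as soon as some
  \<open>\<phi> s\<close> differs from 1.\<close>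

lemma char_integral:
  assumes \<phi>: "\<phi> \<in> X"
  shows "(LINT x|M. indicator (coset S a) x * \<phi> x) = (if \<forall>x\<in>S. \<phi> x = 1 then \<phi> a else 0)"
proof -
  define J where "J = (LINT x|M. indicator S x * \<phi> x)"
  note [measurable] = X_measurable[OF \<phi>]
  have shift: "(LINT x|M. indicator (coset S a) x * \<phi> x) = \<phi> a * J" for a
  proof -
    have "(LINT x|M. indicator (coset S a) x * \<phi> x) =
        (LINT x|M. indicator (coset S a) (a + x) * \<phi> (a + x))"
      by (rule integral_plus[symmetric]) measurable
    also have "\<dots> = (LINT x|M. \<phi> a * (indicator S x * \<phi> x))"
      by (intro Bochner_Integration.integral_cong) (auto simp: X_plus[OF \<phi>] coset_iff indicator_def)
    finally show ?thesis
      by (simp add: J_def)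
  qed
  show ?thesis
  proof (cases "\<forall>x\<in>S. \<phi> x = 1")
    case True
    then have "J = (LINT x|M. indicator S x)"
      unfolding J_def by (intro Bochner_Integration.integral_cong) (auto simp: indicator_def)
    also have "\<dots> = 1"
      using emeasure_S by (simp add: integral_indicator_complex measure_def)
    finally show ?thesis
      using True shift by simp
  next
    case False
    then obtain s where s: "s \<in> S" "\<phi> s \<noteq> 1"
      by blast
    have "coset S s = S"
      using coset_eq[OF subgroup_S, of s 0] s(1) by (simp add: coset_zero)
    then have "J = \<phi> s * J"
      using shift[of s] by (simp add: J_def)
    then have "J = 0"
      using s(2) by (metis mult_cancel_right1)
    then show ?thesis
      unfolding if_not_P[OF False] using shift by simp
  qed
qed

lemma integrable_trig:
  assumes "p \<in> trig X"
  shows "integrable M (\<lambda>x. indicator (coset S a) x * p x)"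
proof -
  have "integrable M (\<lambda>x. (indicator (coset S a) x * p x) * cnj (indicator (coset S a) x))"
    by (intro integrable_L2_inner L2_indicator l2_closed_span_L2[OF trig_closed_span] assms) auto
  moreover have "(indicator (coset S a) x * p x) * cnj (indicator (coset S a) x) =
      indicator (coset S a) x * p x" for x
    by (simp add: indicator_def)
  ultimately show ?thesis
    by simp
qed

text \<open>The values found in \<open>char_integral\<close> depend on \<open>S\<close> and the
  character alone and not on the measure.\<close>

lemma trig_integral_eq:
  assumes M': "haar_group M' S X" and p: "p \<in> trig X"
  shows "(LINT x|M. indicator (coset S a) x * p x) = (LINT x|M'. indicator (coset S a) x * p x)"
proof -
  interpret M': haar_group M' S X
    by (rule M')
  show ?thesis
    using p
  proof induction
    case (base \<phi>)
    then show ?case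
      by (simp add: char_integral M'.char_integral)
  next
    case (add p q)
    then show ?case
      by (simp add: distrib_left integrable_trig M'.integrable_trig)
  next
    case (cmult p c)
    then show ?case
      by (simp add: mult.left_commute[of _ c])
  qed
qed

text \<open>The function \<open>g\<close> of \<open>trig_Urysohn\<close> has the same integral over
  the coset for both measures. That integral is at least \<open>(1 - e)\<close> times the
  \<open>M\<close>-measure of \<open>C\<close> and at most \<open>e\<close> plus the
  \<open>M'\<close>-measure of \<open>U\<close>, as the coset has measure 1.\<close>

lemma emeasure_compact_le_open:
  assumes M': "haar_group M' S X"
    and C: "compact C" "C \<subseteq> U" and U: "open U" "U \<subseteq> coset S a"
  shows "emeasure M C \<le> emeasure M' U"
proof -
  interpret M': haar_group M' S X
    by (rule M')
  have [measurable]: "C \<in> sets borel" "U \<in> sets borel"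
    using compact_imp_closed[OF C(1)] U by auto
  have fin: "emeasure M C < \<infinity>" "emeasure M' U < \<infinity>"
    using emeasure_compact[OF C(1)] emeasure_mono[OF U(2), of M'] by (auto simp: order.strict_trans1[of _ 1])
  have le: "measure M C - 2 * e \<le> measure M' U" if e: "0 < e" "e < 1" for e
  proof -
    obtain g where g: "(\<lambda>x. complex_of_real (g x)) \<in> trig X"
      "\<And>x. x \<in> coset S a \<Longrightarrow> 0 \<le> g x" "\<And>x. x \<in> coset S a \<Longrightarrow> g x \<le> 1"
      "\<And>x. x \<in> coset S a \<Longrightarrow> x \<notin> U \<Longrightarrow> g x < e" "\<And>x. x \<in> C \<Longrightarrow> g x > 1 - e"
      using trig_Urysohn[OF C U e] by blast
    have eq: "complex_of_real (indicator (coset S a) x * g x) =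
        indicator (coset S a) x * complex_of_real (g x)" for x
      by (simp add: indicator_def)
    have int: "integrable M (\<lambda>x. indicator (coset S a) x * g x)"
      "integrable M' (\<lambda>x. indicator (coset S a) x * g x)"
      using integrable_trig[OF g(1), of a] M'.integrable_trig[OF g(1), of a]
      unfolding eq[symmetric] complex_of_real_integrable_eq by simp_all
    have "(LINT x|M. (1 - e) * indicator C x) \<le> (LINT x|M. indicator (coset S a) x * g x)"
    proof (rule integral_mono)
      show "(1 - e) * indicator C x \<le> indicator (coset S a) x * g x" for x
        using g(2)[of x] g(5)[of x] C(2) U(2) e by (auto simp: indicator_def)
    qed (use fin int in auto)
    moreover have "(LINT x|M. indicator (coset S a) x * g x) = (LINT x|M'. indicator (coset S a) x * g x)"
      using trig_integral_eq[OF M' g(1), of a] unfolding eq[symmetric] integral_complex_of_real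
      by simp
    moreover have "(LINT x|M'. indicator (coset S a) x * g x) \<le>
        (LINT x|M'. indicator U x + e * indicator (coset S a) x)"
    proof (rule integral_mono)
      show "indicator (coset S a) x * g x \<le> indicator U x + e * indicator (coset S a) x" for x
        using g(3)[of x] g(4)[of x] U(2) e by (auto simp: indicator_def less_imp_le)
    qed (use fin int in auto)
    moreover have "measure M' (coset S a) = 1"
      by (simp add: measure_def)
    ultimately have "(1 - e) * measure M C \<le> measure M' U + e"
      using fin by simp
    moreover have "measure M C \<le> 1"
    proof -
      have "measure M C \<le> measure M (coset S a)"
        using C(2) U(2) by (intro measure_mono_fmeasurable) (auto intro: fmeasurableI)
      then show ?thesis
        by (simp add: measure_def)
    qed
    then have "e * measure M C \<le> e"
      using e by (simp add: mult_left_le)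
    ultimately show ?thesis
      by (simp add: left_diff_distrib)
  qed
  have "measure M C \<le> measure M' U"
  proof (rule field_le_epsilon)
    fix d :: real assume d: "d > 0"
    show "measure M C \<le> measure M' U + d"
      using le[of "d / 2"] le[of "1 / 2"] d by (cases "d \<le> 1") simp_all
  qed
  then show ?thesis
    using fin by (simp add: emeasure_eq_ennreal_measure less_top[symmetric] ennreal_leI)
qed

lemma emeasure_le_coset:
  assumes M': "haar_group M' S X" and E: "E \<in> sets borel" "E \<subseteq> coset S a"
  shows "emeasure M E \<le> emeasure M' E"
proof -
  interpret M': haar_group M' S X
    by (rule M')
  have fin: "emeasure M' E < \<infinity>"
    using emeasure_mono[OF E(2), of M'] by (auto simp: order.strict_trans1[of _ 1])
  show ?thesis
  proof (rule ennreal_le_epsilon)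
    fix e :: real assume e: "e > 0"
    obtain U0 where U0: "open U0" "E \<subseteq> U0" "emeasure M' U0 < emeasure M' E + ennreal e"
      by (rule M'.outer_approx[OF E(1) fin e])
    let ?U = "U0 \<inter> coset S a"
    have U: "open ?U" "?U \<subseteq> coset S a"
      using U0(1) open_coset by auto
    have "emeasure M E \<le> emeasure M ?U"
      using U0 E U(1) by (intro emeasure_mono) auto
    also have "\<dots> \<le> emeasure M' ?U"
    proof (rule ccontr)
      assume "\<not> ?thesis"
      then have "emeasure M' ?U < emeasure M ?U"
        by simp
      then obtain C where C: "compact C" "C \<subseteq> ?U" "emeasure M' ?U < emeasure M C"
        by (rule inner_approx[OF U(1)])
      then show False
        using emeasure_compact_le_open[OF M' C(1,2) U] by simp
    qed
    also have "\<dots> \<le> emeasure M' U0"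
      using U0(1) by (intro emeasure_mono) auto
    finally show "emeasure M E \<le> emeasure M' E + ennreal e"
      using U0(3) by simp
  qed
qed

lemma emeasure_le_compact:
  assumes M': "haar_group M' S X" and C: "compact C"
  shows "emeasure M C \<le> emeasure M' C"
proof -
  interpret M': haar_group M' S X
    by (rule M')
  have [measurable]: "C \<in> sets borel"
    using compact_imp_closed[OF C(1)] by auto
  obtain F where F: "finite F" "F \<subseteq> range (coset S)" "C \<subseteq> \<Union>F"
    by (rule compact_finite_cosets[OF C])
  have disj: "disjoint_family_on (\<lambda>D. C \<inter> D) F"
    using disjoint_cosets[OF subgroup_S F(2)] by (fastforce simp: disjoint_family_on_def)
  have C_eq: "C = (\<Union>D\<in>F. C \<inter> D)"
    using F(3) by blast
  have sets: "C \<inter> D \<in> sets borel" if "D \<in> F" for D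
    using that F(2) by auto
  have "emeasure M C = (\<Sum>D\<in>F. emeasure M (C \<inter> D))"
    using sets by (subst C_eq) (intro sum_emeasure[symmetric] disj F(1); auto)
  also have "\<dots> \<le> (\<Sum>D\<in>F. emeasure M' (C \<inter> D))"
  proof (rule sum_mono)
    fix D assume D: "D \<in> F"
    then obtain a where "D = coset S a"
      using F(2) by blast
    then show "emeasure M (C \<inter> D) \<le> emeasure M' (C \<inter> D)"
      using sets[OF D] by (intro emeasure_le_coset[OF M', where a = a]) auto
  qed
  also have "\<dots> = emeasure M' C"
    using sets by (subst (2) C_eq) (intro sum_emeasure disj F(1); auto)
  finally show ?thesis .
qed

text \<open>A general Borel set may meet uncountably many cosets, so additivity over cosets reaches
  only compact sets. Inner regularity carries the inequality on to open sets, and outer regularity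
  to all Borel sets.\<close>

lemma emeasure_le:
  assumes M': "haar_group M' S X" and E: "E \<in> sets borel"
  shows "emeasure M E \<le> emeasure M' E"
proof (cases "emeasure M' E < \<infinity>")
  case True
  interpret M': haar_group M' S X
    by (rule M')
  have le_open: "emeasure M U \<le> emeasure M' U" if U: "open U" for U
  proof (rule ccontr)
    assume "\<not> ?thesis"
    then have "emeasure M' U < emeasure M U"
      by simp
    then obtain C where C: "compact C" "C \<subseteq> U" "emeasure M' U < emeasure M C"
      by (rule inner_approx[OF U])
    have "emeasure M C \<le> emeasure M' C"
      by (rule emeasure_le_compact[OF M' C(1)])
    also have "\<dots> \<le> emeasure M' U"
      using U C(2) by (intro emeasure_mono) auto
    finally show False
      using C(3) by simp
  qed
  show ?thesis
  proof (rule ennreal_le_epsilon)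
    fix e :: real assume e: "e > 0"
    obtain U where U: "open U" "E \<subseteq> U" "emeasure M' U < emeasure M' E + ennreal e"
      by (rule M'.outer_approx[OF E True e])
    have "emeasure M E \<le> emeasure M U"
      using U E by (intro emeasure_mono) auto
    also have "\<dots> \<le> emeasure M' U"
      by (rule le_open[OF U(1)])
    finally show "emeasure M E \<le> emeasure M' E + ennreal e"
      using U(3) by simp
  qed
qed (simp add: top_unique less_top[symmetric])

theorem haar_unique:
  assumes "haar_group M' S X" and "E \<in> sets borel"
  shows "emeasure M' E = emeasure M E"
  using emeasure_le[OF assms] haar_group.emeasure_le[OF assms(1) _ assms(2)] haar_group_axioms
  by (intro antisym) auto

text \<open>The map taking \<open>E\<close> to the measure of \<open>A E\<close>, scaled to give
  \<open>S\<close> measure 1, is again a Haar measure, because a homeomorphism preserves open and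
  compact sets. By \<open>haar_unique\<close> it is \<open>M\<close>.\<close>

lemma
  assumes A: "Modules.additive A" "homeomorphism UNIV UNIV A A'"
  shows emeasure_automorphism_pos: "0 < emeasure M (A ` S)"
    and emeasure_automorphism_finite: "emeasure M (A ` S) < \<infinity>"
    and emeasure_automorphism: "\<And>E. E \<in> sets borel \<Longrightarrow> emeasure M (A ` E) = emeasure M (A ` S) * emeasure M E"
proof -
  have inv: "A' (A x) = x" "A (A' x) = x" for x
    using A(2) by (auto simp: homeomorphism_def)
  have cont: "continuous_on UNIV A" "continuous_on UNIV A'"
    using A(2) by (auto simp: homeomorphism_def)
  have image: "A ` E = A' -` E" for E
    using inv by (auto simp: image_iff intro!: exI[of _ "A' _"]) metis
  have image': "A' -` V = A ` V" "A -` (A ` V) = V" "A ` (A -` V) = V" for V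
    using inv by (auto simp: image image_iff)
  have open_image: "open (A ` E)" if "open E" for E
    unfolding image using that cont(2) by (rule open_vimage)
  have compact_image: "compact (A ` E)" if "compact E" for E
    using that by (intro compact_continuous_image continuous_on_subset[OF cont(1)]) auto
  have open_vim: "open (A -` E)" if "open E" for E
    using that cont(1) by (rule open_vimage)
  have vim: "A -` E = A' ` E" for E
    using inv by (auto simp: image_iff) metis
  have compact_vim: "compact (A -` E)" if "compact E" for E
    unfolding vim using that by (intro compact_continuous_image continuous_on_subset[OF cont(2)]) auto
  have [measurable]: "A' \<in> borel_measurable borel"
    by (rule borel_measurable_continuous_onI[OF cont(2)])
  have S': "open S" "compact S" "S \<noteq> {}"
    using compact_open subgroup_S by (auto simp: compact_open_subgroup_def dest: add_subgroup_zero)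
  define c where "c = emeasure M (A ` S)"
  have c: "0 < c" "c < \<infinity>"
    unfolding c_def using S'
    by (auto intro!: emeasure_open_pos open_image emeasure_compact[OF compact_image, unfolded infinity_ennreal_def])
  then show "0 < emeasure M (A ` S)" "emeasure M (A ` S) < \<infinity>"
    by (simp_all add: c_def)
  define r where "r = 1 / c"
  have rc: "r * c = 1" "c * r = 1"
    using c by (simp_all add: r_def ennreal_divide_times ennreal_times_divide)
  have r: "r < \<infinity>"
    using rc(2) c(1) by (cases "r = top") (auto simp: ennreal_mult_top less_top split: if_splits)
  define M' where "M' = scale_measure r (distr M borel A')"
  have sets_M': "sets M' = sets borel"
    by (simp add: M'_def)
  have M'_eq: "emeasure M' E = r * emeasure M (A ` E)" if "E \<in> sets borel" for E
    unfolding M'_def using that by (simp add: emeasure_distr image)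
  have "haar_measure M'"
    unfolding haar_measure_def
  proof (intro conjI allI ballI impI)
    show "sets M' = sets borel"
      by (rule sets_M')
    have "emeasure M' S = 1"
      using rc by (simp add: M'_eq c_def)
    then have "emeasure M' UNIV \<ge> 1"
      using emeasure_mono[of S UNIV M'] sets_M' by simp
    then show "emeasure M' UNIV \<noteq> 0"
      by auto
  next
    fix K :: "'g set" assume K: "compact K"
    then have "K \<in> sets borel"
      using borel_closed[OF compact_imp_closed[OF K]] by simp
    then show "emeasure M' K < \<infinity>"
      using emeasure_compact[OF compact_image[OF K]] r by (simp add: M'_eq ennreal_mult_less_top)
  next
    fix x :: 'g and E :: "'g set" assume E: "E \<in> sets borel"
    have "(+) x ` E = (+) (- x) -` E"
      by (rule plus_image)
    then have "(+) x ` E \<in> sets borel"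
      using E measurable_sets[OF plus_measurable E, of "- x"] by simp
    moreover have "A ` (+) x ` E = (+) (A x) ` A ` E"
      using A(1) by (simp add: image_image Modules.additive.add)
    moreover have "A ` E \<in> sets borel"
      unfolding image using measurable_sets[of A' borel borel E] E by simp
    ultimately show "emeasure M' ((+) x ` E) = emeasure M' E"
      using E by (simp only: M'_eq emeasure_plus)
  next
    fix E :: "'g set" assume E: "E \<in> sets borel"
    then have AE: "A ` E \<in> sets borel"
      unfolding image using measurable_sets[of A' borel borel E] E by simp
    show "emeasure M' E = (INF U\<in>{U. open U \<and> E \<subseteq> U}. emeasure M' U)"
    proof (rule antisym)
      show "emeasure M' E \<le> (INF U\<in>{U. open U \<and> E \<subseteq> U}. emeasure M' U)"
        by (intro INF_greatest emeasure_mono) (auto simp: sets_M')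
      define I where "I = (INF U\<in>{U. open U \<and> E \<subseteq> U}. emeasure M' U)"
      \<comment> \<open>As \<open>r * c = 1\<close>, scaling by \<open>c\<close> turns a lower bound
        for \<open>M'\<close> into one for \<open>M\<close>, so no factor has to be moved through an
        infimum.\<close>
      have "c * I \<le> emeasure M V" if V: "open V" "A ` E \<subseteq> V" for V
      proof -
        have "E \<subseteq> A -` V"
          using V(2) by blast
        then have "I \<le> emeasure M' (A -` V)"
          unfolding I_def using open_vim[OF V(1)] by (intro INF_lower) auto
        also have "\<dots> = r * emeasure M V"
          using open_vim[OF V(1)] by (subst M'_eq) (simp_all only: image' borel_open)
        finally have "c * I \<le> c * (r * emeasure M V)"
          by (intro mult_left_mono) auto
        then show ?thesis
          using rc by (simp add: mult.assoc[symmetric])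
      qed
      then have "c * I \<le> (INF V\<in>{V. open V \<and> A ` E \<subseteq> V}. emeasure M V)"
        by (intro INF_greatest) auto
      also have "\<dots> = emeasure M (A ` E)"
        using haar AE unfolding haar_measure_def by metis
      finally have "r * (c * I) \<le> r * emeasure M (A ` E)"
        by (intro mult_left_mono) auto
      then show "I \<le> emeasure M' E"
        using rc E by (simp add: mult.assoc[symmetric] M'_eq)
    qed
  next
    fix U :: "'g set" assume U: "open U"
    show "emeasure M' U = (SUP K\<in>{K. compact K \<and> K \<subseteq> U}. emeasure M' K)"
    proof (rule antisym)
      have "emeasure M' U = r * emeasure M (A ` U)"
        using U by (simp add: M'_eq)
      also have "emeasure M (A ` U) = (SUP K\<in>{K. compact K \<and> K \<subseteq> A ` U}. emeasure M K)"
        using haar open_image[OF U] unfolding haar_measure_def by blast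
      also have "r * \<dots> = (SUP K\<in>{K. compact K \<and> K \<subseteq> A ` U}. r * emeasure M K)"
        by (rule SUP_mult_left_ennreal)
      also have "\<dots> \<le> (SUP K\<in>{K. compact K \<and> K \<subseteq> U}. emeasure M' K)"
      proof (rule SUP_mono)
        fix K assume "K \<in> {K. compact K \<and> K \<subseteq> A ` U}"
        then have K: "compact K" "K \<subseteq> A ` U"
          by auto
        have "A -` K \<subseteq> U"
          using K(2) image'(2) by blast
        moreover have "emeasure M' (A -` K) = r * emeasure M K"
          using borel_closed[OF compact_imp_closed[OF compact_vim[OF K(1)]]]
          by (subst M'_eq) (simp_all only: image')
        ultimately show "\<exists>K'\<in>{K. compact K \<and> K \<subseteq> U}. r * emeasure M K \<le> emeasure M' K'"
          using compact_vim[OF K(1)] by (intro bexI[of _ "A -` K"]) auto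
      qed
      finally show "emeasure M' U \<le> (SUP K\<in>{K. compact K \<and> K \<subseteq> U}. emeasure M' K)" .
      show "(SUP K\<in>{K. compact K \<and> K \<subseteq> U}. emeasure M' K) \<le> emeasure M' U"
        using U by (intro SUP_least emeasure_mono) (auto simp: sets_M')
    qed
  qed
  moreover note compact_open
  moreover have "emeasure M' S = 1"
    using rc by (simp add: M'_eq c_def)
  ultimately have "haar_group M' S X"
    using continuous_plus X_continuous X_norm X_plus X_one X_mult X_cnj X_separates
    by (rule haar_group.intro)
  then have eq: "r * emeasure M (A ` E) = emeasure M E" if "E \<in> sets borel" for E
    using haar_unique[OF _ that, of M'] unfolding M'_eq[OF that] by blast
  show "emeasure M (A ` E) = emeasure M (A ` S) * emeasure M E" if "E \<in> sets borel" for E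
    unfolding eq[OF that, symmetric] mult.assoc[symmetric] c_def[symmetric] rc by simp
qed

end

section \<open>Extension of characters\<close>

definition int_scale :: "int \<Rightarrow> 'a::ab_group_add \<Rightarrow> 'a" where
  "int_scale k y = (\<Sum>i<nat k. y) - (\<Sum>i<nat (- k). y)"

lemma int_scale_0 [simp]: "int_scale 0 y = 0"
  and int_scale_1 [simp]: "int_scale 1 y = y"
  by (simp_all add: int_scale_def)

lemma int_scale_plus_1: "int_scale (k + 1) y = int_scale k y + y"
proof (cases "k \<ge> 0")
  case True
  then have "nat (k + 1) = Suc (nat k)" "nat (- k) = 0" "nat (- (k + 1)) = 0"
    by simp_all
  then show ?thesis
    by (simp add: int_scale_def)
next
  case False
  then have "nat (- k) = Suc (nat (- (k + 1)))" "nat k = 0" "nat (k + 1) = 0"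
    by simp_all
  then show ?thesis
    by (simp add: int_scale_def)
qed

lemma int_scale_minus_1: "int_scale (k - 1) y = int_scale k y - y"
  using int_scale_plus_1[of "k - 1" y] by simp

lemma int_scale_add: "int_scale (j + k) y = int_scale j y + int_scale k y"
proof (induction k rule: int_induct[where k = 0])
  case (step1 i)
  then show ?case
    using int_scale_plus_1[of "j + i" y] int_scale_plus_1[of i y] by (simp add: add.assoc)
next
  case (step2 i)
  then show ?case
    by (simp only: add_diff_eq int_scale_minus_1)
qed simp

lemma int_scale_diff: "int_scale (j - k) y = int_scale j y - int_scale k y"
  using int_scale_add[of "j - k" k y] by (simp add: algebra_simps)

lemma int_scale_mult: "int_scale (m * q) y = int_scale q (int_scale m y)"
proof (induction q rule: int_induct[where k = 0])
  case (step1 i)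
  then show ?case
    by (simp add: distrib_left int_scale_add int_scale_plus_1)
next
  case (step2 i)
  then show ?case
    by (simp add: right_diff_distrib int_scale_diff)
qed simp

text \<open>The graph of a unimodular character on some subgroup: closure under differences and
  quotients makes the domain a subgroup, and the last clause makes the relation single-valued. As
  graphs, extensions are ordered by inclusion, ready for Zorn's lemma.\<close>

definition partial_character :: "('a::ab_group_add \<times> complex) set \<Rightarrow> bool" where
  "partial_character R \<longleftrightarrow> (0, 1) \<in> R \<and>
     (\<forall>x a y b. (x, a) \<in> R \<longrightarrow> (y, b) \<in> R \<longrightarrow> (x - y, a / b) \<in> R) \<and>
     (\<forall>x a. (x, a) \<in> R \<longrightarrow> cmod a = 1) \<and> (\<forall>a. (0, a) \<in> R \<longrightarrow> a = 1)"

lemma partial_characterD: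
  assumes "partial_character R"
  shows "(0, 1) \<in> R" and "(x, a) \<in> R \<Longrightarrow> (y, b) \<in> R \<Longrightarrow> (x - y, a / b) \<in> R"
    and "(x, a) \<in> R \<Longrightarrow> cmod a = 1" and "(0, a) \<in> R \<Longrightarrow> a = 1"
  using assms unfolding partial_character_def by blast+

lemma partial_character_plus:
  assumes R: "partial_character R" and "(x, a) \<in> R" "(y, b) \<in> R"
  shows "(x + y, a * b) \<in> R"
proof -
  have "(0 - y, 1 / b) \<in> R"
    using assms partial_characterD[OF R] by blast
  then have "(x - (0 - y), a / (1 / b)) \<in> R"
    using assms partial_characterD[OF R] by blast
  then show ?thesis
    by simp
qed

lemma partial_character_unique:
  assumes R: "partial_character R" and "(x, a) \<in> R" "(x, b) \<in> R"
  shows "a = b"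
proof -
  have "(x - x, a / b) \<in> R"
    using assms partial_characterD[OF R] by blast
  then have "a / b = 1"
    by (intro partial_characterD(4)[OF R]) simp
  moreover have "b \<noteq> 0"
    using partial_characterD(3)[OF R assms(3)] by auto
  ultimately show ?thesis
    by simp
qed

lemma partial_character_int_scale:
  assumes R: "partial_character R" and x: "(x, a) \<in> R"
  shows "(int_scale k x, a powi k) \<in> R"
proof (induction k rule: int_induct[where k = 0])
  case base
  then show ?case
    using partial_characterD(1)[OF R] by simp
next
  have a: "a \<noteq> 0"
    using partial_characterD(3)[OF R x] by auto
  case (step1 i)
  then show ?case
    using partial_character_plus[OF R step1(2) x] a by (simp add: int_scale_plus_1 power_int_add)
next
  have a: "a \<noteq> 0"
    using partial_characterD(3)[OF R x] by auto
  case (step2 i)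
  then show ?case
    using partial_characterD(2)[OF R step2(2) x] a by (simp add: int_scale_minus_1 power_int_diff)
qed

text \<open>The only obstruction to prescribing \<open>c\<close> at \<open>y\<close> comes from
  multiples of \<open>y\<close> already in the domain. Given \<open>compat\<close>, the relation
  generated by \<open>R\<close> and \<open>(y, c)\<close> takes only the value 1 at 0, which
  suffices for single-valuedness.\<close>

lemma partial_character_adjoin:
  assumes R: "partial_character R" and c: "cmod c = 1"
    and compat: "\<And>k b. (int_scale k y, b) \<in> R \<Longrightarrow> b = c powi k"
  shows "\<exists>R'. partial_character R' \<and> R \<subseteq> R' \<and> (y, c) \<in> R'"
proof -
  define R' where "R' = {(x + int_scale k y, a * c powi k) | x a k. (x, a) \<in> R}"
  have c0: "c \<noteq> 0"
    using c by auto
  have "partial_character R'"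
    unfolding partial_character_def
  proof (intro conjI allI impI)
    show "(0, 1) \<in> R'"
      unfolding R'_def using partial_characterD(1)[OF R] by (force intro: exI[of _ 0])
  next
    fix x a y' b assume "(x, a) \<in> R'" "(y', b) \<in> R'"
    then obtain x1 a1 k1 x2 a2 k2 where
      1: "x = x1 + int_scale k1 y" "a = a1 * c powi k1" "(x1, a1) \<in> R" and
      2: "y' = x2 + int_scale k2 y" "b = a2 * c powi k2" "(x2, a2) \<in> R"
      unfolding R'_def by blast
    have "x - y' = (x1 - x2) + int_scale (k1 - k2) y" "a / b = (a1 / a2) * c powi (k1 - k2)"
      using c0 by (simp_all add: 1 2 int_scale_diff power_int_diff algebra_simps)
    moreover have "(x1 - x2, a1 / a2) \<in> R"
      using 1 2 partial_characterD(2)[OF R] by blast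
    ultimately show "(x - y', a / b) \<in> R'"
      unfolding R'_def by blast
  next
    fix x a assume "(x, a) \<in> R'"
    then show "cmod a = 1"
      unfolding R'_def using partial_characterD(3)[OF R] c
      by (auto simp: norm_mult norm_power_int)
  next
    fix a assume "(0, a) \<in> R'"
    then obtain x1 a1 k1 where
      1: "0 = x1 + int_scale k1 y" "a = a1 * c powi k1" "(x1, a1) \<in> R"
      unfolding R'_def by blast
    then have "int_scale k1 y = 0 - x1"
      by (metis add_diff_cancel_left')
    then have "(int_scale k1 y, 1 / a1) \<in> R"
      using partial_characterD(2)[OF R partial_characterD(1)[OF R] 1(3)] by simp
    then have "1 / a1 = c powi k1"
      by (rule compat)
    then show "a = 1"
      using 1 c0 partial_characterD(3)[OF R 1(3)] by (auto simp flip: \<open>1 / a1 = c powi k1\<close>)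
  qed
  moreover have "R \<subseteq> R'"
    unfolding R'_def by (force intro: exI[of _ 0])
  moreover have "(y, c) \<in> R'"
    unfolding R'_def using partial_characterD(1)[OF R] by (force intro: exI[of _ 1])
  ultimately show ?thesis
    by blast
qed

text \<open>The last clause is what separates points: starting from the trivial character, the value
  at a new point can be kept different from 1.\<close>

lemma partial_character_extend:
  assumes R: "partial_character R"
  shows "\<exists>R' c. partial_character R' \<and> R \<subseteq> R' \<and> (y, c) \<in> R' \<and>
    (snd ` R \<subseteq> {1} \<longrightarrow> y \<notin> Domain R \<longrightarrow> c \<noteq> 1)"
proof -
  let ?P = "\<lambda>m::nat. 0 < m \<and> int_scale (int m) y \<in> Domain R"
  show ?thesis
  proof (cases "\<exists>m. ?P m")
    case False
    \<comment> \<open>Only \<open>k = 0\<close> occurs, so any unimodular value is compatible;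
      \<open>- 1\<close> is taken because it differs from 1.\<close>
    have "b = (- 1) powi k" if b: "(int_scale k y, b) \<in> R" for k b
    proof (cases "k = 0")
      case True
      then show ?thesis
        using partial_characterD(4)[OF R] that by simp
    next
      case False
      have "(0 - int_scale k y, 1 / b) \<in> R"
        by (rule partial_characterD(2)[OF R partial_characterD(1)[OF R] that])
      then have "int_scale (- k) y \<in> Domain R" "int_scale k y \<in> Domain R"
        using b int_scale_diff[of 0 k y] by auto
      then have "?P (nat \<bar>k\<bar>)"
        using False by (auto simp: abs_if)
      then show ?thesis
        using \<open>\<nexists>m. ?P m\<close> by blast
    qed
    then show ?thesis
      using partial_character_adjoin[OF R, of "- 1" y] by (metis norm_minus_cancel norm_one one_neq_neg_one)
  next
    case True
    define m where "m = (LEAST m. ?P m)"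
    have m: "?P m"
      unfolding m_def using True by (rule LeastI_ex)
    have least: "m \<le> k" if "?P k" for k
      unfolding m_def using that by (rule Least_le)
    obtain b where b: "(int_scale (int m) y, b) \<in> R"
      using m by blast
    \<comment> \<open>An \<open>m\<close>-th root of \<open>b\<close>. The extra
      \<open>2 * pi\<close> avoids the root 1 when \<open>b = 1\<close> and
      \<open>m \<ge> 2\<close>, as the last clause of the statement demands.\<close>
    define c where "c = cis ((Arg b + 2 * pi) / real m)"
    have cb: "c powi int m = b"
    proof -
      have "c ^ m = cis (Arg b + 2 * pi)"
        unfolding c_def using m by (simp add: Complex.DeMoivre)
      also have "\<dots> = cis (Arg b)"
        by (simp add: cis.ctr)
      also have "\<dots> = b"
        using partial_characterD(3)[OF R b] by (subst cis_Arg) (auto simp: sgn_eq)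
      finally show ?thesis
        by (simp add: power_int_def)
    qed
    have compat: "b' = c powi k" if b': "(int_scale k y, b') \<in> R" for k b'
    proof -
      \<comment> \<open>By minimality of \<open>m\<close>, division with remainder shows that every
        multiple of \<open>y\<close> in the domain is already a multiple of
        \<open>int_scale (int m) y\<close>.\<close>
      define q where "q = k div int m"
      define r where "r = k mod int m"
      have k: "k = int m * q + r"
        by (simp add: q_def r_def)
      have mq: "(int_scale (int m * q) y, b powi q) \<in> R"
        unfolding int_scale_mult by (rule partial_character_int_scale[OF R b])
      have "int_scale r y = int_scale k y - int_scale (int m * q) y"
        by (simp add: k int_scale_add)
      then have "int_scale r y \<in> Domain R"
        using partial_characterD(2)[OF R b' mq] by auto
      moreover have "0 \<le> r" "r < int m"
        using m by (simp_all add: r_def)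
      ultimately have "r = 0"
        using least[of "nat r"] by (cases "r = 0") auto
      then have "(int_scale k y, b powi q) \<in> R"
        using mq k by simp
      then have "b' = b powi q"
        by (rule partial_character_unique[OF R b'])
      then show ?thesis
        using \<open>r = 0\<close> k cb by (simp add: power_int_mult)
    qed
    have "c \<noteq> 1" if "snd ` R \<subseteq> {1}" "y \<notin> Domain R"
    proof
      assume "c = 1"
      have "b = 1"
        using that(1) b by force
      then have Arg: "Arg b = 0"
        by simp
      have "m \<noteq> 1"
        using m that(2) by auto
      then have "2 \<le> m"
        using m by simp
      have "cos (2 * pi / real m) = 1"
        using arg_cong[OF \<open>c = 1\<close>, of Re] by (simp add: c_def Arg)
      moreover have "0 < 2 * pi / real m" "2 * pi / real m \<le> pi"
        using \<open>2 \<le> m\<close> by (auto simp: field_simps)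
      ultimately show False
        using cos_monotone_0_pi[of 0 "2 * pi / real m"] by simp
    qed
    moreover have "cmod c = 1"
      by (simp add: c_def)
    ultimately show ?thesis
      using partial_character_adjoin[OF R _ compat] by blast
  qed
qed

text \<open>Such a map is constant on the open cosets of \<open>L\<close>, hence locally
  constant.\<close>

lemma continuous_on_trivial_on_open_subgroup:
  fixes \<rho> :: "'a::topological_ab_group_add \<Rightarrow> complex"
  assumes L: "add_subgroup L" "open L" and add: "\<And>x y. \<rho> (x + y) = \<rho> x * \<rho> y"
    and triv: "\<And>x. x \<in> L \<Longrightarrow> \<rho> x = 1"
  shows "continuous_on UNIV \<rho>"
proof -
  have op: "open (coset L x)" for x
  proof -
    have "coset L x = (\<lambda>y. y - x) -` L"
      by (auto simp: coset_iff)
    then show ?thesis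
      using L(2) by (simp add: open_vimage continuous_on_diff continuous_on_id continuous_on_const)
  qed
  have "open (\<rho> -` U)" for U
  proof -
    have "\<rho> y = \<rho> x" if "y \<in> coset L x" for x y
    proof -
      have "\<rho> (x + (y - x)) = \<rho> x * \<rho> (y - x)"
        by (rule add)
      then show ?thesis
        using triv that by (simp add: coset_iff)
    qed
    then have "\<rho> -` U = (\<Union>x\<in>\<rho> -` U. coset L x)"
      using coset_self[OF L(1)] by fastforce
    then show ?thesis
      using op by (metis open_UN)
  qed
  then show ?thesis
    by (simp add: continuous_on_open_vimage)
qed

text \<open>A maximal extension of the trivial character of \<open>L\<close> is defined everywhere.
  Being trivial on the open \<open>L\<close>, it is continuous, so a purely algebraic extension is
  enough.\<close>

theorem characters_separate_open_subgroup:
  fixes L :: "'a::topological_ab_group_add set"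
  assumes L: "add_subgroup L" "open L" and x: "x \<notin> L"
  shows "\<exists>\<gamma>. (\<forall>y\<in>L. pairing y \<gamma> = 1) \<and> pairing x \<gamma> \<noteq> 1"
proof -
  have "partial_character (L \<times> {1})"
    using L(1) by (auto simp: partial_character_def add_subgroup_zero add_subgroup_diff)
  moreover have "snd ` (L \<times> {1 :: complex}) \<subseteq> {1}" "x \<notin> Domain (L \<times> {1 :: complex})"
    using x by auto
  ultimately obtain R1 c where R1: "partial_character R1" "L \<times> {1} \<subseteq> R1" "(x, c) \<in> R1" "c \<noteq> 1"
    using partial_character_extend[of "L \<times> {1}" x] by blast
  \<comment> \<open>Zorn's lemma runs over extensions of \<open>R1\<close>, where the value at
    \<open>x\<close> is already fixed to be different from 1.\<close>
  let ?A = "{R. partial_character R \<and> R1 \<subseteq> R}"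
  have "\<exists>R\<in>?A. \<forall>R'\<in>?A. R \<subseteq> R' \<longrightarrow> R' = R"
  proof (rule subset_Zorn_nonempty)
    show "?A \<noteq> {}"
      using R1 by blast
  next
    fix \<C> assume "\<C> \<noteq> {}" and ch: "subset.chain ?A \<C>"
    have mem: "partial_character R" "R1 \<subseteq> R" if "R \<in> \<C>" for R
      using that ch by (auto simp: subset.chain_def)
    have dir: "\<exists>R\<in>\<C>. p \<in> R \<and> q \<in> R" if pq: "p \<in> \<Union>\<C>" "q \<in> \<Union>\<C>" for p q
    proof -
      obtain R S where "R \<in> \<C>" "p \<in> R" "S \<in> \<C>" "q \<in> S"
        using pq by blast
      moreover have "R \<subseteq> S \<or> S \<subseteq> R"
        using \<open>R \<in> \<C>\<close> \<open>S \<in> \<C>\<close> ch by (auto simp: subset_chain_def)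
      ultimately show ?thesis
        by blast
    qed
    have "partial_character (\<Union>\<C>)"
      unfolding partial_character_def
    proof (intro conjI allI impI)
      show "(0, 1) \<in> \<Union>\<C>"
        using \<open>\<C> \<noteq> {}\<close> mem(1) partial_characterD(1) by blast
    next
      fix x a y b assume "(x, a) \<in> \<Union>\<C>" "(y, b) \<in> \<Union>\<C>"
      then obtain R where "R \<in> \<C>" "(x, a) \<in> R" "(y, b) \<in> R"
        using dir by blast
      then show "(x - y, a / b) \<in> \<Union>\<C>"
        using partial_characterD(2)[OF mem(1)] by blast
    next
      fix x a assume "(x, a) \<in> \<Union>\<C>"
      then show "cmod a = 1"
        using partial_characterD(3)[OF mem(1)] by blast
    next
      fix a assume "(0, a) \<in> \<Union>\<C>"
      then show "a = 1"
        using partial_characterD(4)[OF mem(1)] by blast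
    qed
    then show "\<Union>\<C> \<in> ?A"
      using \<open>\<C> \<noteq> {}\<close> mem(2) by blast
  qed
  then obtain R where R: "partial_character R" "R1 \<subseteq> R"
    and max: "\<And>R'. partial_character R' \<Longrightarrow> R \<subseteq> R' \<Longrightarrow> R' = R"
    by (auto dest: order_trans)
  have total: "\<exists>a. (y, a) \<in> R" for y
    using partial_character_extend[OF R(1), of y] max by blast
  define \<rho> where "\<rho> y = (SOME a. (y, a) \<in> R)" for y
  have \<rho>: "(y, \<rho> y) \<in> R" for y
    unfolding \<rho>_def using total by (rule someI_ex)
  have \<rho>_eq: "\<rho> y = a" if "(y, a) \<in> R" for y a
    using partial_character_unique[OF R(1) \<rho> that] .
  have add: "\<rho> (y + z) = \<rho> y * \<rho> z" for y z
    by (rule \<rho>_eq) (rule partial_character_plus[OF R(1) \<rho> \<rho>])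
  have triv: "\<rho> y = 1" if "y \<in> L" for y
    using that R1(2) R(2) by (intro \<rho>_eq) auto
  have "continuous_on UNIV \<rho>"
    by (rule continuous_on_trivial_on_open_subgroup[OF L add triv])
  moreover have "cmod (\<rho> y) = 1" for y
    by (rule partial_characterD(3)[OF R(1) \<rho>])
  ultimately have "dual_apply (Dual \<rho>) = \<rho>"
    using add by (subst Dual_inverse) auto
  moreover have "\<rho> x = c"
    using R1(3) R(2) by (intro \<rho>_eq) auto
  ultimately show ?thesis
    using triv R1(4) by (intro exI[of _ "Dual \<rho>"]) auto
qed

section \<open>Topology of the dual group\<close>

lemma open_dual_basic:
  "compact K \<Longrightarrow> open U \<Longrightarrow> open {\<gamma>. dual_apply \<gamma> ` K \<subseteq> U}"
  unfolding open_dual_def by (rule generate_topology.Basis) blast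

text \<open>Preimages commute with intersections and unions, so induction over the generated
  topology reduces continuity to the subbase.\<close>

lemma continuous_on_into_dual:
  assumes "\<And>K U. compact K \<Longrightarrow> open U \<Longrightarrow> openin (top_of_set S) (S \<inter> f -` {\<gamma>. dual_apply \<gamma> ` K \<subseteq> U})"
  shows "continuous_on S (f :: 'b::topological_space \<Rightarrow> 'a::topological_ab_group_add dual)"
proof -
  have "openin (top_of_set S) (S \<inter> f -` V)" if "open V" for V
    using that unfolding open_dual_def
  proof induction
    case (Int V V')
    have "S \<inter> f -` (V \<inter> V') = (S \<inter> f -` V) \<inter> (S \<inter> f -` V')"
      by blast
    then show ?case
      using Int by (simp add: openin_Int)
  next
    case (UN \<V>)
    have "S \<inter> f -` (\<Union>\<V>) = (\<Union>V\<in>\<V>. S \<inter> f -` V)"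
      by blast
    then show ?case
      using UN(2) by (simp only:) (rule openin_Union, blast)
  qed (use assms in auto)
  then show ?thesis
    unfolding continuous_on_open_invariant openin_open by (metis Int_commute)
qed

lemma continuous_on_pairing: "continuous_on UNIV (\<lambda>\<gamma>. pairing x \<gamma>)"
proof -
  have "open ((\<lambda>\<gamma>. pairing x \<gamma>) -` U)" if "open U" for U
    using open_dual_basic[of "{x}" U] that by (simp add: vimage_def)
  then show ?thesis
    by (simp add: continuous_on_open_vimage)
qed

instance dual :: (topological_ab_group_add) t2_space
proof
  fix \<gamma> \<gamma>' :: "'a dual" assume "\<gamma> \<noteq> \<gamma>'"
  then obtain x where "pairing x \<gamma> \<noteq> pairing x \<gamma>'"
    by (metis dual_apply_inject ext)
  then obtain U V where UV: "open U" "open V" "pairing x \<gamma> \<in> U" "pairing x \<gamma>' \<in> V" "U \<inter> V = {}"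
    by (rule hausdorff[elim_format]) blast
  have "open ((\<lambda>\<gamma>. pairing x \<gamma>) -` U)" "open ((\<lambda>\<gamma>. pairing x \<gamma>) -` V)"
    using UV continuous_on_pairing by (auto intro: open_vimage)
  then show "\<exists>U V. open U \<and> open V \<and> \<gamma> \<in> U \<and> \<gamma>' \<in> V \<and> U \<inter> V = {}"
    using UV by (intro exI[of _ "(\<lambda>\<gamma>. pairing x \<gamma>) -` U"] exI[of _ "(\<lambda>\<gamma>. pairing x \<gamma>) -` V"]) auto
qed

lemma dual_apply_0 [simp]: "dual_apply \<gamma> 0 = 1"
  using dual_apply_add[of \<gamma> 0 0] dual_apply_nonzero[of \<gamma> 0] by simp

lemma dual_apply_mult_cnj [simp]: "dual_apply \<gamma> x * cnj (dual_apply \<gamma> x) = 1"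
  using complex_norm_square[of "dual_apply \<gamma> x"] by (simp add: norm_dual_apply)

lemma dual_apply_minus: "dual_apply \<gamma> (- x) = cnj (dual_apply \<gamma> x)"
proof -
  have "dual_apply \<gamma> x * dual_apply \<gamma> (- x) = dual_apply \<gamma> x * cnj (dual_apply \<gamma> x)"
    using dual_apply_add[of \<gamma> x "- x"] by simp
  then show ?thesis
    by (simp only: mult_left_cancel[OF dual_apply_nonzero])
qed

lemma dual_apply_diff: "dual_apply \<gamma> (x - y) = dual_apply \<gamma> x * cnj (dual_apply \<gamma> y)"
  using dual_apply_add[of \<gamma> x "- y"] by (simp add: dual_apply_minus)

lemma dual_apply_dual_diff: "dual_apply (\<gamma> - \<gamma>') x = dual_apply \<gamma> x * cnj (dual_apply \<gamma>' x)"
  by (simp only: diff_conv_add_uminus dual_apply_plus dual_apply_uminus)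

text \<open>A subbasic condition on \<open>\<sigma> + \<gamma>\<close> over \<open>K\<close> is not
  a subbasic condition on \<open>\<gamma>\<close>, since \<open>\<sigma>\<close> varies over
  \<open>K\<close>. Therefore \<open>K\<close> is cut into finitely many compact pieces on which
  \<open>\<sigma>\<close> and the centre are nearly constant.\<close>

lemma continuous_on_dual_plus: "continuous_on UNIV ((+) (\<sigma> :: 'a::topological_ab_group_add dual))"
proof (rule continuous_on_into_dual)
  fix K :: "'a set" and U :: "complex set" assume K: "compact K" and U: "open U"
  have "open ((+) \<sigma> -` {\<gamma>. dual_apply \<gamma> ` K \<subseteq> U})"
  proof (rule Topological_Spaces.openI)
    fix \<gamma>\<^sub>0 assume \<gamma>0: "\<gamma>\<^sub>0 \<in> (+) \<sigma> -` {\<gamma>. dual_apply \<gamma> ` K \<subseteq> U}"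
    then have in_U: "pairing x \<sigma> * pairing x \<gamma>\<^sub>0 \<in> U" if "x \<in> K" for x
      using that by (auto simp: dual_apply_plus)
    have "\<exists>e. e > 0 \<and> ball (pairing x \<sigma> * pairing x \<gamma>\<^sub>0) e \<subseteq> U" if "x \<in> K" for x
      using U in_U[OF that] openE by blast
    then obtain e where e: "\<And>x. x \<in> K \<Longrightarrow> e x > 0"
      "\<And>x. x \<in> K \<Longrightarrow> ball (pairing x \<sigma> * pairing x \<gamma>\<^sub>0) (e x) \<subseteq> U"
      by metis
    \<comment> \<open>The open sets \<open>N\<close> serve to extract a finite cover; their closed
      counterparts \<open>Q\<close> are compact and so define subbasic neighbourhoods. The fractions
      add up to \<open>e x / 2 + e x / 4 < e x\<close>.\<close>
    define N where "N r x = {y. dist (pairing y \<gamma>\<^sub>0) (pairing x \<gamma>\<^sub>0) < r \<and> dist (pairing y \<sigma>) (pairing x \<sigma>) < r}" for r x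
    define Q where "Q x = K \<inter> {y. dist (pairing y \<gamma>\<^sub>0) (pairing x \<gamma>\<^sub>0) \<le> e x / 4 \<and> dist (pairing y \<sigma>) (pairing x \<sigma>) \<le> e x / 4}" for x
    have N: "open (N r x)" for r x
      unfolding N_def by (intro open_Collect_conj open_Collect_less continuous_intros dual_apply_continuous)
    have "K \<subseteq> \<Union>((\<lambda>x. N (e x / 4) x) ` K)"
      using e(1) by (auto simp: N_def)
    then obtain F where F: "F \<subseteq> K" "finite F" "K \<subseteq> (\<Union>x\<in>F. N (e x / 4) x)"
      using compactE_image[OF K, of K "\<lambda>x. N (e x / 4) x"] N by metis
    have Q: "compact (Q x)" for x
      unfolding Q_def by (intro compact_Int_closed K closed_Collect_conj closed_Collect_le continuous_intros dual_apply_continuous)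
    define V where "V = (\<Inter>x\<in>F. {\<gamma>. dual_apply \<gamma> ` Q x \<subseteq> ball (pairing x \<gamma>\<^sub>0) (e x / 2)})"
    have "open V"
      unfolding V_def using F(2) by (intro open_INT ballI open_dual_basic Q open_ball) auto
    moreover have "\<gamma>\<^sub>0 \<in> V"
    proof -
      have "pairing y \<gamma>\<^sub>0 \<in> ball (pairing x \<gamma>\<^sub>0) (e x / 2)" if "x \<in> F" "y \<in> Q x" for x y
        using that F(1) e(1)[of x] by (auto simp: Q_def dist_commute)
      then show ?thesis
        by (auto simp: V_def)
    qed
    moreover have "V \<subseteq> (+) \<sigma> -` {\<gamma>. dual_apply \<gamma> ` K \<subseteq> U}"
    proof
      fix \<gamma> assume \<gamma>: "\<gamma> \<in> V"
      have "pairing y \<sigma> * pairing y \<gamma> \<in> U" if y: "y \<in> K" for y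
      proof -
        obtain x where x: "x \<in> F" "y \<in> N (e x / 4) x"
          using F(3) y by blast
        have "y \<in> Q x"
          using x y by (auto simp: N_def Q_def)
        then have "pairing y \<gamma> \<in> ball (pairing x \<gamma>\<^sub>0) (e x / 2)"
          using \<gamma> x(1) unfolding V_def by blast
        then have "dist (pairing x \<gamma>\<^sub>0) (pairing y \<gamma>) < e x / 2"
          by simp
        then have 1: "cmod (pairing x \<gamma>\<^sub>0 - pairing y \<gamma>) < e x / 2"
          by (simp add: dist_norm)
        have 2: "cmod (pairing y \<sigma> - pairing x \<sigma>) < e x / 4"
          using x(2) by (simp add: N_def dist_norm)
        have "pairing x \<sigma> * pairing x \<gamma>\<^sub>0 - pairing y \<sigma> * pairing y \<gamma> =
            pairing x \<sigma> * (pairing x \<gamma>\<^sub>0 - pairing y \<gamma>) - (pairing y \<sigma> - pairing x \<sigma>) * pairing y \<gamma>"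
          by (simp add: algebra_simps)
        then have "cmod (pairing x \<sigma> * pairing x \<gamma>\<^sub>0 - pairing y \<sigma> * pairing y \<gamma>) \<le>
            cmod (pairing x \<gamma>\<^sub>0 - pairing y \<gamma>) + cmod (pairing y \<sigma> - pairing x \<sigma>)"
          using norm_triangle_ineq4[of "pairing x \<sigma> * (pairing x \<gamma>\<^sub>0 - pairing y \<gamma>)"
              "(pairing y \<sigma> - pairing x \<sigma>) * pairing y \<gamma>"]
          by (simp add: norm_mult norm_dual_apply)
        then have "dist (pairing x \<sigma> * pairing x \<gamma>\<^sub>0) (pairing y \<sigma> * pairing y \<gamma>) < e x"
          using 1 2 e(1)[of x] x(1) F(1) unfolding dist_norm by auto
        then have "pairing y \<sigma> * pairing y \<gamma> \<in> ball (pairing x \<sigma> * pairing x \<gamma>\<^sub>0) (e x)"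
          by (simp only: mem_ball)
        then show ?thesis
          using e(2) x(1) F(1) by blast
      qed
      then show "\<gamma> \<in> (+) \<sigma> -` {\<gamma>. dual_apply \<gamma> ` K \<subseteq> U}"
        by (auto simp: dual_apply_plus)
    qed
    ultimately show "\<exists>V. open V \<and> \<gamma>\<^sub>0 \<in> V \<and> V \<subseteq> (+) \<sigma> -` {\<gamma>. dual_apply \<gamma> ` K \<subseteq> U}"
      by blast
  qed
  then show "openin (top_of_set UNIV) (UNIV \<inter> (+) \<sigma> -` {\<gamma>. dual_apply \<gamma> ` K \<subseteq> U})"
    by simp
qed

text \<open>Squaring doubles the angle, so some power \<open>z ^ 2 ^ n\<close> leaves the right half plane unless \<open>z = 1\<close>.\<close>

lemma no_small_subgroups:
  assumes z: "cmod z = 1" and pos: "\<And>n. Re (z ^ 2 ^ n) > 0"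
  shows "z = 1"
proof -
  \<comment> \<open>For unimodular \<open>w\<close> with \<open>Re w > 0\<close>,
    \<open>1 - Re (w\<^sup>2) = 2 * (1 - Re w) * (1 + Re w)\<close> is at least
    \<open>2 * (1 - Re w)\<close>, so the distance to 1 at least doubles with each squaring.\<close>
  have bound: "2 ^ n * (1 - Re z) \<le> 1 - Re (z ^ 2 ^ n)" for n
  proof (induction n)
    case (Suc n)
    define w where "w = z ^ 2 ^ n"
    have w: "cmod w = 1" "Re w > 0"
      using z pos[of n] by (simp_all add: w_def norm_power)
    have "(Re w)\<^sup>2 + (Im w)\<^sup>2 = 1"
      using w(1) by (simp add: cmod_def)
    then have sq: "Re (w\<^sup>2) = 2 * (Re w)\<^sup>2 - 1"
      by (simp add: power2_eq_square)
    have "Re w \<le> 1"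
      using complex_Re_le_cmod[of w] w(1) by simp
    then have "0 \<le> (1 - Re w) * Re w"
      using w(2) by simp
    then have "2 * (1 - Re w) \<le> 1 - Re (w\<^sup>2)"
      unfolding sq by (simp add: algebra_simps power2_eq_square)
    moreover have "z ^ 2 ^ Suc n = w\<^sup>2"
      by (simp add: w_def power_mult[symmetric] mult.commute)
    ultimately show ?case
      using Suc unfolding w_def[symmetric] by simp
  qed simp
  have "Re z = 1"
  proof (rule ccontr)
    assume "Re z \<noteq> 1"
    moreover have "Re z \<le> 1"
      using complex_Re_le_cmod[of z] z by simp
    ultimately have "1 - Re z > 0"
      by simp
    then obtain n where "1 / (1 - Re z) < 2 ^ n"
      using real_arch_pow[of 2 "1 / (1 - Re z)"] by auto
    then have "1 < 2 ^ n * (1 - Re z)"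
      using \<open>1 - Re z > 0\<close> by (simp add: field_simps)
    then show False
      using bound[of n] pos[of n] by linarith
  qed
  then show ?thesis
    using z by (simp add: complex_eq_iff cmod_def)
qed

text \<open>Powers of the value at \<open>x\<close> are values at multiples of \<open>x\<close>,
  which stay in \<open>H\<close>, so \<open>no_small_subgroups\<close> applies.\<close>

lemma dual_apply_eq_1_on_subgroup:
  assumes H: "add_subgroup H" and pos: "\<And>x. x \<in> H \<Longrightarrow> Re (dual_apply \<gamma> x) > 0" and x: "x \<in> H"
  shows "dual_apply \<gamma> x = 1"
proof (rule no_small_subgroups)
  have "\<exists>y\<in>H. dual_apply \<gamma> y = dual_apply \<gamma> x ^ n" for n
  proof (induction n)
    case 0
    then show ?case
      using add_subgroup_zero[OF H] by (intro bexI[of _ 0]) auto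
  next
    case (Suc n)
    then show ?case
      using add_subgroup_add[OF H x] by (metis dual_apply_add power_Suc)
  qed
  then show "Re (dual_apply \<gamma> x ^ 2 ^ n) > 0" for n
    using pos by metis
qed (rule norm_dual_apply)

lemma add_subgroup_annihilator: "add_subgroup (annihilator H)"
  by (auto simp: add_subgroup_def annihilator_def dual_apply_zero dual_apply_plus dual_apply_uminus)

text \<open>A character that maps \<open>H\<close> into the right half plane is trivial on
  \<open>H\<close>, so the annihilator is itself a subbasic open set.\<close>

lemma open_annihilator:
  assumes H: "compact_open_subgroup H"
  shows "open (annihilator H)"
proof -
  have "annihilator H = {\<gamma>. dual_apply \<gamma> ` H \<subseteq> {z. Re z > 0}}"
  proof (intro equalityI subsetI)
    fix \<gamma> assume "\<gamma> \<in> {\<gamma>. dual_apply \<gamma> ` H \<subseteq> {z. Re z > 0}}"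
    then show "\<gamma> \<in> annihilator H"
      using H dual_apply_eq_1_on_subgroup[of H \<gamma>]
      by (auto simp: annihilator_def compact_open_subgroup_def)
  qed (auto simp: annihilator_def)
  moreover have "open {z. Re z > 0}"
    by (intro open_Collect_less continuous_intros)
  ultimately show ?thesis
    using H by (auto simp: compact_open_subgroup_def intro!: open_dual_basic)
qed

text \<open>As functions, the characters trivial on \<open>H\<close> form a closed subset of a
  product of circles, compact by Tychonoff. They are constant on cosets of \<open>H\<close>, and a
  compact set meets finitely many cosets, so on them the compact-open topology is no finer than
  pointwise convergence.\<close>

lemma compact_annihilator:
  fixes H :: "'a::{topological_ab_group_add,t2_space} set"
  assumes H: "compact_open_subgroup H"
  shows "compact (annihilator H)"
proof -
  have H': "add_subgroup H" "open H" "compact H"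
    using H by (auto simp: compact_open_subgroup_def)
  define Z where "Z = {f :: 'a \<Rightarrow> complex. \<forall>x y. f (x + y) = f x * f y} \<inter> {f. \<forall>x\<in>H. f x = 1}"
  let ?P = "PiE UNIV (\<lambda>_::'a. sphere 0 1) :: ('a \<Rightarrow> complex) set"
  have "compactin (product_topology (\<lambda>_. euclidean) UNIV) ?P"
    by (subst compactin_PiE) auto
  then have P: "compact ?P"
    by (simp add: euclidean_product_topology)
  have coord: "continuous_on UNIV (\<lambda>f :: 'a \<Rightarrow> complex. f x)" for x
    by (rule continuous_on_product_coordinates)
  have "closed Z"
    unfolding Z_def Ball_def
    by (intro closed_Int closed_Collect_all closed_Collect_imp closed_Collect_eq open_Collect_const
      continuous_on_mult coord continuous_on_const)
  then have PZ: "compact (?P \<inter> Z)"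
    by (rule compact_Int_closed[OF P])
  have char: "dual_apply (Dual f) = f" if "f \<in> ?P \<inter> Z" for f
  proof (rule Dual_inverse)
    have "continuous_on UNIV f"
      using that by (intro continuous_on_trivial_on_open_subgroup[OF H'(1,2)]) (auto simp: Z_def)
    then show "f \<in> {\<phi>. continuous_on UNIV \<phi> \<and> (\<forall>x. cmod (\<phi> x) = 1) \<and> (\<forall>x y. \<phi> (x + y) = \<phi> x * \<phi> y)}"
      using that by (auto simp: Z_def PiE_def Pi_def)
  qed
  have "continuous_on (?P \<inter> Z) Dual"
  proof (rule continuous_on_into_dual)
    fix C :: "'a set" and U :: "complex set" assume C: "compact C" and U: "open U"
    have op: "open (coset H x)" for x
    proof -
      have "coset H x = (\<lambda>y. y - x) -` H"
        by (auto simp: coset_iff)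
      then show ?thesis
        using H'(2) by (simp add: open_vimage continuous_on_diff continuous_on_id continuous_on_const)
    qed
    have "C \<subseteq> \<Union>(coset H ` C)"
      using coset_self[OF H'(1)] by blast
    then obtain F where F: "F \<subseteq> C" "finite F" "C \<subseteq> (\<Union>x\<in>F. coset H x)"
      using compactE_image[OF C, of C "coset H"] op by metis
    have "(f ` C \<subseteq> U) = (\<forall>x\<in>F. f x \<in> U)" if f: "f \<in> ?P \<inter> Z" for f
    proof
      assume R: "\<forall>x\<in>F. f x \<in> U"
      have "f y \<in> U" if y: "y \<in> C" for y
      proof -
        obtain x where x: "x \<in> F" "y - x \<in> H"
          using F(3) y by (fastforce simp: coset_iff)
        have "f (x + (y - x)) = f x * f (y - x)"
          using f unfolding Z_def by blast
        also have "f (y - x) = 1"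
          using f x by (auto simp: Z_def)
        finally show ?thesis
          using R x by simp
      qed
      then show "f ` C \<subseteq> U"
        by blast
    qed (use F(1) in blast)
    then have "f \<in> Dual -` {\<gamma>. dual_apply \<gamma> ` C \<subseteq> U} \<longleftrightarrow> f \<in> (\<Inter>x\<in>F. (\<lambda>f. f x) -` U)"
      if "f \<in> ?P \<inter> Z" for f
      unfolding vimage_eq mem_Collect_eq char[OF that] using that by simp
    then have "(?P \<inter> Z) \<inter> Dual -` {\<gamma>. dual_apply \<gamma> ` C \<subseteq> U} = (?P \<inter> Z) \<inter> (\<Inter>x\<in>F. (\<lambda>f. f x) -` U)"
      by blast
    moreover have "open (\<Inter>x\<in>F. (\<lambda>f :: 'a \<Rightarrow> complex. f x) -` U)"
      using F(2) U coord by (intro open_INT ballI open_vimage) auto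
    ultimately show "openin (top_of_set (?P \<inter> Z)) ((?P \<inter> Z) \<inter> Dual -` {\<gamma>. dual_apply \<gamma> ` C \<subseteq> U})"
      by (simp add: openin_open_Int)
  qed
  then have "compact (Dual ` (?P \<inter> Z))"
    using PZ by (rule compact_continuous_image)
  moreover have "Dual ` (?P \<inter> Z) = annihilator H"
  proof (intro equalityI subsetI)
    fix \<gamma> assume "\<gamma> \<in> Dual ` (?P \<inter> Z)"
    then obtain f where "f \<in> ?P \<inter> Z" "\<gamma> = Dual f"
      by blast
    then show "\<gamma> \<in> annihilator H"
      using char by (auto simp: annihilator_def Z_def)
  next
    fix \<gamma> assume "\<gamma> \<in> annihilator H"
    then have "dual_apply \<gamma> \<in> ?P \<inter> Z"
      by (auto simp: annihilator_def Z_def norm_dual_apply dual_apply_add)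
    then show "\<gamma> \<in> Dual ` (?P \<inter> Z)"
      by (metis dual_apply_inverse image_eqI)
  qed
  ultimately show ?thesis
    by simp
qed

section \<open>Automorphisms and their adjoints\<close>

lemma AutD:
  assumes "A \<in> Aut"
  shows "A (x + y) = A x + A y" and "homeomorphism UNIV UNIV A (inv A)" and "bij A"
    and "A (inv A x) = x" and "inv A (A x) = x"
    and "continuous_on UNIV A" and "continuous_on UNIV (inv A)"
proof -
  have h: "Modules.additive A" "homeomorphism UNIV UNIV A (inv A)"
    using assms by (auto simp: Aut_def)
  show "A (x + y) = A x + A y"
    using h(1) by (rule Modules.additive.add)
  show "homeomorphism UNIV UNIV A (inv A)" "A (inv A x) = x" "inv A (A x) = x"
    "continuous_on UNIV A" "continuous_on UNIV (inv A)"
    using h(2) by (auto simp: homeomorphism_def)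
  show "bij A"
    using h(2) by (metis bij_betw_def homeomorphism_def inj_on_inverseI iso_tuple_UNIV_I)
qed

lemma Aut_additive: "A \<in> Aut \<Longrightarrow> Modules.additive A"
  by (simp add: Aut_def)

lemma AutI:
  assumes "\<And>x y. A (x + y) = A x + A y" "continuous_on UNIV A" "continuous_on UNIV B"
    "\<And>x. A (B x) = x" "\<And>x. B (A x) = x"
  shows "A \<in> Aut" and "inv A = B"
proof -
  show "inv A = B"
    using assms(4,5) by (intro inv_unique_comp) auto
  then show "A \<in> Aut"
    using assms by (auto simp: Aut_def homeomorphism_def Modules.additive_def image_iff) metis+
qed

lemma inv_Aut:
  assumes A: "A \<in> Aut"
  shows "inv A \<in> Aut"
proof (rule AutI(1))
  fix x y
  show "inv A (x + y) = inv A x + inv A y"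
    using AutD(1)[OF A, of "inv A x" "inv A y"] AutD(4,5)[OF A] by metis
qed (use AutD[OF A] in auto)

lemma comp_Aut:
  assumes A: "A \<in> Aut" and B: "B \<in> Aut"
  shows "A \<circ> B \<in> Aut"
proof (rule AutI(1)[where B = "inv B \<circ> inv A"])
  show "continuous_on UNIV (A \<circ> B)" "continuous_on UNIV (inv B \<circ> inv A)"
    unfolding comp_def
    by (auto intro: continuous_on_compose2[OF AutD(6)[OF A] AutD(6)[OF B]]
        continuous_on_compose2[OF AutD(7)[OF B] AutD(7)[OF A]])
qed (simp_all add: AutD[OF A] AutD[OF B])

lemma id_Aut: "id \<in> Aut"
  by (rule AutI(1)[where B = id]) auto

lemma funpow_Aut: "A \<in> Aut \<Longrightarrow> A ^^ n \<in> Aut"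
  by (induction n) (simp_all add: id_Aut comp_Aut id_def[symmetric])

lemma int_pow_Aut: "A \<in> Aut \<Longrightarrow> int_pow A n \<in> Aut"
  by (auto simp: int_pow_def fun_eq_iff funpow_Aut inv_Aut)

lemma int_pow_0 [simp]: "int_pow A 0 = id"
  by (simp add: int_pow_def fun_eq_iff)

lemma int_pow_1 [simp]: "int_pow A 1 = A"
  by (simp add: int_pow_def fun_eq_iff)

lemma int_pow_plus_1:
  assumes "bij A"
  shows "int_pow A (n + 1) x = A (int_pow A n x)"
proof (cases "n \<ge> 0")
  case True
  then have "nat (n + 1) = Suc (nat n)"
    by simp
  then show ?thesis
    using True by (simp add: int_pow_def)
next
  case False
  then have "nat (- n) = Suc (nat (- (n + 1)))"
    by simp
  then have "int_pow A n x = inv A ((inv A ^^ nat (- (n + 1))) x)"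
    using False by (simp add: int_pow_def)
  then have "A (int_pow A n x) = (inv A ^^ nat (- (n + 1))) x"
    using assms by (simp add: bij_is_surj surj_f_inv_f)
  moreover have "int_pow A (n + 1) x = (inv A ^^ nat (- (n + 1))) x"
    using False by (cases "n = - 1") (auto simp: int_pow_def)
  ultimately show ?thesis
    by simp
qed

lemma int_pow_minus_1:
  assumes "bij A"
  shows "int_pow A (n - 1) x = inv A (int_pow A n x)"
  using int_pow_plus_1[OF assms, of "n - 1" x] assms by (simp add: bij_is_inj inv_f_f)

lemma int_pow_add:
  assumes "bij A"
  shows "int_pow A (m + n) x = int_pow A m (int_pow A n x)"
proof (induction m rule: int_induct[where k = 0])
  case (step1 i)
  have "int_pow A (i + 1 + n) x = int_pow A ((i + n) + 1) x"
    by (simp add: algebra_simps)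
  then show ?case
    using step1(2) by (simp only: int_pow_plus_1[OF assms])
next
  case (step2 i)
  have "int_pow A (i - 1 + n) x = int_pow A ((i + n) - 1) x"
    by (simp add: algebra_simps)
  then show ?case
    using step2(2) by (simp only: int_pow_minus_1[OF assms])
qed simp

lemma int_pow_image_add:
  assumes "bij A"
  shows "int_pow A (m + n) ` S = int_pow A m ` int_pow A n ` S"
  by (simp add: image_image int_pow_add[OF assms])

lemma int_pow_inverse:
  assumes "bij A"
  shows "int_pow A n (int_pow A (- n) x) = x" "int_pow A (- n) (int_pow A n x) = x"
  using int_pow_add[OF assms, of n "- n" x] int_pow_add[OF assms, of "- n" n x] by simp_all

lemma int_pow_image_iff:
  assumes "bij A"
  shows "x \<in> int_pow A n ` S \<longleftrightarrow> int_pow A (- n) x \<in> S"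
  using int_pow_inverse[OF assms] by (metis (no_types, opaque_lifting) image_iff)

lemma inv_int_pow:
  assumes "bij A"
  shows "inv (int_pow A n) = int_pow A (- n)"
  using int_pow_inverse[OF assms] by (intro inv_unique_comp) (auto simp: fun_eq_iff)

lemma continuous_on_adjoint:
  assumes A: "A \<in> Aut"
  shows "continuous_on UNIV (adjoint_aut A)"
proof (rule continuous_on_into_dual)
  fix K :: "'a set" and U :: "complex set" assume K: "compact K" and U: "open U"
  have "adjoint_aut A -` {\<gamma>. dual_apply \<gamma> ` K \<subseteq> U} = {\<gamma>. dual_apply \<gamma> ` (A ` K) \<subseteq> U}"
    by (auto simp: pairing_adjoint[OF A])
  moreover have "compact (A ` K)"
    using K AutD(6)[OF A] by (intro compact_continuous_image) (auto intro: continuous_on_subset)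
  ultimately show "openin (top_of_set UNIV) (UNIV \<inter> adjoint_aut A -` {\<gamma>. dual_apply \<gamma> ` K \<subseteq> U})"
    using open_dual_basic[OF _ U] by simp
qed

lemma dual_eqI: "(\<And>x. dual_apply \<gamma> x = dual_apply \<gamma>' x) \<Longrightarrow> \<gamma> = \<gamma>'"
  by (simp add: dual_apply_inject[symmetric] fun_eq_iff)

lemma adjoint_comp:
  assumes "A \<in> Aut" "B \<in> Aut"
  shows "adjoint_aut A (adjoint_aut B \<gamma>) = adjoint_aut (B \<circ> A) \<gamma>"
  by (rule dual_eqI) (simp add: pairing_adjoint assms comp_Aut)

lemma adjoint_id: "adjoint_aut id \<gamma> = \<gamma>"
  by (rule dual_eqI) (simp add: pairing_adjoint id_Aut)

lemma
  assumes A: "A \<in> Aut"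
  shows adjoint_Aut: "adjoint_aut A \<in> Aut" and inv_adjoint: "inv (adjoint_aut A) = adjoint_aut (inv A)"
proof -
  have "adjoint_aut A (\<gamma> + \<gamma>') = adjoint_aut A \<gamma> + adjoint_aut A \<gamma>'" for \<gamma> \<gamma>'
    by (rule dual_eqI) (simp add: pairing_adjoint A dual_apply_plus)
  moreover have "adjoint_aut A (adjoint_aut (inv A) \<gamma>) = \<gamma>" for \<gamma>
    by (rule dual_eqI) (simp add: pairing_adjoint A inv_Aut AutD)
  moreover have "adjoint_aut (inv A) (adjoint_aut A \<gamma>) = \<gamma>" for \<gamma>
    by (rule dual_eqI) (simp add: pairing_adjoint A inv_Aut AutD)
  ultimately show "adjoint_aut A \<in> Aut" "inv (adjoint_aut A) = adjoint_aut (inv A)"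
    using AutI[of "adjoint_aut A" "adjoint_aut (inv A)"]
      continuous_on_adjoint[OF A] continuous_on_adjoint[OF inv_Aut[OF A]] by blast+
qed

lemma adjoint_funpow:
  assumes A: "A \<in> Aut"
  shows "adjoint_aut (A ^^ n) \<gamma> = (adjoint_aut A ^^ n) \<gamma>"
proof (induction n arbitrary: \<gamma>)
  case (Suc n)
  have "adjoint_aut (A ^^ Suc n) \<gamma> = adjoint_aut A (adjoint_aut (A ^^ n) \<gamma>)"
    by (subst adjoint_comp) (simp_all add: A funpow_Aut funpow_Suc_right del: funpow.simps(2))
  also have "\<dots> = adjoint_aut A ((adjoint_aut A ^^ n) \<gamma>)"
    by (simp only: Suc)
  also have "\<dots> = (adjoint_aut A ^^ Suc n) \<gamma>"
    by simp
  finally show ?case .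
qed (simp add: adjoint_id[unfolded id_def] id_def)

lemma adjoint_int_pow:
  assumes A: "A \<in> Aut"
  shows "adjoint_aut (int_pow A n) = int_pow (adjoint_aut A) n"
proof
  fix \<gamma>
  have eq: "int_pow A n = (if n \<ge> 0 then A ^^ nat n else inv A ^^ nat (- n))"
    by (auto simp: int_pow_def fun_eq_iff)
  show "adjoint_aut (int_pow A n) \<gamma> = int_pow (adjoint_aut A) n \<gamma>"
    unfolding eq int_pow_def inv_adjoint[OF A]
    by (simp add: adjoint_funpow[OF A] adjoint_funpow[OF inv_Aut[OF A]])
qed

lemma annihilator_image:
  assumes A: "A \<in> Aut"
  shows "annihilator (A ` H) = adjoint_aut (inv A) ` annihilator H"
proof (intro equalityI subsetI)
  fix \<gamma> assume "\<gamma> \<in> annihilator (A ` H)"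
  then have "adjoint_aut A \<gamma> \<in> annihilator H"
    by (auto simp: annihilator_def pairing_adjoint[OF A])
  moreover have "\<gamma> = adjoint_aut (inv A) (adjoint_aut A \<gamma>)"
    using AutD(5)[OF adjoint_Aut[OF A]] inv_adjoint[OF A] by simp
  ultimately show "\<gamma> \<in> adjoint_aut (inv A) ` annihilator H"
    by blast
next
  fix \<gamma> assume "\<gamma> \<in> adjoint_aut (inv A) ` annihilator H"
  then show "\<gamma> \<in> annihilator (A ` H)"
    by (auto simp: annihilator_def pairing_adjoint inv_Aut[OF A] AutD[OF A])
qed

lemma compact_open_subgroup_image:
  fixes H :: "'a::{ab_group_add,topological_space} set"
  assumes H: "compact_open_subgroup H" and A: "A \<in> Aut"
  shows "compact_open_subgroup (A ` H)"
proof -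
  have H': "add_subgroup H" "compact H" "open H"
    using H by (auto simp: compact_open_subgroup_def)
  have zero: "A 0 = 0"
    using AutD(1)[OF A, of 0 0] by simp
  have minus: "- A x = A (- x)" for x
    using AutD(1)[OF A, of x "- x"] zero by (simp add: minus_unique)
  have "A 0 \<in> A ` H"
    using add_subgroup_zero[OF H'(1)] by blast
  moreover have "- A x \<in> A ` H" if "x \<in> H" for x
    using add_subgroup_uminus[OF H'(1) that] minus by simp
  moreover have "A x + A y \<in> A ` H" if "x \<in> H" "y \<in> H" for x y
    unfolding AutD(1)[OF A, symmetric] using add_subgroup_add[OF H'(1) that] by blast
  ultimately have "add_subgroup (A ` H)"
    by (auto simp: add_subgroup_def zero)
  moreover have "compact (A ` H)"
    using H'(2) AutD(6)[OF A] by (intro compact_continuous_image) (auto intro: continuous_on_subset)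
  moreover have "A ` H = inv A -` H"
    using AutD(4,5)[OF A] by (auto simp: image_iff) metis
  then have "open (A ` H)"
    using open_vimage[OF H'(3) AutD(7)[OF A]] by simp
  ultimately show ?thesis
    by (simp add: compact_open_subgroup_def)
qed

lemma compact_open_subgroup_annihilator:
  fixes H :: "'a::{topological_ab_group_add,t2_space} set"
  shows "compact_open_subgroup H \<Longrightarrow> compact_open_subgroup (annihilator H)"
  by (simp add: compact_open_subgroup_def[of "annihilator H"] add_subgroup_annihilator
      open_annihilator compact_annihilator)

text \<open>Separation of the points of the group is assumed here and later supplied by
  \<open>expansive_separates\<close>. On the dual side, distinct characters are separated by
  evaluations anyway.\<close>

locale dual_pair =
  fixes H :: "'a::{topological_ab_group_add,t2_space} set" and \<mu> :: "'a measure" and \<nu> :: "'a dual measure"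
  assumes H: "compact_open_subgroup H"
    and haar_\<mu>: "haar_measure \<mu>" and emeasure_H: "emeasure \<mu> H = 1"
    and haar_\<nu>: "haar_measure \<nu>" and emeasure_K: "emeasure \<nu> (annihilator H) = 1"
    and separates: "\<And>x :: 'a. x \<noteq> 0 \<Longrightarrow> \<exists>\<gamma>. pairing x \<gamma> \<noteq> 1"
begin

abbreviation "K \<equiv> annihilator H"

sublocale G: haar_group \<mu> H "range dual_apply"
proof
  show "continuous_on UNIV ((+) a)" for a :: 'a
    by (intro continuous_intros)
  show "(\<lambda>_. 1) \<in> range dual_apply"
    by (rule image_eqI[of _ _ 0]) (auto simp: dual_apply_zero)
  fix \<phi> \<psi> :: "'a \<Rightarrow> complex" assume "\<phi> \<in> range dual_apply"
  then obtain \<gamma> where \<gamma>: "\<phi> = dual_apply \<gamma>"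
    by blast
  show "continuous_on UNIV \<phi>" "\<And>x. cmod (\<phi> x) = 1" "\<And>x y. \<phi> (x + y) = \<phi> x * \<phi> y"
    by (auto simp: \<gamma> dual_apply_continuous norm_dual_apply dual_apply_add)
  show "(\<lambda>x. cnj (\<phi> x)) \<in> range dual_apply"
    by (rule image_eqI[of _ _ "- \<gamma>"]) (auto simp: dual_apply_uminus \<gamma>)
  assume "\<psi> \<in> range dual_apply"
  then obtain \<gamma>' where "\<psi> = dual_apply \<gamma>'"
    by blast
  then show "(\<lambda>x. \<phi> x * \<psi> x) \<in> range dual_apply"
    by (intro image_eqI[of _ _ "\<gamma> + \<gamma>'"]) (auto simp: dual_apply_plus \<gamma>)
next
  fix x y :: 'a assume "x \<noteq> y"
  then obtain \<gamma> where "pairing (x - y) \<gamma> \<noteq> 1"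
    using separates[of "x - y"] by auto
  then have "pairing x \<gamma> \<noteq> pairing y \<gamma>"
    by (auto simp: dual_apply_diff)
  then show "\<exists>\<phi>\<in>range dual_apply. \<phi> x \<noteq> \<phi> y"
    by blast
qed (rule haar_\<mu> H emeasure_H)+

sublocale Gd: haar_group \<nu> K "range (\<lambda>x \<gamma>. pairing x \<gamma>)"
proof
  show "compact_open_subgroup K"
    by (rule compact_open_subgroup_annihilator[OF H])
  show "continuous_on UNIV ((+) a)" for a :: "'a dual"
    by (rule continuous_on_dual_plus)
  show "(\<lambda>_. 1) \<in> range (\<lambda>x \<gamma>. pairing x \<gamma>)"
    by (rule image_eqI[of _ _ 0]) auto
  fix \<phi> \<psi> :: "'a dual \<Rightarrow> complex" assume "\<phi> \<in> range (\<lambda>x \<gamma>. pairing x \<gamma>)"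
  then obtain x where x: "\<phi> = (\<lambda>\<gamma>. pairing x \<gamma>)"
    by blast
  show "continuous_on UNIV \<phi>" "\<And>x. cmod (\<phi> x) = 1" "\<And>x y. \<phi> (x + y) = \<phi> x * \<phi> y"
    by (auto simp: x continuous_on_pairing norm_dual_apply dual_apply_plus)
  show "(\<lambda>x. cnj (\<phi> x)) \<in> range (\<lambda>x \<gamma>. pairing x \<gamma>)"
    by (rule image_eqI[of _ _ "- x"]) (auto simp: dual_apply_minus x)
  assume "\<psi> \<in> range (\<lambda>x \<gamma>. pairing x \<gamma>)"
  then obtain y where "\<psi> = (\<lambda>\<gamma>. pairing y \<gamma>)"
    by blast
  then show "(\<lambda>x. \<phi> x * \<psi> x) \<in> range (\<lambda>x \<gamma>. pairing x \<gamma>)"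
    by (intro image_eqI[of _ _ "x + y"]) (auto simp: dual_apply_add x)
next
  fix \<gamma> \<gamma>' :: "'a dual" assume "\<gamma> \<noteq> \<gamma>'"
  then obtain x where "pairing x \<gamma> \<noteq> pairing x \<gamma>'"
    by (metis dual_eqI)
  then show "\<exists>\<phi>\<in>range (\<lambda>x \<gamma>. pairing x \<gamma>). \<phi> \<gamma> \<noteq> \<phi> \<gamma>'"
    by (intro bexI[of _ "\<lambda>\<gamma>. pairing x \<gamma>"]) auto
qed (rule haar_\<nu> emeasure_K)+

text \<open>Needed to read the integral of an evaluation over a coset of \<open>K\<close> as a
  condition on membership in \<open>H\<close>. The nontrivial direction is the separation of points
  from an open subgroup.\<close>

lemma double_annihilator: "(\<forall>\<gamma>\<in>K. pairing x \<gamma> = 1) \<longleftrightarrow> x \<in> H"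
proof
  assume *: "\<forall>\<gamma>\<in>K. pairing x \<gamma> = 1"
  show "x \<in> H"
  proof (rule ccontr)
    assume "x \<notin> H"
    then obtain \<gamma> where "\<forall>y\<in>H. pairing y \<gamma> = 1" "pairing x \<gamma> \<noteq> 1"
      using characters_separate_open_subgroup[of H x] H by (auto simp: compact_open_subgroup_def)
    then show False
      using * by (auto simp: annihilator_def)
  qed
qed (auto simp: annihilator_def)

end

section \<open>The Plancherel transform\<close>

lemma cnj_indicator [simp]: "cnj (indicator A x) = indicator A x"
  by (simp add: indicator_def)

text \<open>One index is chosen for each function that occurs, since \<open>e\<close> need not be
  injective on \<open>I\<close>.\<close>

lemma l2_closed_span_approx:
  assumes "f \<in> l2_closed_span M (e ` I)" "\<epsilon> > 0"
  obtains S c where "finite S" "S \<subseteq> I" "l2_norm M (\<lambda>x. f x - (\<Sum>i\<in>S. c i * e i x)) < \<epsilon>"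
proof -
  obtain T d where T: "finite T" "T \<subseteq> e ` I" "l2_norm M (\<lambda>x. f x - (\<Sum>b\<in>T. d b * b x)) < \<epsilon>"
    using assms unfolding l2_closed_span_def by blast
  obtain S where S: "S \<subseteq> I" "inj_on e S" "T = e ` S"
    using T(2) by (auto simp: subset_image_inj)
  have "(\<Sum>b\<in>T. d b * b x) = (\<Sum>i\<in>S. d (e i) * e i x)" for x
    unfolding S(3) by (subst sum.reindex[OF S(2)]) simp
  moreover have "finite S"
    using T(1) S by (auto dest: finite_imageD)
  ultimately show ?thesis
    using T(3) S(1) that[of S "\<lambda>i. d (e i)"] by simp
qed

lemma l2_closed_span_sequence:
  assumes f: "f \<in> l2_closed_span M (range e)"
  obtains S c where "\<And>n::nat. finite (S n)"
    "\<And>n. l2_norm M (\<lambda>x. f x - (\<Sum>i\<in>S n. c n i * e i x)) < 1 / real (Suc n)"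
    "(\<lambda>n. l2_norm M (\<lambda>x. f x - (\<Sum>i\<in>S n. c n i * e i x))) \<longlonglongrightarrow> 0"
proof -
  let ?d = "\<lambda>p. l2_norm M (\<lambda>x. f x - (\<Sum>i\<in>fst p. snd p i * e i x))"
  have "\<exists>p. finite (fst p) \<and> ?d p < 1 / real (Suc n)" for n
  proof -
    have pos: "0 < 1 / real (Suc n)"
      by simp
    show ?thesis
      by (rule l2_closed_span_approx[OF f pos]) auto
  qed
  then have "\<forall>n. \<exists>p. finite (fst p) \<and> ?d p < 1 / real (Suc n)"
    by blast
  from choice[OF this] obtain p where p: "\<And>n. finite (fst (p n))" "\<And>n. ?d (p n) < 1 / real (Suc n)"
    by blast
  have "(\<lambda>n. ?d (p n)) \<longlonglongrightarrow> 0"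
  proof (rule tendsto_sandwich[where f = "\<lambda>_. 0" and h = "\<lambda>n. 1 / real (Suc n)"])
    show "(\<lambda>n. 1 / real (Suc n)) \<longlonglongrightarrow> 0"
      by (rule LIMSEQ_Suc[OF lim_1_over_n])
  qed (auto intro!: always_eventually less_imp_le[OF p(2)] simp del: of_nat_Suc)
  with p show ?thesis
    by (intro that[of "\<lambda>n. fst (p n)" "\<lambda>n. snd (p n)"]) auto
qed

lemma l2_closed_span_subset:
  assumes f: "f \<in> l2_closed_span M B" and B: "B \<subseteq> l2_closed_span M B'" and B': "B' \<subseteq> L2 M"
  shows "f \<in> l2_closed_span M B'"
proof (rule l2_closed_spanI[OF l2_closed_span_L2[OF f] _ B'])
  fix \<epsilon> :: real assume "\<epsilon> > 0"
  then obtain S c where S: "finite S" "S \<subseteq> B" "l2_norm M (\<lambda>x. f x - (\<Sum>b\<in>S. c b * b x)) < \<epsilon>"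
    using f unfolding l2_closed_span_def by blast
  have "(\<lambda>x. \<Sum>b\<in>S. c b * b x) \<in> l2_closed_span M B'"
    using S(2) B by (intro l2_closed_span_sum l2_closed_span_cmult B') auto
  then show "\<exists>g\<in>l2_closed_span M B'. l2_norm M (\<lambda>x. f x - g x) < \<epsilon>"
    using S(3) by (intro bexI[where x = "\<lambda>x. \<Sum>b\<in>S. c b * b x"]) auto
qed

lemma l2_norm_combination_eq:
  assumes "\<And>i. i \<in> S \<Longrightarrow> e i \<in> L2 M" "\<And>i. i \<in> S \<Longrightarrow> E i \<in> L2 N"
    and "\<And>i j. i \<in> S \<Longrightarrow> j \<in> S \<Longrightarrow> l2_inner M (e i) (e j) = l2_inner N (E i) (E j)"
  shows "l2_norm M (\<lambda>x. \<Sum>i\<in>S. c i * e i x) = l2_norm N (\<lambda>x. \<Sum>i\<in>S. c i * E i x)"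
proof -
  have "l2_inner M (\<lambda>x. \<Sum>i\<in>S. c i * e i x) (\<lambda>x. \<Sum>i\<in>S. c i * e i x) =
      l2_inner N (\<lambda>x. \<Sum>i\<in>S. c i * E i x) (\<lambda>x. \<Sum>i\<in>S. c i * E i x)"
    using assms by (simp add: l2_inner_combination_left l2_inner_combination_right L2_combination)
  then have "(l2_norm M (\<lambda>x. \<Sum>i\<in>S. c i * e i x))\<^sup>2 = (l2_norm N (\<lambda>x. \<Sum>i\<in>S. c i * E i x))\<^sup>2"
    unfolding l2_inner_self of_real_eq_iff .
  then show ?thesis
    by (simp add: power2_eq_iff_nonneg)
qed

text \<open>The norm is the supremum of inner products with finite combinations of norm one, and these
  only depend on the coefficients.\<close>

lemma l2_norm_le_of_coefficients:
  assumes e: "\<And>i. e i \<in> L2 M" and E: "\<And>i. E i \<in> L2 N"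
    and gram: "\<And>i j. l2_inner M (e i) (e j) = l2_inner N (E i) (E j)"
    and f: "f \<in> L2 M" and F: "F \<in> l2_closed_span N (range E)"
    and coef: "\<And>i. l2_inner M f (e i) = l2_inner N F (E i)"
  shows "l2_norm N F \<le> l2_norm M f"
proof -
  have FL: "F \<in> L2 N"
    by (rule l2_closed_span_L2[OF F])
  define a where "a = l2_norm N F"
  define b where "b = l2_norm M f"
  have ab: "a \<ge> 0" "b \<ge> 0"
    by (simp_all add: a_def b_def)
  have key: "a\<^sup>2 \<le> b * (a + \<epsilon>) + a * \<epsilon>" if \<epsilon>: "\<epsilon> > 0" for \<epsilon>
  proof -
    obtain S c where S: "finite S" "l2_norm N (\<lambda>x. F x - (\<Sum>i\<in>S. c i * E i x)) < \<epsilon>"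
      using l2_closed_span_approx[OF F \<epsilon>] by metis
    define Q where "Q x = (\<Sum>i\<in>S. c i * E i x)" for x
    define q where "q x = (\<Sum>i\<in>S. c i * e i x)" for x
    have L: "Q \<in> L2 N" "q \<in> L2 M" "(\<lambda>x. F x - Q x) \<in> L2 N"
      unfolding Q_def q_def using FL by (auto intro!: L2_combination L2_diff e E)
    have FQ: "l2_norm N (\<lambda>x. F x - Q x) < \<epsilon>"
      using S(2) by (simp add: Q_def)
    have norm_q: "l2_norm M q = l2_norm N Q"
      unfolding q_def Q_def by (rule l2_norm_combination_eq) (auto simp: e E gram)
    have "l2_inner N F Q = l2_inner M f q"
      unfolding q_def Q_def using f FL e E by (simp add: l2_inner_combination_right coef)
    moreover have "l2_inner N F F = l2_inner N F Q + l2_inner N F (\<lambda>x. F x - Q x)"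
      using FL L by (simp add: l2_inner_diff_right)
    ultimately have "l2_inner N F F = l2_inner M f q + l2_inner N F (\<lambda>x. F x - Q x)"
      by simp
    then have "cmod (l2_inner N F F) \<le> cmod (l2_inner M f q) + cmod (l2_inner N F (\<lambda>x. F x - Q x))"
      by (simp add: norm_triangle_ineq)
    moreover have "cmod (l2_inner N F F) = a\<^sup>2"
      unfolding l2_inner_self norm_of_real by (simp add: a_def)
    moreover have "cmod (l2_inner M f q) \<le> b * l2_norm N Q"
      using l2_Cauchy_Schwarz[OF f L(2)] by (simp add: b_def norm_q)
    moreover have "cmod (l2_inner N F (\<lambda>x. F x - Q x)) \<le> a * l2_norm N (\<lambda>x. F x - Q x)"
      using l2_Cauchy_Schwarz[OF FL L(3)] by (simp add: a_def)
    moreover have "a * l2_norm N (\<lambda>x. F x - Q x) \<le> a * \<epsilon>"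
      using FQ ab by (intro mult_left_mono) auto
    moreover have "l2_norm N Q \<le> a + \<epsilon>"
      using l2_norm_triangle_diff[OF FL L(1)] FQ by (simp add: a_def)
    then have "b * l2_norm N Q \<le> b * (a + \<epsilon>)"
      using ab by (intro mult_left_mono) auto
    ultimately show ?thesis
      by linarith
  qed
  have "a\<^sup>2 \<le> b * a"
  proof (rule field_le_epsilon)
    fix d :: real assume d: "d > 0"
    have pos: "a + b + 1 > 0"
      using ab by simp
    \<comment> \<open>The error \<open>d / (a + b + 1)\<close> is chosen so that
      \<open>a + b\<close> times it is at most \<open>d\<close>, also when both norms
      vanish.\<close>
    have "a\<^sup>2 \<le> b * (a + d / (a + b + 1)) + a * (d / (a + b + 1))"
      using d pos by (intro key) simp
    also have "\<dots> = b * a + (a + b) * (d / (a + b + 1))"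
      by (simp add: algebra_simps add_divide_distrib)
    also have "(a + b) * (d / (a + b + 1)) \<le> d"
      using d ab pos by (simp add: field_simps)
    finally show "a\<^sup>2 \<le> b * a + d"
      by simp
  qed
  then have "a \<le> b"
    using ab by (cases "a = 0") (auto simp: power2_eq_square)
  then show ?thesis
    by (simp add: a_def b_def)
qed

section \<open>Waves, their transforms and their coefficients\<close>

context dual_pair
begin

text \<open>Indexed by all pairs and not by representatives of cosets: only Gram matrices are
  compared, so redundancy among the waves is harmless.\<close>

definition wave :: "'a \<times> 'a dual \<Rightarrow> 'a \<Rightarrow> complex" where
  "wave = (\<lambda>(s, \<sigma>) x. indicator (coset H s) x * pairing x \<sigma>)"

text \<open>Using \<open>\<gamma> - \<sigma>\<close> in place of \<open>\<gamma>\<close> inserts the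
  unimodular constant that makes this the exact transform of \<open>wave\<close>.\<close>

definition dual_wave :: "'a \<times> 'a dual \<Rightarrow> 'a dual \<Rightarrow> complex" where
  "dual_wave = (\<lambda>(s, \<sigma>) \<gamma>. indicator (coset K \<sigma>) \<gamma> * cnj (pairing s (\<gamma> - \<sigma>)))"

lemma wave_coset_waves: "range wave = coset_waves H (range dual_apply)"
proof (intro equalityI subsetI)
  fix f assume "f \<in> coset_waves H (range dual_apply)"
  then obtain s \<sigma> where "f = wave (s, \<sigma>)"
    by (auto simp: coset_waves_def wave_def)
  then show "f \<in> range wave"
    by blast
qed (auto simp: coset_waves_def wave_def)

lemma wave_L2: "wave i \<in> L2 \<mu>"
  using G.coset_waves_L2 wave_coset_waves by blast

lemma wave_dense: "f \<in> L2 \<mu> \<Longrightarrow> f \<in> l2_closed_span \<mu> (range wave)"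
  unfolding wave_coset_waves by (rule G.coset_waves_dense)

lemma dual_wave_eq:
  "dual_wave (s, \<sigma>) = (\<lambda>\<gamma>. pairing s \<sigma> * (indicator (coset K \<sigma>) \<gamma> * pairing (- s) \<gamma>))"
  unfolding dual_wave_def by (auto simp: fun_eq_iff dual_apply_dual_diff dual_apply_minus)

lemma coset_wave_L2: "(\<lambda>\<gamma>. indicator (coset K \<sigma>) \<gamma> * pairing s \<gamma>) \<in> L2 \<nu>"
proof (rule subsetD[OF Gd.coset_waves_L2])
  show "(\<lambda>\<gamma>. indicator (coset K \<sigma>) \<gamma> * pairing s \<gamma>) \<in> coset_waves K (range (\<lambda>x \<gamma>. pairing x \<gamma>))"
    unfolding coset_waves_def mem_Collect_eq by (intro exI conjI) (rule refl, rule rangeI)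
qed

lemma dual_wave_L2: "dual_wave i \<in> L2 \<nu>"
  by (cases i) (auto simp: dual_wave_eq intro!: L2_cmult coset_wave_L2)

lemma dual_wave_dense:
  assumes "F \<in> L2 \<nu>"
  shows "F \<in> l2_closed_span \<nu> (range dual_wave)"
proof (rule l2_closed_span_subset[OF Gd.coset_waves_dense[OF assms]])
  show "coset_waves K (range (\<lambda>x \<gamma>. pairing x \<gamma>)) \<subseteq> l2_closed_span \<nu> (range dual_wave)"
  proof
    fix f assume "f \<in> coset_waves K (range (\<lambda>x \<gamma>. pairing x \<gamma>))"
    then obtain \<sigma> s where f: "f = (\<lambda>\<gamma>. indicator (coset K \<sigma>) \<gamma> * pairing s \<gamma>)"
      by (auto simp: coset_waves_def)
    have "f = (\<lambda>\<gamma>. pairing s \<sigma> * dual_wave (- s, \<sigma>) \<gamma>)"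
      unfolding f dual_wave_eq by (auto simp: fun_eq_iff dual_apply_minus mult.assoc[symmetric])
    moreover have "(\<lambda>\<gamma>. pairing s \<sigma> * dual_wave (- s, \<sigma>) \<gamma>) \<in> l2_closed_span \<nu> (range dual_wave)"
      by (intro l2_closed_span_cmult l2_closed_span_base dual_wave_L2) auto
    ultimately show "f \<in> l2_closed_span \<nu> (range dual_wave)"
      by simp
  qed
qed (auto simp: dual_wave_L2)

lemma dual_apply_measurable [measurable]: "dual_apply \<gamma> \<in> borel_measurable borel"
  by (rule borel_measurable_continuous_onI[OF dual_apply_continuous])

lemma pairing_measurable [measurable]: "(\<lambda>\<gamma>. pairing x \<gamma>) \<in> borel_measurable borel"
  by (rule borel_measurable_continuous_onI[OF continuous_on_pairing])

lemma subgroup_H: "add_subgroup H" and subgroup_K: "add_subgroup K"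
  using H by (auto simp: compact_open_subgroup_def add_subgroup_annihilator)

lemma integral_coset_G:
  "(LINT x|\<mu>. indicator (coset H s) x * pairing x \<gamma>) = (if \<gamma> \<in> K then pairing s \<gamma> else 0)"
  using G.char_integral[of "dual_apply \<gamma>" s] by (simp add: annihilator_def)

lemma integral_coset_Gd:
  "(LINT \<gamma>|\<nu>. indicator (coset K \<sigma>) \<gamma> * pairing x \<gamma>) = (if x \<in> H then pairing x \<sigma> else 0)"
  using Gd.char_integral[of "\<lambda>\<gamma>. pairing x \<gamma>" \<sigma>] by (simp add: double_annihilator)

lemma integrable_wave: "integrable \<mu> (wave i)"
  by (cases i) (auto simp: wave_def intro!: G.integrable_trig trig.base)

lemma fourier_wave: "fourier_L1 \<mu> (wave i) = dual_wave i"
proof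
  fix \<gamma>
  obtain s \<sigma> where i: "i = (s, \<sigma>)"
    by (cases i)
  have "fourier_L1 \<mu> (wave i) \<gamma> = (LINT x|\<mu>. indicator (coset H s) x * pairing x (\<sigma> - \<gamma>))"
    unfolding fourier_L1_def wave_def i by (simp add: dual_apply_dual_diff mult.assoc)
  also have "\<dots> = (if \<sigma> - \<gamma> \<in> K then pairing s (\<sigma> - \<gamma>) else 0)"
    by (rule integral_coset_G)
  also have "\<sigma> - \<gamma> \<in> K \<longleftrightarrow> \<gamma> - \<sigma> \<in> K"
    using add_subgroup_uminus[OF subgroup_K, of "\<sigma> - \<gamma>"] add_subgroup_uminus[OF subgroup_K, of "\<gamma> - \<sigma>"]
    by auto
  finally show "fourier_L1 \<mu> (wave i) \<gamma> = dual_wave i \<gamma>"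
    unfolding dual_wave_def i
    by (auto simp: coset_iff indicator_def dual_apply_dual_diff mult.commute)
qed

text \<open>For \<open>x\<close> in \<open>t + H\<close> the pairings of \<open>x\<close> and of
  \<open>t\<close> with \<open>\<gamma> - \<sigma>\<close> agree, because \<open>x - t\<close> lies
  in \<open>H\<close> and \<open>\<gamma> - \<sigma>\<close> in \<open>K\<close>. The dependence on
  \<open>\<gamma>\<close> thus leaves the integral.\<close>

lemma fourier_coset:
  assumes \<gamma>: "\<gamma> \<in> coset K \<sigma>"
  shows "fourier_L1 \<mu> (\<lambda>x. indicator (coset H t) x * g x) \<gamma> =
    (LINT x|\<mu>. indicator (coset H t) x * g x * cnj (pairing x \<sigma>)) * cnj (pairing t (\<gamma> - \<sigma>))"
proof -
  have eq: "indicator (coset H t) x * g x * cnj (pairing x \<gamma>) =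
      indicator (coset H t) x * g x * cnj (pairing x \<sigma>) * cnj (pairing t (\<gamma> - \<sigma>))" for x
  proof (cases "x \<in> coset H t")
    case True
    have "pairing (x - t) (\<gamma> - \<sigma>) = 1"
      using True \<gamma> by (auto simp: coset_iff annihilator_def)
    then have "pairing x (\<gamma> - \<sigma>) = pairing t (\<gamma> - \<sigma>)"
      using dual_apply_add[of "\<gamma> - \<sigma>" "x - t" t] by simp
    then have "pairing x \<gamma> = pairing x \<sigma> * pairing t (\<gamma> - \<sigma>)"
      using dual_apply_plus[of "\<gamma> - \<sigma>" \<sigma> x] by (simp add: mult.commute)
    then show ?thesis
      by simp
  qed simp
  show ?thesis
    unfolding fourier_L1_def eq by simp
qed

lemma fourier_coset_dual_wave:
  "fourier_L1 \<mu> (\<lambda>x. indicator (coset H t) x * g x) \<gamma> * cnj (dual_wave (s, \<sigma>) \<gamma>) =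
    (LINT x|\<mu>. indicator (coset H t) x * g x * cnj (pairing x \<sigma>)) * cnj (pairing (s - t) \<sigma>) *
    (indicator (coset K \<sigma>) \<gamma> * pairing (s - t) \<gamma>)"
  by (cases "\<gamma> \<in> coset K \<sigma>")
    (simp_all add: fourier_coset dual_wave_def dual_apply_dual_diff dual_apply_diff)

text \<open>On \<open>\<sigma> + K\<close> the transform of a function living on
  \<open>t + H\<close> is a constant times a character, so no interchange of integrals is needed.
  Both sides equal the constant \<open>a\<close> if \<open>s - t\<close> lies in \<open>H\<close>,
  and 0 otherwise.\<close>

lemma coefficient_coset:
  assumes g: "integrable \<mu> g"
  shows "l2_inner \<nu> (fourier_L1 \<mu> (\<lambda>x. indicator (coset H t) x * g x)) (dual_wave i) =
    l2_inner \<mu> (\<lambda>x. indicator (coset H t) x * g x) (wave i)"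
proof -
  obtain s \<sigma> where i: "i = (s, \<sigma>)"
    by (cases i)
  define a where "a = (LINT x|\<mu>. indicator (coset H t) x * g x * cnj (pairing x \<sigma>))"
  have "l2_inner \<nu> (fourier_L1 \<mu> (\<lambda>x. indicator (coset H t) x * g x)) (dual_wave i) =
      a * cnj (pairing (s - t) \<sigma>) * (LINT \<gamma>|\<nu>. indicator (coset K \<sigma>) \<gamma> * pairing (s - t) \<gamma>)"
    unfolding l2_inner_def i fourier_coset_dual_wave a_def by simp
  also have "\<dots> = (if s - t \<in> H then a else 0)"
    unfolding integral_coset_Gd by (auto simp: mult.assoc mult.commute[of "cnj _"])
  finally have lhs: "l2_inner \<nu> (fourier_L1 \<mu> (\<lambda>x. indicator (coset H t) x * g x)) (dual_wave i) =
      (if s - t \<in> H then a else 0)" .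
  show ?thesis
  proof (cases "s - t \<in> H")
    case True
    then have "coset H s = coset H t"
      using coset_eq_iff[OF subgroup_H] by blast
    then have eq: "indicator (coset H t) x * g x * cnj (wave i x) =
        indicator (coset H t) x * g x * cnj (pairing x \<sigma>)" for x
      by (auto simp: wave_def i indicator_def)
    have "l2_inner \<mu> (\<lambda>x. indicator (coset H t) x * g x) (wave i) = a"
      unfolding l2_inner_def eq a_def ..
    then show ?thesis
      using lhs True by simp
  next
    case False
    then have "coset H t \<inter> coset H s = {}"
      using coset_eq_iff[OF subgroup_H] coset_disjoint[OF subgroup_H] by metis
    then have eq: "indicator (coset H t) x * g x * cnj (wave i x) = 0" for x
      by (auto simp: wave_def i indicator_def)
    have "l2_inner \<mu> (\<lambda>x. indicator (coset H t) x * g x) (wave i) = 0"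
      unfolding l2_inner_def eq by simp
    then show ?thesis
      using lhs False by simp
  qed
qed

lemma integrable_cnj_pairing:
  assumes "integrable \<mu> g"
  shows "integrable \<mu> (\<lambda>x. g x * cnj (pairing x \<gamma>))"
proof (rule Bochner_Integration.integrable_bound[OF assms])
  have [measurable]: "g \<in> borel_measurable borel"
    using borel_measurable_integrable[OF assms] by simp
  show "(\<lambda>x. g x * cnj (pairing x \<gamma>)) \<in> borel_measurable \<mu>"
    by measurable
qed (simp add: norm_mult norm_dual_apply)

lemma integrable_indicator_mult:
  assumes "integrable \<mu> g" "A \<in> sets borel"
  shows "integrable \<mu> (\<lambda>x. indicator A x * g x :: complex)"
proof (rule Bochner_Integration.integrable_bound[OF assms(1)])
  have [measurable]: "g \<in> borel_measurable borel" "A \<in> sets borel"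
    using borel_measurable_integrable[OF assms(1)] assms(2) by simp_all
  show "(\<lambda>x. indicator A x * g x) \<in> borel_measurable \<mu>"
    by measurable
qed (simp add: norm_mult indicator_def)

lemma norm_fourier_L1:
  assumes "integrable \<mu> g"
  shows "cmod (fourier_L1 \<mu> g \<gamma>) \<le> (LINT x|\<mu>. cmod (g x))"
proof -
  have "cmod (fourier_L1 \<mu> g \<gamma>) \<le> (LINT x|\<mu>. cmod (g x * cnj (pairing x \<gamma>)))"
    unfolding fourier_L1_def by (rule integral_norm_bound)
  then show ?thesis
    by (simp add: norm_mult norm_dual_apply)
qed

lemma fourier_L1_sum:
  assumes "\<And>j. j \<in> J \<Longrightarrow> integrable \<mu> (g j)"
  shows "fourier_L1 \<mu> (\<lambda>x. \<Sum>j\<in>J. g j x) \<gamma> = (\<Sum>j\<in>J. fourier_L1 \<mu> (g j) \<gamma>)"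
  unfolding fourier_L1_def sum_distrib_right
  by (rule Bochner_Integration.integral_sum) (rule integrable_cnj_pairing[OF assms])

lemma fourier_L1_cmult: "fourier_L1 \<mu> (\<lambda>x. c * g x) \<gamma> = c * fourier_L1 \<mu> g \<gamma>"
  unfolding fourier_L1_def by (simp add: mult.assoc)

text \<open>An integrable \<open>g\<close> lives on countably many cosets. Its restrictions
  \<open>gn\<close> to finitely many of them satisfy the identity by linearity, and dominated
  convergence passes to the limit on both sides.\<close>

theorem coefficient_L1:
  assumes g: "integrable \<mu> g" and gF: "fourier_L1 \<mu> g \<in> L2 \<nu>"
  shows "l2_inner \<nu> (fourier_L1 \<mu> g) (dual_wave i) = l2_inner \<mu> g (wave i)"
proof -
  have gm [measurable]: "g \<in> borel_measurable borel"
    using borel_measurable_integrable[OF g] by simp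
  let ?CC = "{C \<in> range (coset H). \<exists>x\<in>C. g x \<noteq> 0}"
  have count: "countable ?CC"
    by (rule G.integrable_countable_cosets[OF g])
  define F where "F n = from_nat_into ?CC ` {..<n} \<inter> ?CC" for n
  have F: "finite (F n)" "F n \<subseteq> range (coset H)" for n
    by (auto simp: F_def)
  define gn where "gn n x = (\<Sum>C\<in>F n. indicator C x * g x)" for n x
  have gn_eq: "gn n x = indicator (\<Union>(F n)) x * g x" for n x
    unfolding gn_def sum_indicator_disjoint[OF F(1) disjoint_cosets[OF subgroup_H F(2)]]
    by (simp add: indicator_def)
  have coset_sets: "C \<in> sets borel" if "C \<in> F n" for C n
    using subsetD[OF F(2) that] by auto
  have int_C: "integrable \<mu> (\<lambda>x. indicator C x * g x)" if "C \<in> F n" for C n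
    by (rule integrable_indicator_mult[OF g coset_sets[OF that]])
  have int_gn: "integrable \<mu> (gn n)" for n
    unfolding gn_def by (intro Bochner_Integration.integrable_sum int_C)
  have lim: "(\<lambda>n. gn n x) \<longlonglongrightarrow> g x" for x
  proof (cases "g x = 0")
    case False
    then have mem: "coset H x \<in> ?CC"
      using coset_self[OF subgroup_H] by blast
    then obtain k where k: "from_nat_into ?CC k = coset H x"
      using from_nat_into_surj[OF count] by blast
    have "gn n x = g x" if "n > k" for n
    proof -
      have "coset H x \<in> F n"
        unfolding F_def using that k mem by (auto intro!: image_eqI[of _ _ k])
      then have "x \<in> \<Union>(F n)"
        using coset_self[OF subgroup_H] by blast
      then show ?thesis
        by (simp add: gn_eq)
    qed
    then show ?thesis
      by (intro tendsto_eventually eventually_mono[OF eventually_gt_at_top[of k]])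
  qed (simp add: gn_eq)
  have bound: "cmod (gn n x) \<le> cmod (g x)" for n x
    by (auto simp: gn_eq indicator_def)
  have gnm [measurable]: "gn n \<in> borel_measurable borel" for n
    using borel_measurable_integrable[OF int_gn] by simp
  have wm [measurable]: "wave i \<in> borel_measurable borel" "dual_wave i \<in> borel_measurable borel"
    using L2_measurable[OF wave_L2] L2_measurable[OF dual_wave_L2] by simp_all
  have finite_eq: "l2_inner \<nu> (fourier_L1 \<mu> (gn n)) (dual_wave i) = l2_inner \<mu> (gn n) (wave i)" for n
  proof -
    have "l2_inner \<nu> (fourier_L1 \<mu> (gn n)) (dual_wave i) =
        (LINT \<gamma>|\<nu>. (\<Sum>C\<in>F n. fourier_L1 \<mu> (\<lambda>x. indicator C x * g x) \<gamma> * cnj (dual_wave i \<gamma>)))"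
      unfolding l2_inner_def gn_def by (subst fourier_L1_sum[OF int_C]) (simp_all add: sum_distrib_right)
    also have "\<dots> = (\<Sum>C\<in>F n. l2_inner \<nu> (fourier_L1 \<mu> (\<lambda>x. indicator C x * g x)) (dual_wave i))"
      unfolding l2_inner_def
    proof (rule Bochner_Integration.integral_sum)
      fix C assume "C \<in> F n"
      then obtain t where t: "C = coset H t"
        using F(2) by blast
      obtain s \<sigma> where i: "i = (s, \<sigma>)"
        by (cases i)
      show "integrable \<nu> (\<lambda>\<gamma>. fourier_L1 \<mu> (\<lambda>x. indicator C x * g x) \<gamma> * cnj (dual_wave i \<gamma>))"
        unfolding t i fourier_coset_dual_wave
        using Gd.integrable_trig[OF trig.base, of "\<lambda>\<gamma>. pairing (s - t) \<gamma>" \<sigma>] by simp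
    qed
    also have "\<dots> = (\<Sum>C\<in>F n. l2_inner \<mu> (\<lambda>x. indicator C x * g x) (wave i))"
    proof (rule sum.cong[OF refl])
      fix C assume "C \<in> F n"
      then obtain t where "C = coset H t"
        using F(2) by blast
      then show "l2_inner \<nu> (fourier_L1 \<mu> (\<lambda>x. indicator C x * g x)) (dual_wave i) =
          l2_inner \<mu> (\<lambda>x. indicator C x * g x) (wave i)"
        using coefficient_coset[OF g] by simp
    qed
    also have "\<dots> = (LINT x|\<mu>. (\<Sum>C\<in>F n. indicator C x * g x * cnj (wave i x)))"
      unfolding l2_inner_def
    proof (rule Bochner_Integration.integral_sum[symmetric])
      fix C assume C: "C \<in> F n"
      obtain s \<sigma> where i: "i = (s, \<sigma>)"
        by (cases i)
      have "integrable \<mu> (\<lambda>x. indicator (coset H s) x * (indicator C x * g x * cnj (pairing x \<sigma>)))"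
        by (intro integrable_indicator_mult integrable_cnj_pairing int_C[OF C]) simp
      then show "integrable \<mu> (\<lambda>x. indicator C x * g x * cnj (wave i x))"
        by (simp add: wave_def i mult.assoc mult.left_commute mult.commute)
    qed
    also have "\<dots> = l2_inner \<mu> (gn n) (wave i)"
      unfolding l2_inner_def gn_def by (simp add: sum_distrib_right)
    finally show ?thesis .
  qed
  have lim_\<mu>: "(\<lambda>n. l2_inner \<mu> (gn n) (wave i)) \<longlonglongrightarrow> l2_inner \<mu> g (wave i)"
    unfolding l2_inner_def
  proof (rule integral_dominated_convergence)
    show "integrable \<mu> (\<lambda>x. cmod (g x))"
      using g by simp
    show "AE x in \<mu>. (\<lambda>n. gn n x * cnj (wave i x)) \<longlonglongrightarrow> g x * cnj (wave i x)"
      by (intro AE_I2 tendsto_intros lim)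
    have "cmod (wave i x) \<le> 1" for x
      by (cases i) (auto simp: wave_def indicator_def norm_dual_apply)
    then show "AE x in \<mu>. cmod (gn n x * cnj (wave i x)) \<le> cmod (g x)" for n
      using bound by (intro AE_I2) (auto simp: norm_mult intro: order_trans[OF mult_left_le])
  qed auto
  obtain s \<sigma> where i: "i = (s, \<sigma>)"
    by (cases i)
  have "(\<lambda>n. l2_inner \<nu> (fourier_L1 \<mu> (gn n)) (dual_wave i)) \<longlonglongrightarrow> l2_inner \<nu> (fourier_L1 \<mu> g) (dual_wave i)"
    unfolding l2_inner_def
  proof (rule integral_dominated_convergence)
    have gnF: "(\<lambda>\<gamma>. fourier_L1 \<mu> (gn n) \<gamma> * cnj (dual_wave i \<gamma>)) \<in> borel_measurable borel" for n
    proof -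
      have "fourier_L1 \<mu> (gn n) \<gamma> * cnj (dual_wave i \<gamma>) =
          (\<Sum>C\<in>F n. fourier_L1 \<mu> (\<lambda>x. indicator C x * g x) \<gamma> * cnj (dual_wave i \<gamma>))" for \<gamma>
        unfolding gn_def by (subst fourier_L1_sum[OF int_C]) (simp_all add: sum_distrib_right)
      moreover have "(\<lambda>\<gamma>. fourier_L1 \<mu> (\<lambda>x. indicator C x * g x) \<gamma> * cnj (dual_wave i \<gamma>)) \<in> borel_measurable borel"
        if C: "C \<in> F n" for C
      proof -
        obtain t where t: "C = coset H t"
          using F(2) C by blast
        show ?thesis
          unfolding t i fourier_coset_dual_wave by simp
      qed
      ultimately show ?thesis
        by simp
    qed
    then show "(\<lambda>\<gamma>. fourier_L1 \<mu> (gn n) \<gamma> * cnj (dual_wave i \<gamma>)) \<in> borel_measurable \<nu>" for n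
      by simp
    show "(\<lambda>\<gamma>. fourier_L1 \<mu> g \<gamma> * cnj (dual_wave i \<gamma>)) \<in> borel_measurable \<nu>"
      using L2_measurable[OF gF] by measurable
    \<comment> \<open>The \<open>L\<^sup>1\<close> norm of \<open>g\<close> bounds all the
      transforms, and \<open>dual_wave\<close> vanishes off a coset of measure 1; together they give
      an integrable majorant on the dual side.\<close>
    define c where "c = (LINT x|\<mu>. cmod (g x))"
    show "integrable \<nu> (\<lambda>\<gamma>. c * indicator (coset K \<sigma>) \<gamma>)"
      by (intro integrable_mult_right integrable_real_indicator) auto
    have "(\<lambda>n. fourier_L1 \<mu> (gn n) \<gamma>) \<longlonglongrightarrow> fourier_L1 \<mu> g \<gamma>" for \<gamma>
      unfolding fourier_L1_def
    proof (rule integral_dominated_convergence)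
      show "integrable \<mu> (\<lambda>x. cmod (g x))"
        using g by simp
      show "AE x in \<mu>. (\<lambda>n. gn n x * cnj (pairing x \<gamma>)) \<longlonglongrightarrow> g x * cnj (pairing x \<gamma>)"
        by (intro AE_I2 tendsto_intros lim)
      show "AE x in \<mu>. cmod (gn n x * cnj (pairing x \<gamma>)) \<le> cmod (g x)" for n
        using bound by (intro AE_I2) (auto simp: norm_mult norm_dual_apply)
    qed auto
    then show "AE \<gamma> in \<nu>. (\<lambda>n. fourier_L1 \<mu> (gn n) \<gamma> * cnj (dual_wave i \<gamma>)) \<longlonglongrightarrow> fourier_L1 \<mu> g \<gamma> * cnj (dual_wave i \<gamma>)"
      by (intro AE_I2 tendsto_intros)
    have "cmod (fourier_L1 \<mu> (gn n) \<gamma>) \<le> c" for n \<gamma>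
      using norm_fourier_L1[OF int_gn, of n \<gamma>] integral_mono[of \<mu> "\<lambda>x. cmod (gn n x)" "\<lambda>x. cmod (g x)"]
        int_gn g bound by (auto simp: c_def)
    then show "AE \<gamma> in \<nu>. cmod (fourier_L1 \<mu> (gn n) \<gamma> * cnj (dual_wave i \<gamma>)) \<le> c * indicator (coset K \<sigma>) \<gamma>" for n
      by (intro AE_I2) (auto simp: norm_mult i dual_wave_def indicator_def norm_dual_apply)
  qed
  then show ?thesis
    unfolding finite_eq by (rule LIMSEQ_unique[OF _ lim_\<mu>])
qed

end

lemma l2_inner_tendsto:
  assumes f: "\<And>n::nat. fn n \<in> L2 M" "f \<in> L2 M" and h: "h \<in> L2 M"
    and lim: "(\<lambda>n. l2_norm M (\<lambda>x. fn n x - f x)) \<longlonglongrightarrow> 0"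
  shows "(\<lambda>n. l2_inner M (fn n) h) \<longlonglongrightarrow> l2_inner M f h"
proof -
  have "(\<lambda>n. l2_norm M (\<lambda>x. fn n x - f x) * l2_norm M h) \<longlonglongrightarrow> 0 * l2_norm M h"
    by (intro tendsto_intros lim)
  then have lim': "(\<lambda>n. l2_norm M (\<lambda>x. fn n x - f x) * l2_norm M h) \<longlonglongrightarrow> 0"
    by simp
  have "cmod (l2_inner M (fn n) h - l2_inner M f h) \<le> l2_norm M (\<lambda>x. fn n x - f x) * l2_norm M h" for n
    using l2_Cauchy_Schwarz[OF L2_diff[OF f(1)[of n] f(2)] h] l2_inner_diff_left[OF f(1)[of n] f(2) h]
    by simp
  then have "(\<lambda>n. l2_inner M (fn n) h - l2_inner M f h) \<longlonglongrightarrow> 0"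
    by (intro Lim_null_comparison[OF _ lim']) auto
  then show ?thesis
    by (rule LIM_zero_cancel)
qed

lemma L2_Fatou:
  assumes fn: "\<And>n::nat. fn n \<in> L2 M" and bound: "\<And>n. l2_norm M (fn n) \<le> B"
    and lim: "\<And>x. x \<in> space M \<Longrightarrow> (\<lambda>n. fn n x) \<longlonglongrightarrow> f x"
  shows "f \<in> L2 M"
proof (rule L2I)
  note [measurable] = L2_measurable[OF fn]
  show fm [measurable]: "f \<in> borel_measurable M"
    by (rule borel_measurable_LIMSEQ_metric[OF _ lim]) measurable
  have "(\<integral>\<^sup>+x. ennreal ((cmod (f x))\<^sup>2) \<partial>M) = (\<integral>\<^sup>+x. liminf (\<lambda>n. ennreal ((cmod (fn n x))\<^sup>2)) \<partial>M)"
  proof (rule nn_integral_cong)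
    fix x assume "x \<in> space M"
    then have "(\<lambda>n. ennreal ((cmod (fn n x))\<^sup>2)) \<longlonglongrightarrow> ennreal ((cmod (f x))\<^sup>2)"
      by (intro tendsto_ennrealI tendsto_intros lim)
    then show "ennreal ((cmod (f x))\<^sup>2) = liminf (\<lambda>n. ennreal ((cmod (fn n x))\<^sup>2))"
      by (intro lim_imp_Liminf[symmetric]) auto
  qed
  also have "\<dots> \<le> liminf (\<lambda>n. \<integral>\<^sup>+x. ennreal ((cmod (fn n x))\<^sup>2) \<partial>M)"
    by (rule nn_integral_liminf) measurable
  also have "\<dots> \<le> liminf (\<lambda>n::nat. ennreal (B\<^sup>2))"
  proof (intro Liminf_mono always_eventually allI)
    fix n
    have "(\<integral>\<^sup>+x. ennreal ((cmod (fn n x))\<^sup>2) \<partial>M) = ennreal ((l2_norm M (fn n))\<^sup>2)"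
      unfolding l2_norm_power2 by (rule nn_integral_eq_integral[OF L2_integrable[OF fn]]) auto
    also have "\<dots> \<le> ennreal (B\<^sup>2)"
      using bound[of n] by (intro ennreal_leI power_mono) auto
    finally show "(\<integral>\<^sup>+x. ennreal ((cmod (fn n x))\<^sup>2) \<partial>M) \<le> ennreal (B\<^sup>2)" .
  qed
  also have "\<dots> < \<infinity>"
    by (simp add: Liminf_const)
  finally show "integrable M (\<lambda>x. (cmod (f x))\<^sup>2)"
    by (intro integrableI_bounded) auto
qed

section \<open>Change of variables under automorphisms\<close>

context haar_group
begin

lemma automorphism_distr:
  assumes A: "Modules.additive A" "homeomorphism UNIV UNIV A A'"
    and c: "c > 0" "emeasure M (A ` S) = ennreal c"
  shows "distr M M A = density M (\<lambda>_. ennreal (1 / c))"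
proof (rule measure_eqI)
  have inv: "A' (A x) = x" "A (A' x) = x" for x
    using A(2) by (auto simp: homeomorphism_def)
  have [measurable]: "A \<in> borel_measurable borel"
    using A(2) by (intro borel_measurable_continuous_onI) (simp add: homeomorphism_def)
  fix E assume "E \<in> sets (distr M M A)"
  then have E: "E \<in> sets borel"
    by simp
  then have E': "A -` E \<in> sets borel"
    using measurable_sets[of A borel borel E] by simp
  have "A ` (A -` E) = E"
    using inv by (metis surj_def surj_image_vimage_eq)
  then have "emeasure M E = ennreal c * emeasure M (A -` E)"
    using emeasure_automorphism[OF A E'] c(2) by simp
  then have "ennreal (1 / c) * emeasure M E = (ennreal (1 / c) * ennreal c) * emeasure M (A -` E)"
    by (simp add: mult.assoc)
  also have "ennreal (1 / c) * ennreal c = 1"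
    using c(1) by (simp flip: ennreal_mult' add: ennreal_mult'[symmetric])
  finally show "emeasure (distr M M A) E = emeasure (density M (\<lambda>_. ennreal (1 / c))) E"
    using E by (simp add: emeasure_distr emeasure_density_const)
qed simp

lemma
  fixes f :: "'g \<Rightarrow> 'b::{banach,second_countable_topology}"
  assumes A: "Modules.additive A" "homeomorphism UNIV UNIV A A'"
    and c: "c > 0" "emeasure M (A ` S) = ennreal c" and f: "f \<in> borel_measurable borel"
  shows integral_automorphism: "(LINT x|M. f (A x)) = (1 / c) *\<^sub>R (LINT x|M. f x)"
    and integrable_automorphism: "integrable M (\<lambda>x. f (A x)) \<longleftrightarrow> integrable M f"
proof -
  have [measurable]: "A \<in> borel_measurable borel" "f \<in> borel_measurable borel"
    using A(2) f by (auto intro!: borel_measurable_continuous_onI simp: homeomorphism_def)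
  have "(LINT x|M. f (A x)) = (LINT x|distr M M A. f x)"
    by (subst integral_distr) auto
  also have "\<dots> = (LINT x|M. (1 / c) *\<^sub>R f x)"
    unfolding automorphism_distr[OF A c] using c(1) by (subst integral_density) auto
  finally show "(LINT x|M. f (A x)) = (1 / c) *\<^sub>R (LINT x|M. f x)"
    by simp
  have "integrable M (\<lambda>x. f (A x)) \<longleftrightarrow> integrable (distr M M A) f"
    by (subst integrable_distr_eq) auto
  also have "\<dots> \<longleftrightarrow> integrable M (\<lambda>x. (1 / c) *\<^sub>R f x)"
    unfolding automorphism_distr[OF A c] using c(1) by (subst integrable_density) auto
  also have "\<dots> \<longleftrightarrow> integrable M f"
  proof
    assume "integrable M (\<lambda>x. (1 / c) *\<^sub>R f x)"
    then have "integrable M (\<lambda>x. c *\<^sub>R (1 / c) *\<^sub>R f x)"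
      by (rule integrable_scaleR_right)
    then show "integrable M f"
      using c(1) by simp
  qed simp
  finally show "integrable M (\<lambda>x. f (A x)) \<longleftrightarrow> integrable M f" .
qed

lemma
  assumes A: "Modules.additive A" "homeomorphism UNIV UNIV A A'"
    and c: "c > 0" "emeasure M (A ` S) = ennreal c" and f: "f \<in> L2 M"
  shows L2_automorphism: "(\<lambda>x. f (A x)) \<in> L2 M"
    and l2_norm_automorphism: "l2_norm M (\<lambda>x. f (A x)) = l2_norm M f / sqrt c"
proof -
  have [measurable]: "A \<in> borel_measurable borel" "f \<in> borel_measurable borel"
    using A(2) L2_measurable[OF f] by (auto intro!: borel_measurable_continuous_onI simp: homeomorphism_def)
  have meas: "(\<lambda>x. (cmod (f x))\<^sup>2) \<in> borel_measurable borel"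
    by measurable
  show "(\<lambda>x. f (A x)) \<in> L2 M"
    using L2_integrable[OF f] integrable_automorphism[OF A c meas] by (intro L2I) auto
  show "l2_norm M (\<lambda>x. f (A x)) = l2_norm M f / sqrt c"
    unfolding l2_norm_def integral_automorphism[OF A c meas] by (simp add: real_sqrt_divide)
qed

lemma
  assumes A: "A \<in> Aut"
  shows modulus_pos: "modulus M A > 0"
    and emeasure_modulus: "emeasure M (A ` S) = ennreal (modulus M A)"
proof -
  note A' = Aut_additive[OF A] AutD(2)[OF A]
  define c where "c = enn2real (emeasure M (A ` S))"
  have c: "emeasure M (A ` S) = ennreal c" "c > 0"
    using emeasure_automorphism_pos[OF A'] emeasure_automorphism_finite[OF A']
    unfolding c_def enn2real_positive_iff by simp_all
  have "modulus M A = c"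
    unfolding modulus_def
  proof (rule the_equality)
    show "c > 0 \<and> (\<forall>U\<in>sets M. emeasure M (A ` U) = ennreal c * emeasure M U)"
      using c(2) emeasure_automorphism[OF A', unfolded c(1)] by simp
    fix c' assume c': "c' > 0 \<and> (\<forall>U\<in>sets M. emeasure M (A ` U) = ennreal c' * emeasure M U)"
    then have "emeasure M (A ` S) = ennreal c'"
      by (simp add: emeasure_S)
    then show "c' = c"
      using c c' by (simp add: ennreal_inj)
  qed
  then show "modulus M A > 0" "emeasure M (A ` S) = ennreal (modulus M A)"
    using c by simp_all
qed

end

section \<open>The Plancherel relation in terms of coefficients\<close>

context dual_pair
begin

lemma wave_gram: "l2_inner \<mu> (wave i) (wave j) = l2_inner \<nu> (dual_wave i) (dual_wave j)"
  using coefficient_L1[OF integrable_wave, of i j] by (simp add: fourier_wave dual_wave_L2)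

lemma l2_norm_eq_of_coefficients:
  assumes f: "f \<in> L2 \<mu>" and F: "F \<in> L2 \<nu>"
    and coef: "\<And>i. l2_inner \<nu> F (dual_wave i) = l2_inner \<mu> f (wave i)"
  shows "l2_norm \<mu> f = l2_norm \<nu> F"
proof (rule antisym)
  show "l2_norm \<nu> F \<le> l2_norm \<mu> f"
    by (rule l2_norm_le_of_coefficients[OF wave_L2 dual_wave_L2 wave_gram f dual_wave_dense[OF F]])
      (simp add: coef)
  show "l2_norm \<mu> f \<le> l2_norm \<nu> F"
    by (rule l2_norm_le_of_coefficients[OF dual_wave_L2 wave_L2 wave_gram[symmetric] F wave_dense[OF f]])
      (simp add: coef)
qed

lemma plancherel_coefficient:
  assumes "plancherel \<mu> \<nu> f F"
  shows "l2_inner \<nu> F (dual_wave i) = l2_inner \<mu> f (wave i)"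
proof -
  obtain g where L: "f \<in> L2 \<mu>" "F \<in> L2 \<nu>" and
    g: "\<And>n::nat. integrable \<mu> (g n) \<and> g n \<in> L2 \<mu> \<and> fourier_L1 \<mu> (g n) \<in> L2 \<nu>"
      "(\<lambda>n. l2_norm \<mu> (\<lambda>x. g n x - f x)) \<longlonglongrightarrow> 0"
      "(\<lambda>n. l2_norm \<nu> (\<lambda>\<gamma>. fourier_L1 \<mu> (g n) \<gamma> - F \<gamma>)) \<longlonglongrightarrow> 0"
    using assms unfolding plancherel_def by blast
  have "(\<lambda>n. l2_inner \<mu> (g n) (wave i)) \<longlonglongrightarrow> l2_inner \<mu> f (wave i)"
    using g(1) by (intro l2_inner_tendsto g(2) L wave_L2) auto
  moreover have "(\<lambda>n. l2_inner \<nu> (fourier_L1 \<mu> (g n)) (dual_wave i)) \<longlonglongrightarrow> l2_inner \<nu> F (dual_wave i)"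
    using g(1) by (intro l2_inner_tendsto g(3) L dual_wave_L2) auto
  moreover have "l2_inner \<nu> (fourier_L1 \<mu> (g n)) (dual_wave i) = l2_inner \<mu> (g n) (wave i)" for n
    using g(1) by (intro coefficient_L1) auto
  ultimately show ?thesis
    by (simp add: LIMSEQ_unique)
qed

lemma fourier_combination:
  "fourier_L1 \<mu> (\<lambda>x. \<Sum>i\<in>S. c i * wave i x) = (\<lambda>\<gamma>. \<Sum>i\<in>S. c i * dual_wave i \<gamma>)"
  by (rule ext, subst fourier_L1_sum) (auto simp: fourier_L1_cmult fourier_wave integrable_wave)

text \<open>The right-hand side is linear and free of sequences, so that later facts can be read off
  it. Conversely, if combinations of waves approximate \<open>f\<close>,
  \<open>l2_norm_eq_of_coefficients\<close> shows that their explicit transforms approximate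
  \<open>F\<close> with the same error.\<close>

theorem plancherel_iff:
  "plancherel \<mu> \<nu> f F \<longleftrightarrow> f \<in> L2 \<mu> \<and> F \<in> L2 \<nu> \<and>
    (\<forall>i. l2_inner \<nu> F (dual_wave i) = l2_inner \<mu> f (wave i))"
proof (intro iffI conjI allI)
  assume "f \<in> L2 \<mu> \<and> F \<in> L2 \<nu> \<and> (\<forall>i. l2_inner \<nu> F (dual_wave i) = l2_inner \<mu> f (wave i))"
  then have f: "f \<in> L2 \<mu>" and F: "F \<in> L2 \<nu>"
    and coef: "\<And>i. l2_inner \<nu> F (dual_wave i) = l2_inner \<mu> f (wave i)"
    by auto
  obtain S c where lim0: "(\<lambda>n. l2_norm \<mu> (\<lambda>x. f x - (\<Sum>i\<in>S n. c n i * wave i x))) \<longlonglongrightarrow> 0"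
    by (rule l2_closed_span_sequence[OF wave_dense[OF f]])
  define g where "g n x = (\<Sum>i\<in>S n. c n i * wave i x)" for n x
  have gF: "fourier_L1 \<mu> (g n) = (\<lambda>\<gamma>. \<Sum>i\<in>S n. c n i * dual_wave i \<gamma>)" for n
    unfolding g_def by (rule fourier_combination)
  have gL: "integrable \<mu> (g n)" "g n \<in> L2 \<mu>" "fourier_L1 \<mu> (g n) \<in> L2 \<nu>" for n
    unfolding gF unfolding g_def by (auto intro!: L2_combination wave_L2 dual_wave_L2 integrable_wave)
  have eq: "l2_norm \<mu> (\<lambda>x. f x - g n x) = l2_norm \<nu> (\<lambda>\<gamma>. F \<gamma> - fourier_L1 \<mu> (g n) \<gamma>)" for n
  proof (rule l2_norm_eq_of_coefficients)
    fix i
    show "l2_inner \<nu> (\<lambda>\<gamma>. F \<gamma> - fourier_L1 \<mu> (g n) \<gamma>) (dual_wave i) =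
        l2_inner \<mu> (\<lambda>x. f x - g n x) (wave i)"
      using f F gL by (simp add: l2_inner_diff_left wave_L2 dual_wave_L2 coef coefficient_L1)
  qed (use f F gL in \<open>auto intro: L2_diff\<close>)
  have lim: "(\<lambda>n. l2_norm \<mu> (\<lambda>x. f x - g n x)) \<longlonglongrightarrow> 0"
    using lim0 by (simp add: g_def)
  have "(\<lambda>n. l2_norm \<mu> (\<lambda>x. g n x - f x)) \<longlonglongrightarrow> 0"
    "(\<lambda>n. l2_norm \<nu> (\<lambda>\<gamma>. fourier_L1 \<mu> (g n) \<gamma> - F \<gamma>)) \<longlonglongrightarrow> 0"
    using lim lim[unfolded eq] by (simp_all add: l2_norm_minus_commute)
  then show "plancherel \<mu> \<nu> f F"
    unfolding plancherel_def using f F gL by blast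
next
  assume pl: "plancherel \<mu> \<nu> f F"
  then show "f \<in> L2 \<mu>" "F \<in> L2 \<nu>"
    by (simp_all add: plancherel_def)
  show "l2_inner \<nu> F (dual_wave i) = l2_inner \<mu> f (wave i)" for i
    by (rule plancherel_coefficient[OF pl])
qed

lemma plancherelD: "plancherel \<mu> \<nu> f F \<Longrightarrow> f \<in> L2 \<mu>" "plancherel \<mu> \<nu> f F \<Longrightarrow> F \<in> L2 \<nu>"
  by (simp_all add: plancherel_iff)

lemma plancherel_norm: "plancherel \<mu> \<nu> f F \<Longrightarrow> l2_norm \<mu> f = l2_norm \<nu> F"
  unfolding plancherel_iff by (rule l2_norm_eq_of_coefficients) auto

lemma plancherel_wave: "plancherel \<mu> \<nu> (wave i) (dual_wave i)"
  by (simp add: plancherel_iff wave_L2 dual_wave_L2 wave_gram)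

lemma plancherel_cmult: "plancherel \<mu> \<nu> f F \<Longrightarrow> plancherel \<mu> \<nu> (\<lambda>x. c * f x) (\<lambda>\<gamma>. c * F \<gamma>)"
  unfolding plancherel_iff by (simp add: L2_cmult l2_inner_cmult_left)

lemma plancherel_add:
  "plancherel \<mu> \<nu> f F \<Longrightarrow> plancherel \<mu> \<nu> g G \<Longrightarrow> plancherel \<mu> \<nu> (\<lambda>x. f x + g x) (\<lambda>\<gamma>. F \<gamma> + G \<gamma>)"
  unfolding plancherel_iff by (simp add: L2_add l2_inner_add_left wave_L2 dual_wave_L2)

lemma plancherel_diff:
  "plancherel \<mu> \<nu> f F \<Longrightarrow> plancherel \<mu> \<nu> g G \<Longrightarrow> plancherel \<mu> \<nu> (\<lambda>x. f x - g x) (\<lambda>\<gamma>. F \<gamma> - G \<gamma>)"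
  unfolding plancherel_iff by (simp add: L2_diff l2_inner_diff_left wave_L2 dual_wave_L2)

lemma plancherel_combination:
  assumes "\<And>i. i \<in> S \<Longrightarrow> plancherel \<mu> \<nu> (f i) (F i)"
  shows "plancherel \<mu> \<nu> (\<lambda>x. \<Sum>i\<in>S. c i * f i x) (\<lambda>\<gamma>. \<Sum>i\<in>S. c i * F i \<gamma>)"
proof -
  have "f i \<in> L2 \<mu>" "F i \<in> L2 \<nu>" "\<And>j. l2_inner \<nu> (F i) (dual_wave j) = l2_inner \<mu> (f i) (wave j)" if "i \<in> S" for i
    using assms[OF that] by (auto simp: plancherel_iff)
  then show ?thesis
    by (simp add: plancherel_iff L2_combination l2_inner_combination_left wave_L2 dual_wave_L2)
qed

text \<open>Polarisation: equality of norms for \<open>f + h\<close> gives the real part, with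
  \<open>h = g\<close>, and the imaginary part, with \<open>h\<close> equal to \<open>\<i>\<close>
  times \<open>g\<close>.\<close>

lemma plancherel_inner:
  assumes f: "plancherel \<mu> \<nu> f F" and g: "plancherel \<mu> \<nu> g G"
  shows "l2_inner \<mu> f g = l2_inner \<nu> F G"
proof -
  have re: "Re (l2_inner \<mu> f h) = Re (l2_inner \<nu> F K')" if h: "plancherel \<mu> \<nu> h K'" for h K'
    using plancherel_norm[OF plancherel_add[OF f h]] plancherel_norm[OF f] plancherel_norm[OF h]
      l2_norm_add_power2[OF plancherelD(1)[OF f] plancherelD(1)[OF h]]
      l2_norm_add_power2[OF plancherelD(2)[OF f] plancherelD(2)[OF h]]
    by simp
  show ?thesis
    using re[OF g] re[OF plancherel_cmult[OF g, of \<i>]]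
    by (simp add: l2_inner_cmult_right complex_eq_iff)
qed

lemma plancherel_cong_AE:
  assumes "plancherel \<mu> \<nu> f F" "F' \<in> borel_measurable \<nu>" "AE \<gamma> in \<nu>. F \<gamma> = F' \<gamma>"
  shows "plancherel \<mu> \<nu> f F'"
proof -
  have F: "F \<in> L2 \<nu>"
    by (rule plancherelD(2)[OF assms(1)])
  have "l2_inner \<nu> F' (dual_wave i) = l2_inner \<nu> F (dual_wave i)" for i
    using assms(2,3) L2_measurable[OF F] L2_measurable[OF dual_wave_L2]
    by (intro l2_inner_cong_AE) (auto elim: eventually_mono)
  then show ?thesis
    using assms(1) L2_cong_AE[OF F assms(2,3)] by (simp add: plancherel_iff)
qed

lemma plancherel_unique:
  assumes "plancherel \<mu> \<nu> f F" "plancherel \<mu> \<nu> f F'"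
  shows "AE \<gamma> in \<nu>. F \<gamma> = F' \<gamma>"
proof -
  have "l2_norm \<nu> (\<lambda>\<gamma>. F \<gamma> - F' \<gamma>) = 0"
    using plancherel_norm[OF plancherel_diff[OF assms]] by (simp add: l2_norm_def)
  then have "AE \<gamma> in \<nu>. F \<gamma> - F' \<gamma> = 0"
    using assms by (intro l2_norm_eq_0D L2_diff plancherelD)
  then show ?thesis
    by simp
qed

lemma fourier_plancherel:
  assumes "plancherel \<mu> \<nu> f F"
  shows "fourier \<mu> \<nu> f \<in> L2 \<nu>" and "AE \<gamma> in \<nu>. fourier \<mu> \<nu> f \<gamma> = F \<gamma>"
proof -
  have "plancherel \<mu> \<nu> f (fourier \<mu> \<nu> f)"
    unfolding fourier_def using assms by (rule someI[where P = "plancherel \<mu> \<nu> f"])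
  then show "fourier \<mu> \<nu> f \<in> L2 \<nu>" "AE \<gamma> in \<nu>. fourier \<mu> \<nu> f \<gamma> = F \<gamma>"
    using plancherelD plancherel_unique[OF _ assms] by blast+
qed

text \<open>The witness \<open>P F\<close> in the proof is \<open>x \<mapsto> \<integral> F(\<gamma>) (x,\<gamma>) d\<nu>(\<gamma>)\<close>, integrated over \<open>\<sigma> + K\<close>. It is a
  pointwise limit of the preimages of finite combinations, so Fatou's lemma puts it into \<open>L\<^sup>2\<close>.\<close>

lemma plancherel_exists_coset:
  assumes F: "F \<in> L2 \<nu>"
  shows "\<exists>f. plancherel \<mu> \<nu> f (\<lambda>\<gamma>. indicator (coset K \<sigma>) \<gamma> * F \<gamma>)"
proof -
  define P where "P F x = pairing x \<sigma> * l2_inner \<nu> F (dual_wave (x, \<sigma>))" for F x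
  have K_sym: "\<sigma>' - \<sigma> \<in> K \<longleftrightarrow> \<sigma> - \<sigma>' \<in> K" for \<sigma>'
    using add_subgroup_uminus[OF subgroup_K, of "\<sigma>' - \<sigma>"] add_subgroup_uminus[OF subgroup_K, of "\<sigma> - \<sigma>'"]
    by auto
  \<comment> \<open>\<open>P\<close> inverts the transform on waves with frequency in
    \<open>\<sigma> + K\<close> and annihilates the others.\<close>
  have P_wave: "P (dual_wave (s, \<sigma>')) x = (if \<sigma>' \<in> coset K \<sigma> then wave (s, \<sigma>') x else 0)" for s \<sigma>' x
  proof -
    have "l2_inner \<mu> (wave (s, \<sigma>')) (wave (x, \<sigma>)) =
        (if x - s \<in> H \<and> \<sigma>' - \<sigma> \<in> K then pairing x (\<sigma>' - \<sigma>) else 0)"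
    proof (cases "x - s \<in> H")
      case True
      then have "coset H x = coset H s"
        using coset_eq_iff[OF subgroup_H] by blast
      then have "wave (s, \<sigma>') y * cnj (wave (x, \<sigma>) y) = indicator (coset H x) y * pairing y (\<sigma>' - \<sigma>)" for y
        by (auto simp: wave_def indicator_def dual_apply_dual_diff)
      then have "l2_inner \<mu> (wave (s, \<sigma>')) (wave (x, \<sigma>)) =
          (LINT y|\<mu>. indicator (coset H x) y * pairing y (\<sigma>' - \<sigma>))"
        unfolding l2_inner_def by simp
      then show ?thesis
        using True by (simp add: integral_coset_G)
    next
      case False
      then have "coset H x \<inter> coset H s = {}"
        using coset_eq_iff[OF subgroup_H] coset_disjoint[OF subgroup_H] by metis
      then have "wave (s, \<sigma>') y * cnj (wave (x, \<sigma>) y) = 0" for y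
        by (auto simp: wave_def indicator_def)
      then have "l2_inner \<mu> (wave (s, \<sigma>')) (wave (x, \<sigma>)) = 0"
        unfolding l2_inner_def by (simp only: integral_zero)
      then show ?thesis
        using False by simp
    qed
    moreover have "pairing x \<sigma> * pairing x (\<sigma>' - \<sigma>) = pairing x \<sigma>'"
      using dual_apply_plus[of \<sigma> "\<sigma>' - \<sigma>" x] by simp
    ultimately show ?thesis
      unfolding P_def wave_gram[symmetric] by (simp add: coset_iff wave_def indicator_def)
  qed
  obtain S c where fin: "\<And>n. finite (S n)"
    and Sc: "\<And>n. l2_norm \<nu> (\<lambda>x. F x - (\<Sum>i\<in>S n. c n i * dual_wave i x)) < 1 / real (Suc n)"
    and lim0: "(\<lambda>n. l2_norm \<nu> (\<lambda>x. F x - (\<Sum>i\<in>S n. c n i * dual_wave i x))) \<longlonglongrightarrow> 0"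
    by (rule l2_closed_span_sequence[OF dual_wave_dense[OF F]]) blast
  define Q where "Q n \<gamma> = (\<Sum>i\<in>S n. c n i * dual_wave i \<gamma>)" for n \<gamma>
  define S' where "S' n = {i \<in> S n. snd i \<in> coset K \<sigma>}" for n
  define q where "q n x = (\<Sum>i\<in>S' n. c n i * wave i x)" for n x
  have QL: "Q n \<in> L2 \<nu>" for n
    unfolding Q_def by (intro L2_combination dual_wave_L2)
  have qL: "q n \<in> L2 \<mu>" for n
    unfolding q_def by (intro L2_combination wave_L2)
  have small: "l2_norm \<nu> (\<lambda>\<gamma>. F \<gamma> - Q n \<gamma>) < 1 / real (Suc n)" for n
    using Sc[of n] by (simp add: Q_def)
  have lim: "(\<lambda>n. l2_norm \<nu> (\<lambda>\<gamma>. Q n \<gamma> - F \<gamma>)) \<longlonglongrightarrow> 0"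
    using lim0 by (simp add: Q_def l2_norm_minus_commute[of \<nu> _ F])
  have q_eq: "q n x = P (Q n) x" for n x
  proof -
    have "P (Q n) x = (\<Sum>i\<in>S n. c n i * P (dual_wave i) x)"
      unfolding P_def Q_def using dual_wave_L2
      by (subst l2_inner_combination_left) (auto simp: sum_distrib_left mult.left_commute)
    also have "\<dots> = (\<Sum>i\<in>S n. if snd i \<in> coset K \<sigma> then c n i * wave i x else 0)"
      by (intro sum.cong) (auto simp: P_wave)
    also have "\<dots> = q n x"
      unfolding q_def S'_def using fin by (simp add: sum.If_cases Int_def)
    finally show ?thesis ..
  qed
  have q_lim: "(\<lambda>n. q n x) \<longlonglongrightarrow> P F x" for x
    unfolding q_eq P_def by (intro tendsto_intros l2_inner_tendsto QL F dual_wave_L2 lim)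
  \<comment> \<open>The norm of \<open>q n\<close> is that of \<open>Q n\<close> cut down to
    \<open>\<sigma> + K\<close>. The uniform bound is what \<open>L2_Fatou\<close> asks for, and the
    summand 1 covers the approximation error.\<close>
  have q_norm: "l2_norm \<mu> (q n) \<le> l2_norm \<nu> F + 1" for n
  proof -
    have "l2_norm \<mu> (q n) = l2_norm \<nu> (\<lambda>\<gamma>. \<Sum>i\<in>S' n. c n i * dual_wave i \<gamma>)"
      unfolding q_def by (rule l2_norm_combination_eq) (auto simp: wave_L2 dual_wave_L2 wave_gram)
    also have "(\<lambda>\<gamma>. \<Sum>i\<in>S' n. c n i * dual_wave i \<gamma>) = (\<lambda>\<gamma>. indicator (coset K \<sigma>) \<gamma> * Q n \<gamma>)"
    proof
      fix \<gamma>
      have "indicator (coset K \<sigma>) \<gamma> * dual_wave i \<gamma> = (if snd i \<in> coset K \<sigma> then dual_wave i \<gamma> else 0)" for i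
      proof (cases i)
        case (Pair s \<sigma>')
        show ?thesis
        proof (cases "\<sigma>' \<in> coset K \<sigma>")
          case True
          then have "coset K \<sigma>' = coset K \<sigma>"
            by (rule coset_eq[OF subgroup_K])
          then show ?thesis
            using True by (auto simp: Pair dual_wave_def indicator_def)
        next
          case False
          then have "coset K \<sigma>' \<inter> coset K \<sigma> = {}"
            using coset_self[OF subgroup_K] coset_disjoint[OF subgroup_K] by metis
          then show ?thesis
            using False by (auto simp: Pair dual_wave_def indicator_def)
        qed
      qed
      then have "indicator (coset K \<sigma>) \<gamma> * Q n \<gamma> =
          (\<Sum>i\<in>S n. if snd i \<in> coset K \<sigma> then c n i * dual_wave i \<gamma> else 0)"
        unfolding Q_def sum_distrib_left by (intro sum.cong) (auto simp: mult.left_commute)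
      also have "\<dots> = (\<Sum>i\<in>S' n. c n i * dual_wave i \<gamma>)"
        unfolding S'_def using fin by (simp add: sum.If_cases Int_def)
      finally show "(\<Sum>i\<in>S' n. c n i * dual_wave i \<gamma>) = indicator (coset K \<sigma>) \<gamma> * Q n \<gamma>" ..
    qed
    also have "l2_norm \<nu> \<dots> \<le> l2_norm \<nu> (Q n)"
      unfolding l2_norm_def
    proof (intro real_sqrt_le_mono integral_mono)
      have "(\<lambda>\<gamma>. indicator (coset K \<sigma>) \<gamma> * Q n \<gamma>) \<in> L2 \<nu>"
        using L2_measurable[OF QL[of n]] by (intro L2_dominated[OF QL[of n], of _ 1]) (auto simp: indicator_def)
      then show "integrable \<nu> (\<lambda>\<gamma>. (cmod (indicator (coset K \<sigma>) \<gamma> * Q n \<gamma>))\<^sup>2)"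
        by (rule L2_integrable)
      show "(cmod (indicator (coset K \<sigma>) \<gamma> * Q n \<gamma>))\<^sup>2 \<le> (cmod (Q n \<gamma>))\<^sup>2" for \<gamma>
        by (auto simp: indicator_def)
    qed (rule L2_integrable[OF QL])
    also have "\<dots> \<le> l2_norm \<nu> F + l2_norm \<nu> (\<lambda>\<gamma>. F \<gamma> - Q n \<gamma>)"
      using l2_norm_triangle_diff[OF F QL[of n]] by simp
    also have "\<dots> \<le> l2_norm \<nu> F + 1"
      using order.strict_trans2[OF small[of n], of 1] by simp
    finally show ?thesis .
  qed
  have PL: "P F \<in> L2 \<mu>"
    by (rule L2_Fatou[OF qL q_norm q_lim])
  define F' where "F' \<gamma> = indicator (coset K \<sigma>) \<gamma> * F \<gamma>" for \<gamma>
  have F'L: "F' \<in> L2 \<nu>"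
    unfolding F'_def using L2_measurable[OF F] by (intro L2_dominated[OF F, of _ 1]) (auto simp: indicator_def)
  have "l2_inner \<nu> F' (dual_wave (s, \<sigma>')) = l2_inner \<mu> (P F) (wave (s, \<sigma>'))" for s \<sigma>'
  proof -
    define \<beta> where "\<beta> = l2_inner \<nu> F (dual_wave (s, \<sigma>))"
    \<comment> \<open>On \<open>\<sigma> + K\<close> the function
      \<open>dual_wave (x, \<sigma>)\<close> depends on \<open>x\<close> only through its coset.
      Hence \<open>P F\<close> is a multiple of the character \<open>\<sigma>\<close> on each coset
      of \<open>H\<close>, and its coefficients reduce to \<open>integral_coset_G\<close>.\<close>
    have "P F x = pairing x \<sigma> * \<beta>" if x: "x \<in> coset H s" for x
    proof -
      have "dual_wave (x, \<sigma>) \<gamma> = dual_wave (s, \<sigma>) \<gamma>" for \<gamma>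
      proof (cases "\<gamma> \<in> coset K \<sigma>")
        case True
        then have "pairing (x - s) (\<gamma> - \<sigma>) = 1"
          using x by (auto simp: coset_iff annihilator_def)
        then have "pairing x (\<gamma> - \<sigma>) = pairing s (\<gamma> - \<sigma>)"
          using dual_apply_add[of "\<gamma> - \<sigma>" "x - s" s] by simp
        then show ?thesis
          by (simp add: dual_wave_def)
      qed (simp add: dual_wave_def)
      then have "dual_wave (x, \<sigma>) = dual_wave (s, \<sigma>)"
        by (rule ext)
      then show ?thesis
        by (simp add: P_def \<beta>_def)
    qed
    then have "P F x * cnj (wave (s, \<sigma>') x) = \<beta> * (indicator (coset H s) x * pairing x (\<sigma> - \<sigma>'))" for x
      by (auto simp: wave_def indicator_def dual_apply_dual_diff)
    then have lhs: "l2_inner \<mu> (P F) (wave (s, \<sigma>')) = \<beta> * (if \<sigma> - \<sigma>' \<in> K then pairing s (\<sigma> - \<sigma>') else 0)"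
      unfolding l2_inner_def by (simp add: integral_coset_G[symmetric])
    show ?thesis
    proof (cases "\<sigma> - \<sigma>' \<in> K")
      case True
      then have "coset K \<sigma> = coset K \<sigma>'"
        using coset_eq_iff[OF subgroup_K] by blast
      then have eq: "F' \<gamma> * cnj (dual_wave (s, \<sigma>') \<gamma>) = pairing s (\<sigma> - \<sigma>') * (F \<gamma> * cnj (dual_wave (s, \<sigma>) \<gamma>))" for \<gamma>
        by (auto simp: F'_def dual_wave_def indicator_def dual_apply_dual_diff mult.commute mult.left_commute)
      have "l2_inner \<nu> F' (dual_wave (s, \<sigma>')) = pairing s (\<sigma> - \<sigma>') * \<beta>"
        unfolding \<beta>_def l2_inner_def eq by simp
      then show ?thesis
        using lhs True by (simp add: mult.commute)
    next
      case False
      then have "coset K \<sigma> \<inter> coset K \<sigma>' = {}"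
        using coset_eq_iff[OF subgroup_K] coset_disjoint[OF subgroup_K] by metis
      then have "F' \<gamma> * cnj (dual_wave (s, \<sigma>') \<gamma>) = 0" for \<gamma>
        by (auto simp: F'_def dual_wave_def indicator_def)
      then show ?thesis
        unfolding lhs using False by (simp only: l2_inner_def integral_zero if_False mult_zero_right)
    qed
  qed
  then have "plancherel \<mu> \<nu> (P F) F'"
    using PL F'L by (simp add: plancherel_iff split_paired_all)
  then show ?thesis
    unfolding F'_def by blast
qed

text \<open>A compact support meets finitely many cosets of \<open>K\<close>, and the preimages of
  the pieces add up.\<close>

lemma plancherel_exists:
  assumes F: "F \<in> L2 \<nu>" and C: "compact C" "\<And>\<gamma>. \<gamma> \<notin> C \<Longrightarrow> F \<gamma> = 0"
  shows "\<exists>f. plancherel \<mu> \<nu> f F"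
proof -
  obtain Fs where Fs: "finite Fs" "Fs \<subseteq> range (coset K)" "C \<subseteq> \<Union>Fs"
    by (rule Gd.compact_finite_cosets[OF C(1)])
  have "\<exists>f. plancherel \<mu> \<nu> f (\<lambda>\<gamma>. indicator D \<gamma> * F \<gamma>)" if "D \<in> Fs" for D
    using that Fs(2) plancherel_exists_coset[OF F] by auto
  then obtain f where "\<And>D. D \<in> Fs \<Longrightarrow> plancherel \<mu> \<nu> (f D) (\<lambda>\<gamma>. indicator D \<gamma> * F \<gamma>)"
    by metis
  then have "plancherel \<mu> \<nu> (\<lambda>x. \<Sum>D\<in>Fs. 1 * f D x) (\<lambda>\<gamma>. \<Sum>D\<in>Fs. 1 * (indicator D \<gamma> * F \<gamma>))"
    by (rule plancherel_combination)
  moreover have "(\<Sum>D\<in>Fs. 1 * (indicator D \<gamma> * F \<gamma>)) = F \<gamma>" for \<gamma>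
    using sum_indicator_disjoint[OF Fs(1) disjoint_cosets[OF subgroup_K Fs(2)], of \<gamma> "F \<gamma>"]
      Fs(3) C(2)[of \<gamma>] by auto
  ultimately show ?thesis
    by auto
qed

text \<open>\<open>F'\<close> is the representative that actually occurs and \<open>F\<close> a
  version supported in a compact set: what \<open>fourier\<close> returns is known only almost
  everywhere.\<close>

lemma inverse_fourier_plancherel:
  assumes "F \<in> L2 \<nu>" and "compact C" "\<And>\<gamma>. \<gamma> \<notin> C \<Longrightarrow> F \<gamma> = 0"
    and "F' \<in> borel_measurable \<nu>" "AE \<gamma> in \<nu>. F \<gamma> = F' \<gamma>"
  shows "plancherel \<mu> \<nu> (inverse_fourier \<mu> \<nu> F') F'"
proof -
  obtain f where "plancherel \<mu> \<nu> f F"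
    using plancherel_exists[OF assms(1-3)] by blast
  then have "plancherel \<mu> \<nu> f F'"
    using assms(4,5) by (rule plancherel_cong_AE)
  then show ?thesis
    unfolding inverse_fourier_def by (rule someI[where P = "\<lambda>f. plancherel \<mu> \<nu> f F'"])
qed

text \<open>For integrable functions this is a change of variables, where the normalising
  \<open>sqrt c\<close> meets the factor \<open>1 / c\<close> of the measure. The approximating
  sequence of \<open>f\<close> is dilated along with it.\<close>

theorem plancherel_dilate:
  assumes A: "A \<in> Aut" and fF: "plancherel \<mu> \<nu> f F"
  shows "plancherel \<mu> \<nu> (dilate \<mu> A f)
    (\<lambda>\<gamma>. of_real (1 / sqrt (modulus \<mu> A)) * F (adjoint_aut (inv A) \<gamma>))"
proof -
  define c where "c = modulus \<mu> A"
  have c: "c > 0" "emeasure \<mu> (A ` H) = ennreal c"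
    unfolding c_def by (rule G.modulus_pos[OF A] G.emeasure_modulus[OF A])+
  note A' = Aut_additive[OF A] AutD(2)[OF A]
  let ?B = "adjoint_aut (inv A)"
  have B: "?B \<in> Aut"
    by (rule adjoint_Aut[OF inv_Aut[OF A]])
  note B' = Aut_additive[OF B] AutD(2)[OF B]
  \<comment> \<open>The modulus on the dual side enters only as a constant factor of the
    approximation error, so its relation to \<open>c\<close> is left open.\<close>
  define d where "d = modulus \<nu> ?B"
  have d: "d > 0" "emeasure \<nu> (?B ` K) = ennreal d"
    unfolding d_def by (rule Gd.modulus_pos[OF B] Gd.emeasure_modulus[OF B])+
  have dil: "dilate \<mu> A g = (\<lambda>x. of_real (sqrt c) * g (A x))" for g
    by (simp add: dilate_def c_def fun_eq_iff)
  have dil_L2: "dilate \<mu> A g \<in> L2 \<mu>" if "g \<in> L2 \<mu>" for g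
    unfolding dil by (intro L2_cmult G.L2_automorphism[OF A' c that])
  have dil_L2': "(\<lambda>\<gamma>. of_real (1 / sqrt c) * g (?B \<gamma>)) \<in> L2 \<nu>" if "g \<in> L2 \<nu>" for g
    by (intro L2_cmult Gd.L2_automorphism[OF B' d that])
  have dil_F: "fourier_L1 \<mu> (dilate \<mu> A g) = (\<lambda>\<gamma>. of_real (1 / sqrt c) * fourier_L1 \<mu> g (?B \<gamma>))"
    if g: "integrable \<mu> g" for g
  proof
    fix \<gamma>
    have [measurable]: "g \<in> borel_measurable borel" "inv A \<in> borel_measurable borel"
      using borel_measurable_integrable[OF g] AutD(7)[OF A] by (auto intro: borel_measurable_continuous_onI)
    have "fourier_L1 \<mu> (dilate \<mu> A g) \<gamma> =
        of_real (sqrt c) * (LINT x|\<mu>. (\<lambda>y. g y * cnj (pairing (inv A y) \<gamma>)) (A x))"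
      unfolding fourier_L1_def dil by (simp add: AutD(5)[OF A] mult.assoc)
    also have "(LINT x|\<mu>. (\<lambda>y. g y * cnj (pairing (inv A y) \<gamma>)) (A x)) =
        (1 / c) *\<^sub>R (LINT y|\<mu>. g y * cnj (pairing (inv A y) \<gamma>))"
      by (rule G.integral_automorphism[OF A' c]) measurable
    also have "(LINT y|\<mu>. g y * cnj (pairing (inv A y) \<gamma>)) = fourier_L1 \<mu> g (?B \<gamma>)"
      unfolding fourier_L1_def by (simp add: pairing_adjoint inv_Aut[OF A])
    also have "of_real (sqrt c) * ((1 / c) *\<^sub>R fourier_L1 \<mu> g (?B \<gamma>)) =
        of_real (1 / sqrt c) * fourier_L1 \<mu> g (?B \<gamma>)"
    proof -
      have "sqrt c * (1 / c) = 1 / sqrt c"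
        using c(1) by (simp add: divide_simps)
      then have "complex_of_real (sqrt c) * of_real (1 / c) = of_real (1 / sqrt c)"
        by (simp only: of_real_mult[symmetric])
      then show ?thesis
        by (simp only: scaleR_conv_of_real mult.assoc[symmetric])
    qed
    finally show "fourier_L1 \<mu> (dilate \<mu> A g) \<gamma> = of_real (1 / sqrt c) * fourier_L1 \<mu> g (?B \<gamma>)" .
  qed
  obtain g where L: "f \<in> L2 \<mu>" "F \<in> L2 \<nu>" and
    g: "\<And>n::nat. integrable \<mu> (g n) \<and> g n \<in> L2 \<mu> \<and> fourier_L1 \<mu> (g n) \<in> L2 \<nu>"
      "(\<lambda>n. l2_norm \<mu> (\<lambda>x. g n x - f x)) \<longlonglongrightarrow> 0"
      "(\<lambda>n. l2_norm \<nu> (\<lambda>\<gamma>. fourier_L1 \<mu> (g n) \<gamma> - F \<gamma>)) \<longlonglongrightarrow> 0"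
    using fF unfolding plancherel_def by blast
  have int: "integrable \<mu> (dilate \<mu> A (g n))" for n
  proof -
    have "g n \<in> borel_measurable borel"
      using borel_measurable_integrable[of \<mu> "g n"] g(1)[of n] by simp
    then show ?thesis
      unfolding dil using G.integrable_automorphism[OF A' c, of "g n"] g(1) by simp
  qed
  have "l2_norm \<mu> (\<lambda>x. dilate \<mu> A (g n) x - dilate \<mu> A f x) = l2_norm \<mu> (\<lambda>x. g n x - f x)" for n
  proof -
    have "(\<lambda>x. dilate \<mu> A (g n) x - dilate \<mu> A f x) = (\<lambda>x. of_real (sqrt c) * (g n (A x) - f (A x)))"
      by (simp add: dil right_diff_distrib)
    then show ?thesis
      using G.l2_norm_automorphism[OF A' c L2_diff[of "g n" \<mu> f]] g(1)[of n] L c(1)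
      by (simp add: l2_norm_cmult)
  qed
  moreover have "l2_norm \<nu> (\<lambda>\<gamma>. fourier_L1 \<mu> (dilate \<mu> A (g n)) \<gamma> - of_real (1 / sqrt c) * F (?B \<gamma>)) =
      (1 / sqrt c / sqrt d) * l2_norm \<nu> (\<lambda>\<gamma>. fourier_L1 \<mu> (g n) \<gamma> - F \<gamma>)" for n
  proof -
    have eq: "(\<lambda>\<gamma>. fourier_L1 \<mu> (dilate \<mu> A (g n)) \<gamma> - of_real (1 / sqrt c) * F (?B \<gamma>)) =
        (\<lambda>\<gamma>. of_real (1 / sqrt c) * (fourier_L1 \<mu> (g n) (?B \<gamma>) - F (?B \<gamma>)))"
      using g(1)[of n] by (simp only: dil_F right_diff_distrib)
    show ?thesis
      unfolding eq l2_norm_cmult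
      using Gd.l2_norm_automorphism[OF B' d L2_diff[of "fourier_L1 \<mu> (g n)" \<nu> F]] g(1)[of n] L c(1)
      by (simp add: norm_divide)
  qed
  moreover have "(\<lambda>n. (1 / sqrt c / sqrt d) * l2_norm \<nu> (\<lambda>\<gamma>. fourier_L1 \<mu> (g n) \<gamma> - F \<gamma>)) \<longlonglongrightarrow> 0"
    using tendsto_mult_left[OF g(3), of "1 / sqrt c / sqrt d"] by simp
  ultimately have "(\<lambda>n. l2_norm \<mu> (\<lambda>x. dilate \<mu> A (g n) x - dilate \<mu> A f x)) \<longlonglongrightarrow> 0"
    "(\<lambda>n. l2_norm \<nu> (\<lambda>\<gamma>. fourier_L1 \<mu> (dilate \<mu> A (g n)) \<gamma> - of_real (1 / sqrt c) * F (?B \<gamma>))) \<longlonglongrightarrow> 0"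
    using g(2) by simp_all
  then show ?thesis
    unfolding plancherel_def c_def[symmetric] using int dil_L2 dil_L2' L g(1)
    by (intro conjI exI[of _ "\<lambda>n. dilate \<mu> A (g n)"]) (auto simp: dil_F)
qed

lemma l2_inner_dilate:
  assumes A: "A \<in> Aut" and f: "f \<in> L2 \<mu>" and g: "g \<in> L2 \<mu>"
  shows "l2_inner \<mu> (dilate \<mu> A f) (dilate \<mu> A g) = l2_inner \<mu> f g"
proof -
  define c where "c = modulus \<mu> A"
  have c: "c > 0" "emeasure \<mu> (A ` H) = ennreal c"
    unfolding c_def by (rule G.modulus_pos[OF A] G.emeasure_modulus[OF A])+
  have [measurable]: "f \<in> borel_measurable borel" "g \<in> borel_measurable borel"
    using L2_measurable[OF f] L2_measurable[OF g] by simp_all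
  have "dilate \<mu> A f x * cnj (dilate \<mu> A g x) = of_real c * (f (A x) * cnj (g (A x)))" for x
  proof -
    have "complex_of_real (sqrt c) * of_real (sqrt c) = of_real c"
      using c(1) by (simp flip: of_real_mult)
    then show ?thesis
      unfolding dilate_def c_def[symmetric] by (metis (no_types) complex_cnj_complex_of_real complex_cnj_mult
          mult.assoc mult.left_commute)
  qed
  then have "l2_inner \<mu> (dilate \<mu> A f) (dilate \<mu> A g) = of_real c * (LINT x|\<mu>. (\<lambda>y. f y * cnj (g y)) (A x))"
    unfolding l2_inner_def by simp
  also have "(LINT x|\<mu>. (\<lambda>y. f y * cnj (g y)) (A x)) = (1 / c) *\<^sub>R (LINT y|\<mu>. f y * cnj (g y))"
    by (rule G.integral_automorphism[OF Aut_additive[OF A] AutD(2)[OF A] c]) measurable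
  finally show ?thesis
    using c(1) by (simp add: l2_inner_def scaleR_conv_of_real)
qed

end

section \<open>Wavelet collections of sets\<close>

text \<open>A nonzero \<open>x\<close> lies outside one of the open subgroups in the intersection
  that defines expansiveness, and a character trivial on that subgroup can be chosen different from
  1 at \<open>x\<close>.\<close>

lemma expansive_separates:
  fixes H :: "'a::{topological_ab_group_add,t2_space} set"
  assumes H: "compact_open_subgroup H" and A: "expansive H A" and x: "x \<noteq> (0 :: 'a)"
  shows "\<exists>\<gamma>. pairing x \<gamma> \<noteq> 1"
proof -
  have "A \<in> Aut" "x \<notin> (\<Inter>n\<in>{..0}. int_pow A n ` H)"
    using A x by (auto simp: expansive_def)
  then obtain n where n: "x \<notin> int_pow A n ` H"
    by blast
  have "compact_open_subgroup (int_pow A n ` H)"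
    by (rule compact_open_subgroup_image[OF H int_pow_Aut[OF \<open>A \<in> Aut\<close>]])
  then show ?thesis
    using characters_separate_open_subgroup[OF _ _ n] by (auto simp: compact_open_subgroup_def)
qed

lemma disjoint_supports_inner:
  assumes "\<And>x. f x = 0 \<or> g x = 0"
  shows "l2_inner M f g = 0"
proof -
  have "f x * cnj (g x) = 0" for x
    using assms[of x] by auto
  then show ?thesis
    unfolding l2_inner_def by (simp only: integral_zero)
qed

text \<open>Composition with \<open>A\<close> rescales all norms by the same constant, which is why
  the error is enlarged by \<open>c\<close> beforehand.\<close>

lemma (in haar_group) l2_closed_span_automorphism:
  assumes A: "A \<in> Aut" and f: "f \<in> l2_closed_span M B"
    and B: "\<And>b. b \<in> B \<Longrightarrow> (\<lambda>x. b (A x)) \<in> l2_closed_span M B'"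
    and L: "B \<subseteq> L2 M" "B' \<subseteq> L2 M"
  shows "(\<lambda>x. f (A x)) \<in> l2_closed_span M B'"
proof -
  note A' = Aut_additive[OF A] AutD(2)[OF A] modulus_pos[OF A] emeasure_modulus[OF A]
  define c where "c = sqrt (modulus M A)"
  have c: "c > 0"
    using modulus_pos[OF A] by (simp add: c_def)
  have fL: "f \<in> L2 M"
    by (rule l2_closed_span_L2[OF f])
  show ?thesis
  proof (rule l2_closed_spanI[OF _ _ L(2)])
    show "(\<lambda>x. f (A x)) \<in> L2 M"
      by (rule L2_automorphism[OF A' fL])
    fix \<epsilon> :: real assume "\<epsilon> > 0"
    then have "\<epsilon> * c > 0"
      using c by simp
    then obtain S d where S: "finite S" "S \<subseteq> B" "l2_norm M (\<lambda>x. f x - (\<Sum>b\<in>S. d b * b x)) < \<epsilon> * c"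
      using f unfolding l2_closed_span_def by blast
    have "(\<lambda>x. f x - (\<Sum>b\<in>S. d b * b x)) \<in> L2 M"
      using S(2) L(1) by (intro L2_diff fL L2_combination) auto
    from l2_norm_automorphism[OF A' this] S(3)
    have "l2_norm M (\<lambda>x. f (A x) - (\<Sum>b\<in>S. d b * b (A x))) < \<epsilon>"
      using pos_divide_less_eq[OF c] by (simp add: c_def[symmetric])
    moreover have "(\<lambda>x. \<Sum>b\<in>S. d b * b (A x)) \<in> l2_closed_span M B'"
      using S(2) B by (intro l2_closed_span_sum l2_closed_span_cmult L(2)) auto
    ultimately show "\<exists>g\<in>l2_closed_span M B'. l2_norm M (\<lambda>x. f (A x) - g x) < \<epsilon>"
      by (intro bexI[where x = "\<lambda>x. \<Sum>b\<in>S. d b * b (A x)"]) auto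
  qed
qed

section \<open>Coset representatives and the dynamics of the adjoint on the dual\<close>

locale wavelet_setting = dual_pair H \<mu> \<nu>
  for H :: "'a::{topological_ab_group_add,t2_space} set" and \<mu> \<nu> +
  fixes D :: "'a dual set" and A1 :: "'a \<Rightarrow> 'a"
  assumes reps: "coset_representatives K D"
    and expansive_A1: "expansive H A1"
begin

abbreviation "\<theta> \<equiv> theta K D"
abbreviation "\<eta> \<equiv> eta K D"
abbreviation "B \<equiv> adjoint_aut A1"

lemma A1_Aut: "A1 \<in> Aut"
  using expansive_A1 by (simp add: expansive_def)

lemma B_Aut: "B \<in> Aut" and bij_B: "bij B" and bij_A1: "bij A1"
  using adjoint_Aut[OF A1_Aut] AutD(3) A1_Aut by blast+

lemma coset_K_sym: "\<sigma> \<in> coset K \<gamma> \<longleftrightarrow> \<gamma> \<in> coset K \<sigma>"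
  using coset_eq[OF subgroup_K] coset_self[OF subgroup_K] by blast

lemma theta_in_D: "\<theta> \<gamma> \<in> D" and theta_coset: "\<gamma> \<in> coset K (\<theta> \<gamma>)"
proof -
  have "\<exists>!\<sigma>. \<sigma> \<in> D \<inter> coset K \<gamma>"
    using reps by (simp add: coset_representatives_def)
  then have "\<theta> \<gamma> \<in> D \<inter> coset K \<gamma>"
    unfolding theta_def by (rule theI')
  then show "\<theta> \<gamma> \<in> D" "\<gamma> \<in> coset K (\<theta> \<gamma>)"
    using coset_K_sym by blast+
qed

lemma theta_eqI:
  assumes "\<sigma> \<in> D" "\<gamma> \<in> coset K \<sigma>"
  shows "\<theta> \<gamma> = \<sigma>"
proof -
  have "\<exists>!\<sigma>. \<sigma> \<in> D \<inter> coset K \<gamma>"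
    using reps by (simp add: coset_representatives_def)
  then show ?thesis
    unfolding theta_def by (rule the1_equality) (use assms coset_K_sym in blast)
qed

lemma eta_in_K: "\<eta> \<gamma> \<in> K"
  by (rule eta_annihilator[OF reps])

lemma eta_eqI: "\<sigma> \<in> D \<Longrightarrow> \<gamma> \<in> coset K \<sigma> \<Longrightarrow> \<eta> \<gamma> = \<gamma> - \<sigma>"
  by (simp add: eta_def theta_eqI)

text \<open>On each open coset of \<open>K\<close> the map subtracts a fixed representative.\<close>

lemma continuous_eta: "continuous_on UNIV \<eta>"
proof -
  have "open (\<eta> -` U)" if U: "open U" for U
  proof -
    have "\<eta> -` U = (\<Union>\<sigma>\<in>D. coset K \<sigma> \<inter> (+) (- \<sigma>) -` U)"
    proof (intro equalityI subsetI)
      fix \<gamma> assume "\<gamma> \<in> \<eta> -` U"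
      then have "\<gamma> \<in> coset K (\<theta> \<gamma>) \<inter> (+) (- \<theta> \<gamma>) -` U"
        using theta_coset by (simp add: eta_def)
      then show "\<gamma> \<in> (\<Union>\<sigma>\<in>D. coset K \<sigma> \<inter> (+) (- \<sigma>) -` U)"
        using theta_in_D by blast
    qed (auto simp: eta_eqI)
    moreover have "open (coset K \<sigma> \<inter> (+) (- \<sigma>) -` U)" for \<sigma>
      using U Gd.continuous_plus by (intro open_Int Gd.open_coset open_vimage)
    ultimately show ?thesis
      by (simp add: open_UN)
  qed
  then show ?thesis
    by (simp add: continuous_on_open_vimage)
qed

lemma eta_measurable [measurable]: "\<eta> \<in> borel_measurable borel"
  by (rule borel_measurable_continuous_onI[OF continuous_eta])

text \<open>A compact set meets finitely many cosets, each with one representative. Hence on a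
  compact set \<open>\<eta>\<close> consists of finitely many translations.\<close>

lemma finite_theta_image:
  assumes C: "compact C"
  shows "finite (\<theta> ` C)"
proof -
  obtain Fs where Fs: "finite Fs" "Fs \<subseteq> range (coset K)" "C \<subseteq> \<Union>Fs"
    by (rule Gd.compact_finite_cosets[OF C])
  have "coset K (\<theta> \<gamma>) \<in> Fs" if \<gamma>: "\<gamma> \<in> C" for \<gamma>
  proof -
    obtain C' where C': "C' \<in> Fs" "\<gamma> \<in> C'"
      using Fs(3) \<gamma> by blast
    moreover obtain \<sigma> where "C' = coset K \<sigma>"
      using Fs(2) C'(1) by blast
    ultimately have "coset K \<sigma> \<in> Fs" "\<gamma> \<in> coset K \<sigma>"
      by auto
    then show ?thesis
      using coset_eq[OF subgroup_K, of \<gamma> \<sigma>] coset_eq[OF subgroup_K theta_coset, of \<gamma>] by simp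
  qed
  then have "coset K ` \<theta> ` C \<subseteq> Fs"
    by auto
  moreover have "inj_on (coset K) (\<theta> ` C)"
  proof (rule inj_onI)
    fix \<sigma> \<sigma>' assume "\<sigma> \<in> \<theta> ` C" "\<sigma>' \<in> \<theta> ` C" and eq: "coset K \<sigma> = coset K \<sigma>'"
    then have "\<sigma> \<in> D" "\<sigma>' \<in> D"
      using theta_in_D by auto
    then show "\<sigma> = \<sigma>'"
      using theta_eqI[of \<sigma> \<sigma>] theta_eqI[of \<sigma>' \<sigma>] eq coset_self[OF subgroup_K] by metis
  qed
  ultimately show ?thesis
    using Fs(1) finite_imageD finite_subset by metis
qed

lemma B_pow_image_sets:
  assumes "E \<in> sets borel"
  shows "int_pow B n ` E \<in> sets borel"
proof -
  have "int_pow B n ` E = int_pow B (- n) -` E"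
    using int_pow_image_iff[OF bij_B] by blast
  moreover have "int_pow B (- n) \<in> borel_measurable borel"
    by (rule borel_measurable_continuous_onI[OF AutD(6)[OF int_pow_Aut[OF B_Aut]]])
  ultimately show ?thesis
    using measurable_sets[of "int_pow B (- n)" borel borel E] assms by simp
qed

text \<open>Duality reverses the direction of the exponent, and it lets monotonicity and exhaustion
  for \<open>B\<close> and \<open>K\<close> be read off from \<open>A1\<close> and
  \<open>H\<close>.\<close>

lemma B_pow_image_K: "int_pow B n ` K = annihilator (int_pow A1 (- n) ` H)"
  using annihilator_image[OF int_pow_Aut[OF A1_Aut], of "- n" H]
  by (simp add: inv_int_pow[OF bij_A1] adjoint_int_pow[OF A1_Aut])

lemma A1_pow_mono: "m \<le> n \<Longrightarrow> int_pow A1 m ` H \<subseteq> int_pow A1 n ` H"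
proof (induction n rule: int_ge_induct)
  case (step n)
  have "int_pow A1 n ` H \<subseteq> int_pow A1 n ` A1 ` H"
    using expansive_A1 by (intro image_mono) (auto simp: expansive_def)
  also have "\<dots> = int_pow A1 (n + 1) ` H"
    by (simp add: int_pow_image_add[OF bij_A1])
  finally show ?case
    using step by blast
qed simp

lemma B_pow_mono: "m \<le> n \<Longrightarrow> int_pow B m ` K \<subseteq> int_pow B n ` K"
  unfolding B_pow_image_K using A1_pow_mono[of "- n" "- m"] by (auto simp: annihilator_def)

text \<open>The subgroups \<open>L k\<close> shrink to 0, so one of them lies in the neighbourhood
  \<open>U\<close> of 0 where \<open>\<gamma>\<close> has positive real part. On that subgroup
  \<open>\<gamma>\<close> is then trivial.\<close>

lemma B_pow_exhaust: "\<exists>n. \<gamma> \<in> int_pow B n ` K"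
proof -
  define L where "L k = int_pow A1 (- int k) ` H" for k
  have L: "compact_open_subgroup (L k)" for k
    unfolding L_def by (rule compact_open_subgroup_image[OF H int_pow_Aut[OF A1_Aut]])
  define U where "U = {x. Re (pairing x \<gamma>) > 0}"
  have U: "open U"
    unfolding U_def by (intro open_Collect_less continuous_intros dual_apply_continuous)
  \<comment> \<open>Every nonzero point of \<open>H\<close> leaves some \<open>L k\<close>, and 0
    lies in \<open>U\<close>. Since the \<open>L k\<close> decrease, a finite subcover amounts to a
    single \<open>L m\<close> inside \<open>U\<close>.\<close>
  have "H \<subseteq> (\<Union>k\<in>UNIV. U \<union> - L k)"
  proof
    fix x assume "x \<in> H"
    show "x \<in> (\<Union>k\<in>UNIV. U \<union> - L k)"
    proof (cases "x = 0")
      case False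
      then have "x \<notin> (\<Inter>n\<in>{..0}. int_pow A1 n ` H)"
        using expansive_A1 by (simp add: expansive_def)
      then obtain n where n: "n \<le> 0" "x \<notin> int_pow A1 n ` H"
        by blast
      then have "x \<notin> L (nat (- n))"
        by (simp add: L_def)
      then show ?thesis
        by blast
    qed (simp add: U_def)
  qed
  moreover have "open (U \<union> - L k)" for k
    using U L[of k] by (intro open_Un) (auto simp: compact_open_subgroup_def intro: compact_imp_closed)
  ultimately obtain F where F: "finite F" "H \<subseteq> (\<Union>k\<in>F. U \<union> - L k)"
    using compactE_image[of H UNIV "\<lambda>k. U \<union> - L k"] H by (metis compact_open_subgroup_def)
  define m where "m = Max (insert 0 F)"
  have "L m \<subseteq> U"
  proof
    fix x assume x: "x \<in> L m"
    have "L m \<subseteq> H"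
      using A1_pow_mono[of "- int m" 0] by (simp add: L_def)
    then obtain k where k: "k \<in> F" "x \<in> U \<union> - L k"
      using F(2) x by blast
    then have "k \<le> m"
      using F(1) by (simp add: m_def)
    then have "L m \<subseteq> L k"
      unfolding L_def by (intro A1_pow_mono) simp
    then show "x \<in> U"
      using k x by blast
  qed
  then have "\<gamma> \<in> annihilator (L m)"
    using dual_apply_eq_1_on_subgroup[of "L m" \<gamma>] L[of m]
    by (auto simp: annihilator_def U_def compact_open_subgroup_def)
  then show ?thesis
    unfolding L_def B_pow_image_K[of "int m", symmetric] by blast
qed

lemma B_pow_K_sets [measurable]: "int_pow B n ` K \<in> sets borel"
  using compact_open_subgroup_image[OF Gd.compact_open int_pow_Aut[OF B_Aut]]
  by (auto simp: compact_open_subgroup_def)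

text \<open>The number 2 counts two disjoint cosets of \<open>K\<close> in the image. The second
  comes from a character trivial on \<open>inv A1\<close> applied to \<open>H\<close> but not on
  \<open>H\<close>, which exists because \<open>H\<close> is strictly smaller than its image under
  \<open>A1\<close>.\<close>

lemma emeasure_BK: "emeasure \<nu> (B ` K) \<ge> 2"
proof -
  have "inv A1 ` H \<subset> H"
  proof -
    have "inv A1 ` H \<subseteq> inv A1 ` A1 ` H" "inv A1 ` A1 ` H = H"
      using expansive_A1 AutD(5)[OF A1_Aut] by (auto simp: expansive_def image_image)
    moreover have "inv A1 ` H \<noteq> H"
    proof
      assume "inv A1 ` H = H"
      then have "A1 ` H = A1 ` inv A1 ` H"
        by simp
      also have "\<dots> = H"
        using AutD(4)[OF A1_Aut] by (simp add: image_image)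
      finally show False
        using expansive_A1 by (auto simp: expansive_def)
    qed
    ultimately show ?thesis
      by blast
  qed
  then obtain x where x: "x \<in> H" "x \<notin> inv A1 ` H"
    by blast
  have "compact_open_subgroup (inv A1 ` H)"
    by (rule compact_open_subgroup_image[OF H inv_Aut[OF A1_Aut]])
  then obtain \<sigma> where \<sigma>: "\<forall>y\<in>inv A1 ` H. pairing y \<sigma> = 1" "pairing x \<sigma> \<noteq> 1"
    using characters_separate_open_subgroup[OF _ _ x(2)] by (auto simp: compact_open_subgroup_def)
  have BK: "B ` K = annihilator (inv A1 ` H)"
    using B_pow_image_K[of 1] inv_int_pow[OF bij_A1, of 1] by simp
  have "add_subgroup (B ` K)"
    unfolding BK by (rule add_subgroup_annihilator)
  moreover have "\<sigma> \<in> B ` K" "\<sigma> \<notin> K"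
    unfolding BK using \<sigma> x(1) by (auto simp: annihilator_def)
  moreover have "K \<subseteq> B ` K"
    using B_pow_mono[of 0 1] by simp
  ultimately have "coset K 0 \<union> coset K \<sigma> \<subseteq> B ` K" "coset K 0 \<inter> coset K \<sigma> = {}"
    using add_subgroup_add[of "B ` K" \<sigma>] coset_disjoint[OF subgroup_K, of 0 \<sigma>] coset_eq_iff[OF subgroup_K, of \<sigma> 0]
    by (auto simp: coset_def)
  moreover from this(2) have "emeasure \<nu> (coset K 0) + emeasure \<nu> (coset K \<sigma>) = emeasure \<nu> (coset K 0 \<union> coset K \<sigma>)"
    by (intro plus_emeasure) auto
  moreover have "B ` K \<in> sets \<nu>"
    using B_pow_K_sets[of 1] by simp
  ultimately have "emeasure \<nu> (coset K 0) + emeasure \<nu> (coset K \<sigma>) \<le> emeasure \<nu> (B ` K)"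
    using emeasure_mono[of "coset K 0 \<union> coset K \<sigma>" "B ` K" \<nu>] by simp
  then show ?thesis
    by (simp only: Gd.emeasure_coset one_add_one)
qed

text \<open>\<open>Z\<close> consists of the points whose forward orbit stays in \<open>K\<close>,
  so it is invariant under \<open>B\<close>. Its measure is at most 1 and, by
  \<open>emeasure_BK\<close>, at least twice itself.\<close>

lemma null_core: "(\<Inter>k. int_pow B (- int k) ` K) \<in> null_sets \<nu>"
proof -
  define Z where "Z = (\<Inter>k. int_pow B (- int k) ` K)"
  have Z: "Z \<in> sets borel"
    unfolding Z_def by (intro sets.countable_INT) auto
  have mem: "\<gamma> \<in> Z \<longleftrightarrow> (\<forall>k. int_pow B (int k) \<gamma> \<in> K)" for \<gamma>
    unfolding Z_def by (simp add: int_pow_image_iff[OF bij_B])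
  have "B \<gamma> \<in> Z \<longleftrightarrow> \<gamma> \<in> Z" for \<gamma>
  proof -
    have pow: "int_pow B (int k) (B \<gamma>) = int_pow B (int (Suc k)) \<gamma>" for k
      using int_pow_add[OF bij_B, of "int k" 1 \<gamma>] by (simp add: add.commute)
    have mono: "\<gamma> \<in> K" if "int_pow B (int (Suc 0)) \<gamma> \<in> K"
      using that B_pow_mono[of "- 1" 0] int_pow_image_iff[OF bij_B, of \<gamma> "- 1" K] by auto
    show ?thesis
      unfolding mem pow using mono by (metis (full_types) int_pow_0 id_apply not0_implies_Suc of_nat_0)
  qed
  then have "B ` Z = Z"
    using AutD(4)[OF B_Aut] by (metis (no_types, lifting) imageI image_iff subsetI subset_antisym)
  then have eq: "emeasure \<nu> Z = emeasure \<nu> (B ` K) * emeasure \<nu> Z"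
    using Gd.emeasure_automorphism[OF Aut_additive[OF B_Aut] AutD(2)[OF B_Aut] Z] by simp
  have "Z \<subseteq> int_pow B (- int 0) ` K"
    unfolding Z_def by blast
  then have "Z \<subseteq> K"
    by simp
  then have "emeasure \<nu> Z \<le> 1"
    using emeasure_mono[of Z K \<nu>] Gd.emeasure_S by simp
  then obtain r where r: "emeasure \<nu> Z = ennreal r" "r \<ge> 0"
    by (cases "emeasure \<nu> Z") (auto simp: top_unique)
  have "2 * ennreal r \<le> ennreal r"
    using mult_right_mono[OF emeasure_BK, of "emeasure \<nu> Z"] eq r(1) by simp
  then have "2 * r \<le> r"
    using r(2) by (metis ennreal_le_iff ennreal_mult' ennreal_numeral mult_nonneg_nonneg zero_le_numeral)
  then have "emeasure \<nu> Z = 0"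
    using r by simp
  then show ?thesis
    using Z by (auto simp: Z_def[symmetric] intro: null_setsI)
qed

end

text \<open>A criterion on the dual side alone. Boundedness serves twice: it leaves finitely many
  cosets, on each of which \<open>\<eta>\<close> is a translation, and it provides the inverse
  transforms of \<open>plancherel_exists\<close>.\<close>

locale wavelet_sets = wavelet_setting H \<mu> \<nu> D A1
  for H :: "'a::{topological_ab_group_add,t2_space} set" and \<mu> \<nu> D A1 +
  fixes N :: nat and \<Omega> :: "nat \<Rightarrow> 'a dual set" and C :: "'a dual set"
  assumes \<Omega>_sets: "\<And>j. j \<in> {1..N} \<Longrightarrow> \<Omega> j \<in> sets borel"
    and \<Omega>_bounded: "compact C" "\<And>j. j \<in> {1..N} \<Longrightarrow> \<Omega> j \<subseteq> C"
    and \<Omega>_eta: "\<And>j. j \<in> {1..N} \<Longrightarrow> bij_betw (eta (annihilator H) D) (\<Omega> j) (annihilator H)"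
    and \<Omega>_disjoint: "\<And>j k m n. j \<in> {1..N} \<Longrightarrow> k \<in> {1..N} \<Longrightarrow> (j, m) \<noteq> (k, n) \<Longrightarrow>
      int_pow (adjoint_aut A1) m ` \<Omega> j \<inter> int_pow (adjoint_aut A1) n ` \<Omega> k = {}"
    and \<Omega>_cover: "AE \<gamma> in \<nu>. \<exists>n. \<exists>j\<in>{1..N}. \<gamma> \<in> int_pow (adjoint_aut A1) n ` \<Omega> j"
begin

definition reps_C :: "'a dual set" where
  "reps_C = \<theta> ` C"

lemma finite_reps_C: "finite reps_C"
  unfolding reps_C_def by (rule finite_theta_image[OF \<Omega>_bounded(1)])

lemma reps_C_D: "reps_C \<subseteq> D"
  using theta_in_D by (auto simp: reps_C_def)

lemma \<Omega>_reps:
  assumes "j \<in> {1..N}" "\<gamma> \<in> \<Omega> j"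
  shows "\<exists>\<sigma>\<in>reps_C. \<gamma> \<in> coset K \<sigma>"
  using assms \<Omega>_bounded(2) theta_coset by (auto simp: reps_C_def)

lemma reps_C_disjoint:
  assumes "\<sigma> \<in> reps_C" "\<sigma>' \<in> reps_C" "\<sigma> \<noteq> \<sigma>'"
  shows "coset K \<sigma> \<inter> coset K \<sigma>' = {}"
proof -
  have "\<sigma> \<in> D" "\<sigma>' \<in> D"
    using assms reps_C_D by auto
  then show ?thesis
    using theta_eqI assms(3) by blast
qed

text \<open>On each of the finitely many cosets meeting \<open>\<Omega> j\<close> the map \<open>\<eta>\<close> is a translation.\<close>

lemma emeasure_eta:
  assumes j: "j \<in> {1..N}" and E: "E \<in> sets borel"
  shows "emeasure \<nu> (\<Omega> j \<inter> \<eta> -` E) = emeasure \<nu> (K \<inter> E)"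
proof -
  have [measurable]: "\<Omega> j \<in> sets borel" "E \<in> sets borel"
    by (rule \<Omega>_sets[OF j], rule E)
  have inj: "inj_on \<eta> (\<Omega> j)" and img: "\<eta> ` \<Omega> j = K"
    using \<Omega>_eta[OF j] by (auto simp: bij_betw_def)
  define P where "P \<sigma> = \<Omega> j \<inter> coset K \<sigma> \<inter> \<eta> -` E" for \<sigma>
  have eta_meas: "\<eta> -` E \<in> sets borel"
    using measurable_sets[OF eta_measurable E] by simp
  have P [measurable]: "P \<sigma> \<in> sets borel" for \<sigma>
    unfolding P_def using eta_meas by (intro sets.Int) auto
  have sub: "P \<sigma> \<subseteq> coset K \<sigma>" for \<sigma>
    by (auto simp: P_def)
  have img_P: "\<eta> ` P \<sigma> = (+) (- \<sigma>) ` P \<sigma>" if "\<sigma> \<in> reps_C" for \<sigma>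
    using that reps_C_D by (intro image_cong) (auto simp: P_def eta_eqI)
  have img_sets: "\<eta> ` P \<sigma> \<in> sets borel" if "\<sigma> \<in> reps_C" for \<sigma>
  proof -
    have "(+) (- \<sigma>) ` P \<sigma> = (+) \<sigma> -` P \<sigma>"
      using Gd.plus_image[of "- \<sigma>" "P \<sigma>"] by (simp only: minus_minus)
    then show ?thesis
      unfolding img_P[OF that] using measurable_sets[OF Gd.plus_measurable P, of \<sigma> \<sigma>] by simp
  qed
  have "\<Omega> j \<inter> \<eta> -` E = (\<Union>\<sigma>\<in>reps_C. P \<sigma>)"
    using \<Omega>_reps[OF j] by (auto simp: P_def)
  moreover have disj_P: "disjoint_family_on P reps_C"
    unfolding disjoint_family_on_def using sub reps_C_disjoint by blast
  ultimately have "emeasure \<nu> (\<Omega> j \<inter> \<eta> -` E) = (\<Sum>\<sigma>\<in>reps_C. emeasure \<nu> (P \<sigma>))"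
    using sum_emeasure[of P reps_C \<nu>] finite_reps_C P by (simp add: image_subset_iff)
  also have "\<dots> = (\<Sum>\<sigma>\<in>reps_C. emeasure \<nu> (\<eta> ` P \<sigma>))"
    by (intro sum.cong refl) (simp only: img_P Gd.emeasure_plus[OF P])
  also have "\<dots> = emeasure \<nu> (\<Union>\<sigma>\<in>reps_C. \<eta> ` P \<sigma>)"
  proof (rule sum_emeasure)
    show "disjoint_family_on (\<lambda>\<sigma>. \<eta> ` P \<sigma>) reps_C"
      unfolding disjoint_family_on_def
    proof (intro ballI impI)
      fix \<sigma> \<sigma>' assume "\<sigma> \<in> reps_C" "\<sigma>' \<in> reps_C" "\<sigma> \<noteq> \<sigma>'"
      then have "P \<sigma> \<inter> P \<sigma>' = {}"
        using disj_P by (auto simp: disjoint_family_on_def)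
      moreover have "P \<sigma> \<subseteq> \<Omega> j" "P \<sigma>' \<subseteq> \<Omega> j"
        by (auto simp: P_def)
      ultimately show "\<eta> ` P \<sigma> \<inter> \<eta> ` P \<sigma>' = {}"
        using inj_on_image_Int[OF inj, of "P \<sigma>" "P \<sigma>'"] by simp
    qed
  qed (use img_sets finite_reps_C in auto)
  also have "(\<Union>\<sigma>\<in>reps_C. \<eta> ` P \<sigma>) = \<eta> ` (\<Omega> j \<inter> \<eta> -` E)"
    using \<open>\<Omega> j \<inter> \<eta> -` E = (\<Union>\<sigma>\<in>reps_C. P \<sigma>)\<close> by (simp add: image_UN)
  also have "\<dots> = \<eta> ` \<Omega> j \<inter> E"
    by blast
  also have "\<dots> = K \<inter> E"
    by (simp only: img)
  finally show ?thesis .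
qed

lemma distr_eta:
  assumes j: "j \<in> {1..N}"
  shows "distr (density \<nu> (\<lambda>\<gamma>. ennreal (indicator (\<Omega> j) \<gamma>))) borel \<eta> = density \<nu> (\<lambda>\<gamma>. ennreal (indicator K \<gamma>))"
proof (rule measure_eqI)
  have [measurable]: "\<Omega> j \<in> sets borel"
    by (rule \<Omega>_sets[OF j])
  fix E assume "E \<in> sets (distr (density \<nu> (\<lambda>\<gamma>. ennreal (indicator (\<Omega> j) \<gamma>))) borel \<eta>)"
  then have E [measurable]: "E \<in> sets borel"
    by simp
  have eta_meas [measurable]: "\<eta> -` E \<in> sets borel"
    using measurable_sets[OF eta_measurable E] by simp
  have ind: "ennreal (indicator S \<gamma>) * indicator T \<gamma> = indicator (S \<inter> T) \<gamma>" for S T and \<gamma> :: "'a dual"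
    by (simp add: indicator_def)
  show "emeasure (distr (density \<nu> (\<lambda>\<gamma>. ennreal (indicator (\<Omega> j) \<gamma>))) borel \<eta>) E =
      emeasure (density \<nu> (\<lambda>\<gamma>. ennreal (indicator K \<gamma>))) E"
    using emeasure_eta[OF j E] by (simp add: emeasure_distr emeasure_density ind)
qed simp

lemma integral_eta:
  fixes h :: "'a dual \<Rightarrow> 'b::{banach,second_countable_topology}"
  assumes j: "j \<in> {1..N}" and h: "h \<in> borel_measurable borel"
  shows "(LINT \<gamma>|\<nu>. indicator (\<Omega> j) \<gamma> *\<^sub>R h (\<eta> \<gamma>)) = (LINT \<gamma>|\<nu>. indicator K \<gamma> *\<^sub>R h \<gamma>)"
    and "integrable \<nu> (\<lambda>\<gamma>. indicator (\<Omega> j) \<gamma> *\<^sub>R h (\<eta> \<gamma>)) \<longleftrightarrow> integrable \<nu> (\<lambda>\<gamma>. indicator K \<gamma> *\<^sub>R h \<gamma>)"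
proof -
  have [measurable]: "\<Omega> j \<in> sets borel" "h \<in> borel_measurable borel"
    by (rule \<Omega>_sets[OF j], rule h)
  have "(LINT \<gamma>|\<nu>. indicator (\<Omega> j) \<gamma> *\<^sub>R h (\<eta> \<gamma>)) =
      (LINT \<gamma>|density \<nu> (\<lambda>\<gamma>. ennreal (indicator (\<Omega> j) \<gamma>)). h (\<eta> \<gamma>))"
    by (subst integral_density) auto
  also have "\<dots> = (LINT \<gamma>|distr (density \<nu> (\<lambda>\<gamma>. ennreal (indicator (\<Omega> j) \<gamma>))) borel \<eta>. h \<gamma>)"
    by (subst integral_distr) auto
  also have "\<dots> = (LINT \<gamma>|\<nu>. indicator K \<gamma> *\<^sub>R h \<gamma>)"
    unfolding distr_eta[OF j] by (subst integral_density) auto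
  finally show "(LINT \<gamma>|\<nu>. indicator (\<Omega> j) \<gamma> *\<^sub>R h (\<eta> \<gamma>)) = (LINT \<gamma>|\<nu>. indicator K \<gamma> *\<^sub>R h \<gamma>)" .
  have "integrable \<nu> (\<lambda>\<gamma>. indicator (\<Omega> j) \<gamma> *\<^sub>R h (\<eta> \<gamma>)) \<longleftrightarrow>
      integrable (density \<nu> (\<lambda>\<gamma>. ennreal (indicator (\<Omega> j) \<gamma>))) (\<lambda>\<gamma>. h (\<eta> \<gamma>))"
    by (subst integrable_density) auto
  also have "\<dots> \<longleftrightarrow> integrable (distr (density \<nu> (\<lambda>\<gamma>. ennreal (indicator (\<Omega> j) \<gamma>))) borel \<eta>) h"
    by (subst integrable_distr_eq) auto
  also have "\<dots> \<longleftrightarrow> integrable \<nu> (\<lambda>\<gamma>. indicator K \<gamma> *\<^sub>R h \<gamma>)"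
    unfolding distr_eta[OF j] by (subst integrable_density) auto
  finally show "integrable \<nu> (\<lambda>\<gamma>. indicator (\<Omega> j) \<gamma> *\<^sub>R h (\<eta> \<gamma>)) \<longleftrightarrow> integrable \<nu> (\<lambda>\<gamma>. indicator K \<gamma> *\<^sub>R h \<gamma>)" .
qed

definition \<Phi> :: "nat \<Rightarrow> 'a \<Rightarrow> 'a dual \<Rightarrow> complex" where
  "\<Phi> j s \<gamma> = indicator (\<Omega> j) \<gamma> * cnj (pairing s (\<eta> \<gamma>))"

lemma pairing_eta_measurable [measurable]: "(\<lambda>\<gamma>. pairing s (\<eta> \<gamma>)) \<in> borel_measurable borel"
  using measurable_compose[OF eta_measurable pairing_measurable] .

lemma \<Omega>_L2: "j \<in> {1..N} \<Longrightarrow> indicator (\<Omega> j) \<in> L2 \<nu>"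
  using \<Omega>_sets order.strict_trans1[OF emeasure_mono[OF \<Omega>_bounded(2)] Gd.emeasure_compact[OF \<Omega>_bounded(1)]]
    compact_imp_closed[OF \<Omega>_bounded(1)]
  by (intro L2_indicator) auto

lemma \<Phi>_L2: "j \<in> {1..N} \<Longrightarrow> \<Phi> j s \<in> L2 \<nu>"
  unfolding \<Phi>_def by (intro L2_mult_bounded \<Omega>_L2) (auto simp: norm_dual_apply)

text \<open>\<open>\<eta>\<close> carries the integral from \<open>\<Omega> j\<close> to
  \<open>K\<close>, where the character given by \<open>t - s\<close> has integral 0 unless
  \<open>t - s\<close> lies in \<open>H\<close>.\<close>

lemma \<Phi>_orthonormal:
  assumes j: "j \<in> {1..N}"
  shows "l2_inner \<nu> (\<Phi> j s) (\<Phi> j t) = (if t - s \<in> H then 1 else 0)"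
proof -
  have "\<Phi> j s \<gamma> * cnj (\<Phi> j t \<gamma>) = indicator (\<Omega> j) \<gamma> *\<^sub>R pairing (t - s) (\<eta> \<gamma>)" for \<gamma>
    by (auto simp: \<Phi>_def dual_apply_diff indicator_def)
  then have "l2_inner \<nu> (\<Phi> j s) (\<Phi> j t) = (LINT \<gamma>|\<nu>. indicator (\<Omega> j) \<gamma> *\<^sub>R pairing (t - s) (\<eta> \<gamma>))"
    unfolding l2_inner_def by simp
  also have "\<dots> = (LINT \<gamma>|\<nu>. indicator K \<gamma> *\<^sub>R pairing (t - s) \<gamma>)"
    by (rule integral_eta(1)[OF j]) measurable
  also have "\<dots> = (LINT \<gamma>|\<nu>. indicator (coset K 0) \<gamma> * pairing (t - s) \<gamma>)"
    by (intro Bochner_Integration.integral_cong) (auto simp: coset_zero indicator_def)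
  finally show ?thesis
    by (simp add: integral_coset_Gd dual_apply_zero)
qed

lemma \<Phi>_dense:
  assumes j: "j \<in> {1..N}" and F: "F \<in> L2 \<nu>" and supp: "\<And>\<gamma>. \<gamma> \<notin> \<Omega> j \<Longrightarrow> F \<gamma> = 0"
  shows "F \<in> l2_closed_span \<nu> (range (\<Phi> j))"
proof (rule l2_closed_spanI[OF F])
  show "range (\<Phi> j) \<subseteq> L2 \<nu>"
    using \<Phi>_L2[OF j] by auto
  fix \<epsilon> :: real assume \<epsilon>: "\<epsilon> > 0"
  have [measurable]: "\<Omega> j \<in> sets borel" "F \<in> borel_measurable borel"
    using \<Omega>_sets[OF j] L2_measurable[OF F] by simp_all
  \<comment> \<open>\<open>F\<close> carried to \<open>K\<close> along the inverse of
    \<open>\<eta>\<close>: for \<open>\<kappa>\<close> in \<open>K\<close> at most one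
    \<open>\<sigma>\<close> in \<open>reps_C\<close> has \<open>\<sigma> + \<kappa>\<close> in
    \<open>\<Omega> j\<close>, by injectivity of \<open>\<eta>\<close>, and all other terms
    vanish.\<close>
  define G where "G \<kappa> = (\<Sum>\<sigma>\<in>reps_C. F (\<sigma> + \<kappa>))" for \<kappa>
  have [measurable]: "(\<lambda>\<kappa>. F (\<sigma> + \<kappa>)) \<in> borel_measurable borel" for \<sigma>
    using measurable_compose[OF Gd.plus_measurable, of F borel \<sigma>] by simp
  have G [measurable]: "G \<in> borel_measurable borel"
    unfolding G_def by measurable
  have G_eta: "G (\<eta> \<gamma>) = F \<gamma>" if \<gamma>: "\<gamma> \<in> \<Omega> j" for \<gamma>
  proof -
    obtain \<sigma> where \<sigma>: "\<sigma> \<in> reps_C" "\<gamma> \<in> coset K \<sigma>"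
      using \<Omega>_reps[OF j \<gamma>] by blast
    have "F (\<sigma>' + \<eta> \<gamma>) = 0" if \<sigma>': "\<sigma>' \<in> reps_C" "\<sigma>' \<noteq> \<sigma>" for \<sigma>'
    proof (rule supp, rule notI)
      assume mem: "\<sigma>' + \<eta> \<gamma> \<in> \<Omega> j"
      have c: "\<sigma>' + \<eta> \<gamma> \<in> coset K \<sigma>'"
        using eta_in_K by (simp add: coset_iff)
      then have "\<eta> (\<sigma>' + \<eta> \<gamma>) = \<eta> \<gamma>"
        using \<sigma>'(1) reps_C_D by (subst eta_eqI[of \<sigma>']) auto
      then have "\<sigma>' + \<eta> \<gamma> = \<gamma>"
        using \<Omega>_eta[OF j] mem \<gamma> by (auto simp: bij_betw_def dest: inj_onD)
      then have "\<gamma> \<in> coset K \<sigma>'"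
        using c by simp
      then show False
        using reps_C_disjoint[OF \<sigma>'(1) \<sigma>(1) \<sigma>'(2)] \<sigma>(2) by blast
    qed
    then have "G (\<eta> \<gamma>) = (\<Sum>\<sigma>'\<in>{\<sigma>}. F (\<sigma>' + \<eta> \<gamma>))"
      unfolding G_def using \<sigma>(1) finite_reps_C by (intro sum.mono_neutral_right) auto
    then show ?thesis
      using \<sigma> reps_C_D by (auto simp: eta_eqI[of \<sigma>])
  qed
  have GL: "(\<lambda>\<kappa>. indicator K \<kappa> * G \<kappa>) \<in> L2 \<nu>"
  proof (rule L2I)
    have "integrable \<nu> (\<lambda>\<gamma>. indicator (\<Omega> j) \<gamma> *\<^sub>R (cmod (G (\<eta> \<gamma>)))\<^sup>2)"
    proof -
      have "indicator (\<Omega> j) \<gamma> *\<^sub>R (cmod (G (\<eta> \<gamma>)))\<^sup>2 = (cmod (F \<gamma>))\<^sup>2" for \<gamma>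
        using G_eta[of \<gamma>] supp[of \<gamma>] by (auto simp: indicator_def)
      then show ?thesis
        using L2_integrable[OF F] by simp
    qed
    then have "integrable \<nu> (\<lambda>\<kappa>. indicator K \<kappa> *\<^sub>R (cmod (G \<kappa>))\<^sup>2)"
      using integral_eta(2)[OF j, of "\<lambda>\<kappa>. (cmod (G \<kappa>))\<^sup>2"] by simp
    moreover have "indicator K \<kappa> *\<^sub>R (cmod (G \<kappa>))\<^sup>2 = (cmod (indicator K \<kappa> * G \<kappa>))\<^sup>2" for \<kappa>
      by (simp add: indicator_def)
    ultimately show "integrable \<nu> (\<lambda>\<kappa>. (cmod (indicator K \<kappa> * G \<kappa>))\<^sup>2)"
      by simp
  qed measurable
  obtain S c where S: "finite S" "S \<subseteq> coset_waves K (range (\<lambda>x \<gamma>. pairing x \<gamma>))"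
    "l2_norm \<nu> (\<lambda>\<kappa>. indicator K \<kappa> * G \<kappa> - (\<Sum>b\<in>S. c b * b \<kappa>)) < \<epsilon>"
    using Gd.coset_waves_dense[OF GL] \<epsilon> unfolding l2_closed_span_def by blast
  define p where "p \<kappa> = (\<Sum>b\<in>S. c b * b \<kappa>)" for \<kappa>
  have pL: "p \<in> L2 \<nu>"
    unfolding p_def using S(2) Gd.coset_waves_L2 by (intro L2_combination) auto
  then have [measurable]: "p \<in> borel_measurable borel"
    using L2_measurable by fastforce
  define q where "q \<gamma> = (\<Sum>b\<in>S. c b * (indicator (\<Omega> j) \<gamma> * b (\<eta> \<gamma>)))" for \<gamma>
  have q_eq: "q \<gamma> = indicator (\<Omega> j) \<gamma> * p (\<eta> \<gamma>)" for \<gamma>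
    unfolding q_def p_def sum_distrib_left by (intro sum.cong) auto
  have q: "q \<in> l2_closed_span \<nu> (range (\<Phi> j))"
    unfolding q_def
  proof (intro l2_closed_span_sum l2_closed_span_cmult)
    fix b assume "b \<in> S"
    then obtain a s where b: "b = (\<lambda>\<kappa>. indicator (coset K a) \<kappa> * pairing s \<kappa>)"
      using S(2) by (auto simp: coset_waves_def)
    show "(\<lambda>\<gamma>. indicator (\<Omega> j) \<gamma> * b (\<eta> \<gamma>)) \<in> l2_closed_span \<nu> (range (\<Phi> j))"
    \<comment> \<open>On \<open>K\<close> a coset wave is either a character, which yields some
      \<open>\<Phi> j\<close>, or zero, because cosets coincide or are disjoint.\<close>
    proof (cases "coset K a = K")
      case True
      then have "(\<lambda>\<gamma>. indicator (\<Omega> j) \<gamma> * b (\<eta> \<gamma>)) = \<Phi> j (- s)"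
        by (auto simp: b \<Phi>_def fun_eq_iff eta_in_K dual_apply_minus)
      then show ?thesis
        using \<Phi>_L2[OF j] by (auto intro: l2_closed_span_base)
    next
      case False
      then have "coset K a \<inter> K = {}"
        using coset_disjoint[OF subgroup_K, of a 0] by (simp add: coset_zero)
      then have "(\<lambda>\<gamma>. indicator (\<Omega> j) \<gamma> * b (\<eta> \<gamma>)) = (\<lambda>\<gamma>. 0 * \<Phi> j 0 \<gamma>)"
        using eta_in_K by (auto simp: b fun_eq_iff indicator_def)
      then show ?thesis
        by (simp only:) (intro l2_closed_span_cmult l2_closed_span_base rangeI \<Phi>_L2[OF j])
    qed
  qed (use \<Phi>_L2[OF j] in auto)
  have "(l2_norm \<nu> (\<lambda>\<gamma>. F \<gamma> - q \<gamma>))\<^sup>2 = (LINT \<gamma>|\<nu>. indicator (\<Omega> j) \<gamma> *\<^sub>R (cmod (G (\<eta> \<gamma>) - p (\<eta> \<gamma>)))\<^sup>2)"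
    unfolding l2_norm_power2
    by (intro Bochner_Integration.integral_cong) (auto simp: q_eq G_eta supp indicator_def)
  also have "\<dots> = (LINT \<kappa>|\<nu>. indicator K \<kappa> *\<^sub>R (cmod (G \<kappa> - p \<kappa>))\<^sup>2)"
    by (rule integral_eta(1)[OF j, of "\<lambda>\<kappa>. (cmod (G \<kappa> - p \<kappa>))\<^sup>2"]) measurable
  also have "\<dots> \<le> (LINT \<kappa>|\<nu>. (cmod (indicator K \<kappa> * G \<kappa> - p \<kappa>))\<^sup>2)"
  proof (rule integral_mono')
    show "integrable \<nu> (\<lambda>\<kappa>. (cmod (indicator K \<kappa> * G \<kappa> - p \<kappa>))\<^sup>2)"
      by (rule L2_integrable[OF L2_diff[OF GL pL]])
  qed (auto simp: indicator_def)
  also have "\<dots> = (l2_norm \<nu> (\<lambda>\<kappa>. indicator K \<kappa> * G \<kappa> - p \<kappa>))\<^sup>2"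
    by (rule l2_norm_power2[symmetric])
  also have "\<dots> < \<epsilon>\<^sup>2"
    using S(3) by (intro power_strict_mono) (auto simp: p_def)
  finally have "l2_norm \<nu> (\<lambda>\<gamma>. F \<gamma> - q \<gamma>) < \<epsilon>"
    using \<epsilon> by (simp add: power2_less_imp_less)
  then show "\<exists>g\<in>l2_closed_span \<nu> (range (\<Phi> j)). l2_norm \<nu> (\<lambda>\<gamma>. F \<gamma> - g \<gamma>) < \<epsilon>"
    using q by blast
qed

end

section \<open>From the tiling to an orthonormal basis\<close>

context wavelet_sets
begin

definition dual_wavelet :: "nat \<Rightarrow> int \<Rightarrow> 'a \<Rightarrow> 'a dual \<Rightarrow> complex" where
  "dual_wavelet j n s \<gamma> =
     of_real (1 / sqrt (modulus \<mu> (int_pow A1 n))) * \<Phi> j s (int_pow B (- n) \<gamma>)"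

lemma generator_plancherel:
  assumes j: "j \<in> {1..N}"
  shows "plancherel \<mu> \<nu> (inverse_fourier \<mu> \<nu> (indicator (\<Omega> j))) (indicator (\<Omega> j))"
proof (rule inverse_fourier_plancherel[OF \<Omega>_L2[OF j] \<Omega>_bounded(1) _ L2_measurable[OF \<Omega>_L2[OF j]]])
  show "indicator (\<Omega> j) \<gamma> = (0 :: complex)" if "\<gamma> \<notin> C" for \<gamma>
    using that \<Omega>_bounded(2)[OF j] by (auto simp: indicator_def)
qed simp

lemma translate_plancherel:
  assumes j: "j \<in> {1..N}"
  shows "plancherel \<mu> \<nu> (translate H D \<mu> \<nu> (coset H s) (inverse_fourier \<mu> \<nu> (indicator (\<Omega> j)))) (\<Phi> j s)"
proof -
  let ?f = "fourier \<mu> \<nu> (inverse_fourier \<mu> \<nu> (indicator (\<Omega> j)))"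
  define F' where "F' \<gamma> = ?f \<gamma> * translation_weight H D (coset H s) \<gamma>" for \<gamma>
  have F'_eq: "F' \<gamma> = ?f \<gamma> * cnj (pairing s (\<eta> \<gamma>))" for \<gamma>
    by (simp add: F'_def translation_weight_coset[OF subgroup_H reps])
  have f: "?f \<in> L2 \<nu>" "AE \<gamma> in \<nu>. ?f \<gamma> = indicator (\<Omega> j) \<gamma>"
    by (rule fourier_plancherel[OF generator_plancherel[OF j]])+
  have [measurable]: "?f \<in> borel_measurable borel"
    using L2_measurable[OF f(1)] by simp
  have F'm: "F' \<in> borel_measurable \<nu>"
    unfolding F'_eq[abs_def] by measurable
  have AE: "AE \<gamma> in \<nu>. \<Phi> j s \<gamma> = F' \<gamma>"
    using f(2) by eventually_elim (simp add: F'_eq \<Phi>_def)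
  have "plancherel \<mu> \<nu> (inverse_fourier \<mu> \<nu> F') F'"
  proof (rule inverse_fourier_plancherel[OF \<Phi>_L2[OF j] \<Omega>_bounded(1) _ F'm AE])
    show "\<Phi> j s \<gamma> = 0" if "\<gamma> \<notin> C" for \<gamma>
      using that \<Omega>_bounded(2)[OF j] by (auto simp: \<Phi>_def indicator_def)
  qed
  then have "plancherel \<mu> \<nu> (inverse_fourier \<mu> \<nu> F') (\<Phi> j s)"
    using AE by (intro plancherel_cong_AE[OF _ L2_measurable[OF \<Phi>_L2[OF j]]]) auto
  then show ?thesis
    by (simp add: translate_def F'_def[abs_def])
qed

lemma wavelet_plancherel:
  assumes j: "j \<in> {1..N}"
  shows "plancherel \<mu> \<nu>
    (dilate \<mu> (int_pow A1 n) (translate H D \<mu> \<nu> (coset H s) (inverse_fourier \<mu> \<nu> (indicator (\<Omega> j)))))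
    (dual_wavelet j n s)"
proof -
  have "adjoint_aut (inv (int_pow A1 n)) = int_pow B (- n)"
    by (simp add: inv_int_pow[OF bij_A1] adjoint_int_pow[OF A1_Aut])
  then show ?thesis
    using plancherel_dilate[OF int_pow_Aut[OF A1_Aut] translate_plancherel[OF j], of n s]
    by (simp add: dual_wavelet_def[abs_def])
qed

lemma dual_wavelet_L2: "j \<in> {1..N} \<Longrightarrow> dual_wavelet j n s \<in> L2 \<nu>"
  by (rule plancherelD(2)[OF wavelet_plancherel])

lemma dual_wavelet_disjoint:
  assumes "j \<in> {1..N}" "k \<in> {1..N}" "(j, m) \<noteq> (k, n)"
  shows "dual_wavelet j m s \<gamma> = 0 \<or> dual_wavelet k n t \<gamma> = 0"
proof -
  have "\<gamma> \<notin> int_pow B m ` \<Omega> j \<or> \<gamma> \<notin> int_pow B n ` \<Omega> k"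
    using \<Omega>_disjoint[OF assms] by blast
  then show ?thesis
    by (auto simp: dual_wavelet_def \<Phi>_def int_pow_image_iff[OF bij_B])
qed

definition dual_wavelets :: "('a dual \<Rightarrow> complex) set" where
  "dual_wavelets = {dual_wavelet j n s | j n s. j \<in> {1..N}}"

lemma dual_wavelets_L2: "dual_wavelets \<subseteq> L2 \<nu>"
  by (auto simp: dual_wavelets_def dual_wavelet_L2)

lemma dual_wavelets_dense_piece:
  assumes j: "j \<in> {1..N}" and F: "F \<in> L2 \<nu>" and supp: "\<And>\<gamma>. \<gamma> \<notin> int_pow B n ` \<Omega> j \<Longrightarrow> F \<gamma> = 0"
  shows "F \<in> l2_closed_span \<nu> dual_wavelets"
proof -
  note A = int_pow_Aut[OF B_Aut]
  have "(\<lambda>\<gamma>. F (int_pow B n \<gamma>)) \<in> L2 \<nu>"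
    using Gd.L2_automorphism[OF Aut_additive[OF A] AutD(2)[OF A] Gd.modulus_pos[OF A] Gd.emeasure_modulus[OF A] F] .
  moreover have "F (int_pow B n \<gamma>) = 0" if "\<gamma> \<notin> \<Omega> j" for \<gamma>
    using that by (intro supp) (simp add: int_pow_image_iff[OF bij_B] int_pow_inverse[OF bij_B])
  ultimately have "(\<lambda>\<gamma>. F (int_pow B n \<gamma>)) \<in> l2_closed_span \<nu> (range (\<Phi> j))"
    by (rule \<Phi>_dense[OF j])
  then have "(\<lambda>\<gamma>. F (int_pow B n (int_pow B (- n) \<gamma>))) \<in> l2_closed_span \<nu> dual_wavelets"
  proof (rule Gd.l2_closed_span_automorphism[OF A[of "- n"]])
    fix b assume "b \<in> range (\<Phi> j)"
    then obtain s where b: "b = \<Phi> j s"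
      by blast
    define m where "m = sqrt (modulus \<mu> (int_pow A1 n))"
    have "m > 0"
      using G.modulus_pos[OF int_pow_Aut[OF A1_Aut]] by (simp add: m_def)
    then have "(\<lambda>\<gamma>. b (int_pow B (- n) \<gamma>)) = (\<lambda>\<gamma>. of_real m * dual_wavelet j n s \<gamma>)"
      by (simp add: b dual_wavelet_def m_def[symmetric])
    moreover have "dual_wavelet j n s \<in> dual_wavelets"
      using j by (auto simp: dual_wavelets_def)
    ultimately show "(\<lambda>\<gamma>. b (int_pow B (- n) \<gamma>)) \<in> l2_closed_span \<nu> dual_wavelets"
      using dual_wavelet_L2[OF j] by (simp only:) (intro l2_closed_span_cmult l2_closed_span_base)
  qed (use \<Phi>_L2[OF j] dual_wavelets_L2 in auto)
  then show ?thesis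
    by (simp add: int_pow_inverse[OF bij_B])
qed

lemma dual_wavelets_dense:
  assumes F: "F \<in> L2 \<nu>"
  shows "F \<in> l2_closed_span \<nu> dual_wavelets"
proof -
  define I where "I m = {1..N} \<times> {- int m..int m}" for m
  define Y where "Y p = int_pow B (snd p) ` \<Omega> (fst p)" for p
  define s where "s m \<gamma> = (\<Sum>p\<in>I m. indicator (Y p) \<gamma> * F \<gamma>)" for m \<gamma>
  have [measurable]: "F \<in> borel_measurable borel"
    using L2_measurable[OF F] by simp
  have Ys: "Y p \<in> sets borel" if "p \<in> I m" for p m
    unfolding Y_def using that by (intro B_pow_image_sets \<Omega>_sets) (auto simp: I_def)
  have s_eq: "s m \<gamma> = (if \<exists>p\<in>I m. \<gamma> \<in> Y p then F \<gamma> else 0)" for m \<gamma>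
  proof -
    have "disjoint_family_on Y (I m)"
      unfolding disjoint_family_on_def Y_def using \<Omega>_disjoint by (auto simp: I_def)
    then show ?thesis
      unfolding s_def by (subst sum_indicator_disjoint) (auto simp: I_def)
  qed
  show ?thesis
  proof (rule l2_closed_span_limit[OF F _ dual_wavelets_L2])
    show "s m \<in> l2_closed_span \<nu> dual_wavelets" for m
      unfolding s_def
    proof (rule l2_closed_span_sum[OF _ dual_wavelets_L2])
      fix p assume p: "p \<in> I m"
      have [measurable]: "Y p \<in> sets borel"
        by (rule Ys[OF p])
      have "(\<lambda>\<gamma>. indicator (Y p) \<gamma> * F \<gamma>) \<in> L2 \<nu>"
        by (rule L2_dominated[OF F, of _ 1]) (auto simp: indicator_def)
      then show "(\<lambda>\<gamma>. indicator (Y p) \<gamma> * F \<gamma>) \<in> l2_closed_span \<nu> dual_wavelets"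
        using p by (intro dual_wavelets_dense_piece[of "fst p" _ "snd p"]) (auto simp: I_def Y_def)
    qed
    show "AE \<gamma> in \<nu>. (\<lambda>m. s m \<gamma>) \<longlonglongrightarrow> F \<gamma>"
      using \<Omega>_cover
    proof eventually_elim
      case (elim \<gamma>)
      then obtain n j where "j \<in> {1..N}" "\<gamma> \<in> int_pow B n ` \<Omega> j"
        by blast
      then have nj: "j \<in> {1..N}" "\<gamma> \<in> Y (j, n)"
        by (simp_all add: Y_def)
      have "s m \<gamma> = F \<gamma>" if "m \<ge> nat \<bar>n\<bar>" for m
      proof -
        have "(j, n) \<in> I m"
          using nj(1) that by (auto simp: I_def)
        then show ?thesis
          using nj(2) unfolding s_eq by auto
      qed
      then show ?case
        by (intro tendsto_eventually eventually_mono[OF eventually_ge_at_top[of "nat \<bar>n\<bar>"]])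
    qed
    show "cmod (s m \<gamma>) \<le> 2 * cmod (F \<gamma>)" for m \<gamma>
      by (simp add: s_eq)
  qed
qed

theorem wavelet_collection: "wavelet_collection H D (range (int_pow A1)) \<mu> \<nu> N \<Omega>"
proof -
  define \<psi> where "\<psi> j = inverse_fourier \<mu> \<nu> (indicator (\<Omega> j))" for j
  let ?I = "{1..N} \<times> range (int_pow A1) \<times> range (coset H)"
  define e where "e = (\<lambda>(j, A, C). dilate \<mu> A (translate H D \<mu> \<nu> C (\<psi> j)))"
  have e: "plancherel \<mu> \<nu> (e (j, int_pow A1 n, coset H s)) (dual_wavelet j n s)" if "j \<in> {1..N}" for j n s
    unfolding e_def \<psi>_def using wavelet_plancherel[OF that] by simp
  have "l2_orthonormal_basis \<mu> ?I e"
    unfolding l2_orthonormal_basis_def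
  proof (intro conjI ballI allI impI)
    fix i assume "i \<in> ?I"
    then show "e i \<in> L2 \<mu>"
      using plancherelD(1)[OF e] by auto
  next
    fix i i' assume "i \<in> ?I" "i' \<in> ?I"
    then obtain j n s k m t where
      i: "i = (j, int_pow A1 n, coset H s)" "j \<in> {1..N}" and
      i': "i' = (k, int_pow A1 m, coset H t)" "k \<in> {1..N}"
      by blast
    show "l2_inner \<mu> (e i) (e i') = (if i = i' then 1 else 0)"
    \<comment> \<open>Basis elements are indexed by automorphisms, so powers are compared as maps.
      Distinct maps have distinct exponents, which is the direction used below.\<close>
    proof (cases "int_pow A1 n = int_pow A1 m")
      case True
      have tr: "plancherel \<mu> \<nu> (translate H D \<mu> \<nu> (coset H s) (\<psi> j)) (\<Phi> j s)"
        "plancherel \<mu> \<nu> (translate H D \<mu> \<nu> (coset H t) (\<psi> k)) (\<Phi> k t)"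
        unfolding \<psi>_def by (rule translate_plancherel[OF i(2)], rule translate_plancherel[OF i'(2)])
      have "l2_inner \<mu> (e i) (e i') = l2_inner \<mu> (translate H D \<mu> \<nu> (coset H s) (\<psi> j)) (translate H D \<mu> \<nu> (coset H t) (\<psi> k))"
        unfolding i i' e_def using True tr by (simp add: l2_inner_dilate[OF int_pow_Aut[OF A1_Aut]] plancherelD)
      also have "\<dots> = l2_inner \<nu> (\<Phi> j s) (\<Phi> k t)"
        by (rule plancherel_inner[OF tr])
      also have "\<dots> = (if i = i' then 1 else 0)"
      proof (cases "j = k")
        case True
        have "t - s \<in> H \<longleftrightarrow> coset H s = coset H t"
          using coset_eq_iff[OF subgroup_H, of t s] by auto
        then show ?thesis
          using True \<open>int_pow A1 n = int_pow A1 m\<close> i i' by (simp add: \<Phi>_orthonormal)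
      next
        case False
        then have "\<Omega> j \<inter> \<Omega> k = {}"
          using \<Omega>_disjoint[OF i(2) i'(2), of 0 0] by simp
        then have "l2_inner \<nu> (\<Phi> j s) (\<Phi> k t) = 0"
          by (intro disjoint_supports_inner) (auto simp: \<Phi>_def indicator_def)
        then show ?thesis
          using False i i' by simp
      qed
      finally show ?thesis .
    next
      case False
      then have "n \<noteq> m"
        by auto
      then have "l2_inner \<nu> (dual_wavelet j n s) (dual_wavelet k m t) = 0"
        using i(2) i'(2) by (intro disjoint_supports_inner dual_wavelet_disjoint) auto
      then show ?thesis
        using False plancherel_inner[OF e[OF i(2), of n s] e[OF i'(2), of m t]] i i' by simp
    qed
  next
    fix f :: "'a \<Rightarrow> complex" and \<epsilon> :: real assume f: "f \<in> L2 \<mu>" and \<epsilon>: "\<epsilon> > 0"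
    then have \<epsilon>2: "\<epsilon> / 2 > 0"
      by simp
    \<comment> \<open>Replacing \<open>f\<close> by a combination of waves gives a function with the
      explicit transform \<open>P\<close>, to which density on the dual side applies.\<close>
    obtain S c where S: "finite S" "l2_norm \<mu> (\<lambda>x. f x - (\<Sum>i\<in>S. c i * wave i x)) < \<epsilon> / 2"
      by (rule l2_closed_span_approx[OF wave_dense[OF f] \<epsilon>2])
    define p where "p x = (\<Sum>i\<in>S. c i * wave i x)" for x
    define P where "P \<gamma> = (\<Sum>i\<in>S. c i * dual_wave i \<gamma>)" for \<gamma>
    have pP: "plancherel \<mu> \<nu> p P"
      unfolding p_def P_def by (rule plancherel_combination) (rule plancherel_wave)
    define J where "J = {1..N} \<times> (UNIV :: int set) \<times> (UNIV :: 'a set)"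
    have "dual_wavelets = (\<lambda>(j, n, s). dual_wavelet j n s) ` J"
    proof (intro equalityI subsetI)
      fix f assume "f \<in> dual_wavelets"
      then obtain j n s where "f = dual_wavelet j n s" "j \<in> {1..N}"
        by (auto simp: dual_wavelets_def)
      then show "f \<in> (\<lambda>(j, n, s). dual_wavelet j n s) ` J"
        by (intro image_eqI[of _ _ "(j, n, s)"]) (auto simp: J_def)
    next
      fix f assume "f \<in> (\<lambda>(j, n, s). dual_wavelet j n s) ` J"
      then obtain j n s where "f = dual_wavelet j n s" "j \<in> {1..N}"
        by (auto simp: J_def)
      then show "f \<in> dual_wavelets"
        unfolding dual_wavelets_def by blast
    qed
    then have "P \<in> l2_closed_span \<nu> ((\<lambda>(j, n, s). dual_wavelet j n s) ` J)"
      using dual_wavelets_dense[OF plancherelD(2)[OF pP]] by simp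
    then obtain T d where T: "finite T" "T \<subseteq> J"
      "l2_norm \<nu> (\<lambda>x. P x - (\<Sum>i\<in>T. d i * (case i of (j, n, s) \<Rightarrow> dual_wavelet j n s) x)) < \<epsilon> / 2"
      by (rule l2_closed_span_approx[OF _ \<epsilon>2])
    \<comment> \<open>Different \<open>s\<close> may represent the same coset, so \<open>h\<close>
      need not be injective; coefficients are summed over its fibres further down.\<close>
    define h where "h = (\<lambda>(j, n, s). (j :: nat, int_pow A1 n, coset H s))"
    define q where "q x = (\<Sum>i\<in>T. d i * e (h i) x)" for x
    have "plancherel \<mu> \<nu> q (\<lambda>x. \<Sum>i\<in>T. d i * (case i of (j, n, s) \<Rightarrow> dual_wavelet j n s) x)"
      unfolding q_def
    proof (rule plancherel_combination)
      fix i assume "i \<in> T"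
      then show "plancherel \<mu> \<nu> (e (h i)) (case i of (j, n, s) \<Rightarrow> dual_wavelet j n s)"
        using T(2) e by (auto simp: J_def h_def)
    qed
    then have pq: "plancherel \<mu> \<nu> (\<lambda>x. p x - q x)
        (\<lambda>x. P x - (\<Sum>i\<in>T. d i * (case i of (j, n, s) \<Rightarrow> dual_wavelet j n s) x))"
      and qL: "q \<in> L2 \<mu>"
      using plancherel_diff[OF pP] plancherelD(1) by blast+
    have "l2_norm \<mu> (\<lambda>x. f x - q x) \<le> l2_norm \<mu> (\<lambda>x. f x - p x) + l2_norm \<mu> (\<lambda>x. p x - q x)"
      by (rule l2_norm_diff_triangle[OF f plancherelD(1)[OF pP] qL])
    also have "\<dots> < \<epsilon>"
      using S(2) T(3) plancherel_norm[OF pq] by (simp add: p_def)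
    finally have "l2_norm \<mu> (\<lambda>x. f x - q x) < \<epsilon>" .
    moreover have "q x = (\<Sum>i\<in>h ` T. (\<Sum>k\<in>{k \<in> T. h k = i}. d k) * e i x)" for x
    proof -
      have "q x = (\<Sum>i\<in>h ` T. \<Sum>k\<in>{k \<in> T. h k = i}. d k * e (h k) x)"
        unfolding q_def by (rule sum.image_gen[OF T(1)])
      also have "\<dots> = (\<Sum>i\<in>h ` T. (\<Sum>k\<in>{k \<in> T. h k = i}. d k) * e i x)"
        unfolding sum_distrib_right by (intro sum.cong) auto
      finally show ?thesis .
    qed
    ultimately have "l2_norm \<mu> (\<lambda>x. f x - (\<Sum>i\<in>h ` T. (\<Sum>k\<in>{k \<in> T. h k = i}. d k) * e i x)) < \<epsilon>"
      by simp
    moreover have "h ` T \<subseteq> ?I"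
      using T(2) by (auto simp: h_def J_def)
    ultimately show "\<exists>S c. finite S \<and> S \<subseteq> ?I \<and> l2_norm \<mu> (\<lambda>x. f x - (\<Sum>i\<in>S. c i * e i x)) < \<epsilon>"
      using T(1) by (intro exI[of _ "h ` T"] exI[of _ "\<lambda>i. \<Sum>k\<in>{k \<in> T. h k = i}. d k"]) auto
  qed
  moreover have "\<psi> j \<in> L2 \<mu>" if "j \<in> {1..N}" for j
    unfolding \<psi>_def by (rule plancherelD(1)[OF generator_plancherel[OF that]])
  ultimately show ?thesis
    using \<Omega>_sets \<Omega>_L2
    by (simp add: wavelet_collection_def wavelet_generators_def e_def \<psi>_def)
qed

end

section \<open>The iterative construction\<close>

lemma mem_contractions:
  assumes "bij B"
  shows "\<gamma> \<in> contractions B S \<longleftrightarrow> (\<exists>n\<ge>1. int_pow B (int n) \<gamma> \<in> S)"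
  unfolding contractions_def by (auto simp: int_pow_image_iff[OF assms])

text \<open>Every point of the new set is \<open>x\<close> or \<open>T x\<close> for some
  \<open>x\<close> in \<open>S\<close> with the same \<open>\<eta>\<close>-value, and this value
  determines \<open>x\<close>.\<close>

lemma bij_betw_exchange:
  assumes bij: "bij_betw \<eta> S K" and sub: "L \<subseteq> S" and eta: "\<And>x. x \<in> L \<Longrightarrow> \<eta> (T x) = \<eta> x"
  shows "bij_betw \<eta> ((S - L) \<union> T ` L) K"
proof -
  have inj: "inj_on \<eta> S" and img: "\<eta> ` S = K"
    using bij by (auto simp: bij_betw_def)
  have "inj_on \<eta> ((S - L) \<union> T ` L)"
  proof (rule inj_onI)
    fix x y assume x: "x \<in> (S - L) \<union> T ` L" and y: "y \<in> (S - L) \<union> T ` L" and eq: "\<eta> x = \<eta> y"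
    obtain x' where x': "x' \<in> S" "\<eta> x' = \<eta> x" "x = (if x' \<in> L then T x' else x')"
      using x sub eta by auto
    obtain y' where y': "y' \<in> S" "\<eta> y' = \<eta> y" "y = (if y' \<in> L then T y' else y')"
      using y sub eta by auto
    have "x' = y'"
      using inj_onD[OF inj, of x' y'] x' y' eq by simp
    then show "x = y"
      using x'(3) y'(3) by simp
  qed
  moreover have "\<eta> ` ((S - L) \<union> T ` L) = \<eta> ` ((S - L) \<union> L)"
    unfolding image_Un image_image using eta by (simp cong: image_cong)
  moreover have "(S - L) \<union> L = S"
    using sub by blast
  ultimately show ?thesis
    using img by (simp add: bij_betw_def)
qed

text \<open>Each piece \<open>P' n\<close> lies in \<open>K\<close> and its translate
  \<open>P n\<close> in one coset, so a nonempty piece forces \<open>\<sigma>' n\<close> to be the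
  representative of \<open>K\<close> itself. Hence \<open>\<eta>\<close> sends the point coming from
  \<open>x\<close> to \<open>x\<close> minus one fixed element of \<open>K\<close>.\<close>

lemma (in wavelet_setting) congruent_sets_eta:
  assumes "congruent_sets K D V K"
  shows "bij_betw \<eta> V K"
proof -
  obtain I :: "int set" and P P' \<sigma> \<sigma>' where
    disj: "disjoint_family_on P' I" and V: "(\<Union>n\<in>I. P n) = V" and K: "(\<Union>n\<in>I. P' n) = K" and
    P: "\<forall>n\<in>I. P n \<in> sets borel \<and> P' n \<in> sets borel \<and> \<sigma> n \<in> D \<and> \<sigma>' n \<in> D \<and>
           P n \<subseteq> coset K (\<sigma> n) \<and> P n = (\<lambda>\<gamma>. \<gamma> - \<sigma>' n + \<sigma> n) ` P' n"
    using assms unfolding congruent_sets_def by (elim exE conjE) (rule that)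
  define \<sigma>\<^sub>0 where "\<sigma>\<^sub>0 = \<theta> 0"
  have \<sigma>0: "\<sigma>\<^sub>0 \<in> K"
    using theta_coset[of 0] add_subgroup_uminus[OF subgroup_K, of "- \<theta> 0"] by (simp add: \<sigma>\<^sub>0_def coset_iff)
  have eta: "\<eta> (x - \<sigma>' n + \<sigma> n) = x - \<sigma>\<^sub>0" and mem: "x - \<sigma>' n + \<sigma> n \<in> P n" and \<sigma>': "\<sigma>' n = \<sigma>\<^sub>0"
    if n: "n \<in> I" and x: "x \<in> P' n" for n x
  proof -
    show mem: "x - \<sigma>' n + \<sigma> n \<in> P n"
      using P n x by blast
    then have c: "x - \<sigma>' n + \<sigma> n \<in> coset K (\<sigma> n)"
      using P n by blast
    then have "x - \<sigma>' n \<in> K"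
      by (simp add: coset_iff)
    moreover have "x \<in> K"
      using K n x by blast
    ultimately have "x - (x - \<sigma>' n) \<in> K"
      using add_subgroup_diff[OF subgroup_K] by blast
    then have "0 \<in> coset K (\<sigma>' n)"
      using add_subgroup_uminus[OF subgroup_K, of "\<sigma>' n"] by (simp add: coset_iff)
    then show \<sigma>': "\<sigma>' n = \<sigma>\<^sub>0"
      unfolding \<sigma>\<^sub>0_def using P n by (intro theta_eqI[symmetric]) auto
    have "\<eta> (x - \<sigma>' n + \<sigma> n) = x - \<sigma>' n + \<sigma> n - \<sigma> n"
      using P n c by (intro eta_eqI) auto
    then show "\<eta> (x - \<sigma>' n + \<sigma> n) = x - \<sigma>\<^sub>0"
      using \<sigma>' by simp
  qed
  have V_cases: "\<exists>n\<in>I. \<exists>x\<in>P' n. v = x - \<sigma>' n + \<sigma> n" if v: "v \<in> V" for v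
  proof -
    obtain n where n: "n \<in> I" "v \<in> P n"
      using V v by blast
    then have "P n = (\<lambda>\<gamma>. \<gamma> - \<sigma>' n + \<sigma> n) ` P' n"
      using P by blast
    then show ?thesis
      using n by blast
  qed
  show ?thesis
    unfolding bij_betw_def
  proof
    show "inj_on \<eta> V"
    proof (rule inj_onI)
      fix v w assume "v \<in> V" "w \<in> V" and eq: "\<eta> v = \<eta> w"
      then obtain n x m y where n: "n \<in> I" "x \<in> P' n" "v = x - \<sigma>' n + \<sigma> n"
        and m: "m \<in> I" "y \<in> P' m" "w = y - \<sigma>' m + \<sigma> m"
        using V_cases by meson
      have "x - \<sigma>\<^sub>0 = y - \<sigma>\<^sub>0"
        using eq eta[OF n(1,2)] eta[OF m(1,2)] n(3) m(3) by simp
      then have "x = y"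
        by simp
      then have "n = m"
        using disj n m by (auto simp: disjoint_family_on_def)
      then show "v = w"
        using \<open>x = y\<close> n(3) m(3) by simp
    qed
    show "\<eta> ` V = K"
    proof (intro equalityI subsetI)
      fix \<kappa> assume "\<kappa> \<in> K"
      then have "\<kappa> + \<sigma>\<^sub>0 \<in> K"
        using \<sigma>0 add_subgroup_add[OF subgroup_K] by blast
      then obtain n where n: "n \<in> I" "\<kappa> + \<sigma>\<^sub>0 \<in> P' n"
        using K by blast
      have "\<eta> (\<kappa> + \<sigma>\<^sub>0 - \<sigma>' n + \<sigma> n) = \<kappa>"
        using eta[OF n] by simp
      moreover have "\<kappa> + \<sigma>\<^sub>0 - \<sigma>' n + \<sigma> n \<in> V"
        using mem[OF n] V n(1) by blast
      ultimately show "\<kappa> \<in> \<eta> ` V"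
        by (metis imageI)
    qed (auto simp: eta_in_K)
  qed
qed

section \<open>Invariants of the iteration and disjointness of the limit sets\<close>

locale wavelet_construction = wavelet_setting H \<mu> \<nu> D A1
  for H :: "'a::{topological_ab_group_add,t2_space} set" and \<mu> \<nu> D A1 +
  fixes M N l :: nat and T :: "nat \<Rightarrow> 'a dual \<Rightarrow> 'a dual" and \<Omega>0 :: "nat \<Rightarrow> 'a dual set"
    and W :: "'a dual set"
  assumes W_def: "W = int_pow (adjoint_aut A1) (int M) ` annihilator H"
    and T_range: "\<And>j. j \<in> {1..N} \<Longrightarrow> T j \<in> W \<rightarrow> (adjoint_aut A1 ` W) - W"
    and T_measurable: "\<And>j. j \<in> {1..N} \<Longrightarrow> T j \<in> borel_measurable (restrict_space borel W)"
    and T_inj: "\<And>j. j \<in> {1..N} \<Longrightarrow> inj_on (T j) W"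
    and T_translation: "\<And>j \<gamma>. j \<in> {1..N} \<Longrightarrow> \<gamma> \<in> W \<Longrightarrow> T j \<gamma> - \<gamma> + theta (annihilator H) D \<gamma> \<in> D"
    and \<Omega>0_W: "\<And>j. j \<in> {1..N} \<Longrightarrow> \<Omega>0 j \<subseteq> W"
    and \<Omega>0_sets: "\<And>j. j \<in> {1..N} \<Longrightarrow> \<Omega>0 j \<in> sets borel"
    and \<Omega>0_congruent: "\<And>j. j \<in> {1..N} \<Longrightarrow> congruent_sets (annihilator H) D (\<Omega>0 j) (annihilator H)"
    and \<Omega>0_cover: "int_pow (adjoint_aut A1) (- int l) ` annihilator H \<subseteq> (\<Union>j\<in>{1..N}. \<Omega>0 j)"
    and T_separated: "\<And>j k. j \<in> {1..N} \<Longrightarrow> k \<in> {1..N} \<Longrightarrow> j \<noteq> k \<Longrightarrow>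
           T j ` W \<inter> T k ` W = {} \<or>
           ((\<forall>\<gamma>\<in>W. T j \<gamma> = T k \<gamma>) \<and> \<Omega>0 j \<inter> \<Omega>0 k = {})"
begin

abbreviation "\<Omega>\<^sub>m \<equiv> Omega_step B N T \<Omega>0"
abbreviation "\<Lambda>\<^sub>m \<equiv> Lambda_step B N T \<Omega>0"
abbreviation "\<Omega>L \<equiv> Omega_limit B N T \<Omega>0"
abbreviation "\<Lambda>L \<equiv> Lambda_limit B N T \<Omega>0"

definition \<Omega>t :: "nat \<Rightarrow> 'a dual set" where
  "\<Omega>t m = (\<Union>k\<in>{1..N}. \<Omega>\<^sub>m m k)"

definition \<Lambda>u :: "nat \<Rightarrow> nat \<Rightarrow> 'a dual set" where
  "\<Lambda>u m j = (\<Union>i\<le>m. \<Lambda>\<^sub>m i j)"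

lemma BW: "B ` W = int_pow B (int (Suc M)) ` K"
  unfolding W_def using int_pow_image_add[OF bij_B, of 1 "int M" K] by simp

lemma W_BW: "W \<subseteq> B ` W"
  unfolding BW unfolding W_def by (rule B_pow_mono) simp

lemma mem_BW: "int_pow B n \<gamma> \<in> B ` W \<longleftrightarrow> \<gamma> \<in> int_pow B (int M + 1 - n) ` K"
proof -
  have "int_pow B n \<gamma> \<in> B ` W \<longleftrightarrow> int_pow B (- int (Suc M)) (int_pow B n \<gamma>) \<in> K"
    unfolding BW by (simp only: int_pow_image_iff[OF bij_B])
  also have "int_pow B (- int (Suc M)) (int_pow B n \<gamma>) = int_pow B (- (int M + 1 - n)) \<gamma>"
    by (subst int_pow_add[OF bij_B, symmetric]) (simp add: algebra_simps)
  finally show ?thesis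
    by (simp only: int_pow_image_iff[OF bij_B])
qed

text \<open>Negative powers of \<open>B\<close> shrink the image of \<open>W\<close> back into
  \<open>W\<close>. So the contractions of any set in that image stay in \<open>W\<close>, which
  explains why points moved outside \<open>W\<close> are never removed.\<close>

lemma pow_BW_imp_W:
  assumes "int_pow B n \<gamma> \<in> B ` W" "n \<ge> 1"
  shows "\<gamma> \<in> W"
proof -
  have "\<gamma> \<in> int_pow B (int M + 1 - n) ` K"
    using assms(1) unfolding mem_BW .
  moreover have "int_pow B (int M + 1 - n) ` K \<subseteq> int_pow B (int M) ` K"
    using assms(2) by (intro B_pow_mono) simp
  ultimately show ?thesis
    unfolding W_def by blast
qed

lemma T_notin_W: "j \<in> {1..N} \<Longrightarrow> \<gamma> \<in> W \<Longrightarrow> T j \<gamma> \<notin> W"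
  and T_in_BW: "j \<in> {1..N} \<Longrightarrow> \<gamma> \<in> W \<Longrightarrow> T j \<gamma> \<in> B ` W"
  using T_range by auto

text \<open>The difference \<open>\<gamma> - \<theta> \<gamma>\<close> lies in \<open>K\<close>, so
  the element of \<open>D\<close> supplied by \<open>T_translation\<close> is in the coset of
  \<open>T j \<gamma>\<close>. Thus \<open>T j\<close> moves points by differences of
  representatives.\<close>

lemma theta_T:
  assumes "j \<in> {1..N}" "\<gamma> \<in> W"
  shows "\<theta> (T j \<gamma>) = T j \<gamma> - \<gamma> + \<theta> \<gamma>"
proof (rule theta_eqI[OF T_translation[OF assms]])
  have "T j \<gamma> - (T j \<gamma> - \<gamma> + \<theta> \<gamma>) = \<eta> \<gamma>"
    by (simp add: eta_def)
  then show "T j \<gamma> \<in> coset K (T j \<gamma> - \<gamma> + \<theta> \<gamma>)"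
    by (simp only: coset_iff eta_in_K)
qed

lemma eta_T:
  assumes "j \<in> {1..N}" "\<gamma> \<in> W"
  shows "\<eta> (T j \<gamma>) = \<eta> \<gamma>"
  by (simp add: eta_def[of K D "T j \<gamma>"] theta_T[OF assms]) (simp add: eta_def)

text \<open>The three facts need each other: the closed form keeps \<open>\<Omega>\<^sub>m\<close>
  inside the image of \<open>W\<close> under \<open>B\<close>, this forces the next contraction
  points into \<open>W\<close>, and the points of the closed form that lie in \<open>W\<close> are
  original points.\<close>

lemma steps_conj:
  "\<forall>j\<in>{1..N}. \<Lambda>\<^sub>m (Suc m) j \<subseteq> \<Omega>0 j \<and>
    \<Omega>\<^sub>m m j = (\<Omega>0 j - \<Lambda>u m j) \<union> T j ` \<Lambda>u m j \<and> \<Lambda>u m j \<subseteq> \<Omega>0 j"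
proof (induction m)
  case 0
  then show ?case
    by (auto simp: \<Lambda>u_def)
next
  case (Suc m)
  have IH: "\<Lambda>\<^sub>m (Suc m) k \<subseteq> \<Omega>0 k" "\<Omega>\<^sub>m m k = (\<Omega>0 k - \<Lambda>u m k) \<union> T k ` \<Lambda>u m k"
    "\<Lambda>u m k \<subseteq> \<Omega>0 k" if "k \<in> {1..N}" for k
    using Suc that by blast+
  have u: "\<Lambda>u (Suc m) k = \<Lambda>u m k \<union> \<Lambda>\<^sub>m (Suc m) k" for k
    by (auto simp: \<Lambda>u_def atMost_Suc)
  have sub: "\<Lambda>u (Suc m) k \<subseteq> \<Omega>0 k" if "k \<in> {1..N}" for k
    unfolding u using IH(1,3)[OF that] by blast
  have \<Omega>: "\<Omega>\<^sub>m (Suc m) k = (\<Omega>0 k - \<Lambda>u (Suc m) k) \<union> T k ` \<Lambda>u (Suc m) k" if k: "k \<in> {1..N}" for k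
  proof -
    \<comment> \<open>Since removed points lie in \<open>W\<close> and images under
      \<open>T k\<close> do not, a step leaves the images of earlier steps in place.\<close>
    have "T k ` \<Lambda>u m k \<inter> \<Lambda>\<^sub>m (Suc m) k = {}"
      using T_notin_W[OF k] IH(1,3)[OF k] \<Omega>0_W[OF k] by fast
    then show ?thesis
      unfolding Omega_step.simps(2) IH(2)[OF k] u by blast
  qed
  have \<Omega>_BW: "\<Omega>t (Suc m) \<subseteq> B ` W"
    unfolding \<Omega>t_def
  proof (rule UN_least)
    fix k assume k: "k \<in> {1..N}"
    show "\<Omega>\<^sub>m (Suc m) k \<subseteq> B ` W"
      unfolding \<Omega>[OF k] using \<Omega>0_W[OF k] W_BW sub[OF k] T_in_BW[OF k] by blast
  qed
  have "\<Lambda>\<^sub>m (Suc (Suc m)) j \<subseteq> \<Omega>0 j" if j: "j \<in> {1..N}" for j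
  proof
    fix \<gamma> assume "\<gamma> \<in> \<Lambda>\<^sub>m (Suc (Suc m)) j"
    then have \<gamma>: "\<gamma> \<in> \<Omega>\<^sub>m (Suc m) j" "\<gamma> \<in> contractions B (\<Omega>t (Suc m))"
      by (auto simp: \<Omega>t_def)
    then obtain n where n: "n \<ge> 1" "int_pow B (int n) \<gamma> \<in> \<Omega>t (Suc m)"
      unfolding mem_contractions[OF bij_B] by blast
    then have "int_pow B (int n) \<gamma> \<in> B ` W"
      using \<Omega>_BW by blast
    then have "\<gamma> \<in> W"
      using pow_BW_imp_W n(1) by simp
    then show "\<gamma> \<in> \<Omega>0 j"
      using \<gamma>(1) T_notin_W[OF j] sub[OF j] \<Omega>0_W[OF j]
      unfolding \<Omega>[OF j] by blast
  qed
  with \<Omega> sub show ?case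
    by blast
qed

lemma steps:
  assumes "j \<in> {1..N}"
  shows "\<Lambda>\<^sub>m (Suc m) j \<subseteq> \<Omega>0 j"
    and "\<Omega>\<^sub>m m j = (\<Omega>0 j - \<Lambda>u m j) \<union> T j ` \<Lambda>u m j" and "\<Lambda>u m j \<subseteq> \<Omega>0 j"
  using steps_conj[of m] assms by blast+

lemma \<Lambda>_limit_eq: "\<Lambda>L j = (\<Union>m. \<Lambda>u m j)"
proof (intro equalityI subsetI)
  fix \<gamma> assume "\<gamma> \<in> (\<Union>m. \<Lambda>u m j)"
  then obtain i where "\<gamma> \<in> \<Lambda>\<^sub>m i j"
    by (auto simp: \<Lambda>u_def)
  moreover from this have "i \<noteq> 0"
    by (cases i) auto
  ultimately show "\<gamma> \<in> \<Lambda>L j"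
    by (auto simp: Lambda_limit_def intro!: bexI[of _ i])
qed (auto simp: Lambda_limit_def \<Lambda>u_def)

lemma \<Lambda>_limit_sub: "j \<in> {1..N} \<Longrightarrow> \<Lambda>L j \<subseteq> \<Omega>0 j"
  unfolding \<Lambda>_limit_eq using steps(3) by blast

lemma \<Omega>_limit_BW: "j \<in> {1..N} \<Longrightarrow> \<Omega>L j \<subseteq> B ` W"
  unfolding Omega_limit_def using \<Lambda>_limit_sub \<Omega>0_W W_BW T_in_BW by blast

lemma \<Omega>_limit_W: "j \<in> {1..N} \<Longrightarrow> \<gamma> \<in> \<Omega>L j \<Longrightarrow> \<gamma> \<in> W \<Longrightarrow> \<gamma> \<in> \<Omega>0 j - \<Lambda>L j"
  unfolding Omega_limit_def using \<Lambda>_limit_sub \<Omega>0_W T_notin_W by blast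

lemma \<Omega>_limit_notin_W:
  "j \<in> {1..N} \<Longrightarrow> \<gamma> \<in> \<Omega>L j \<Longrightarrow> \<gamma> \<notin> W \<Longrightarrow> \<exists>a\<in>\<Lambda>L j. \<gamma> = T j a"
  unfolding Omega_limit_def using \<Omega>0_W by blast

lemma \<Omega>_limit_eta:
  assumes j: "j \<in> {1..N}"
  shows "bij_betw \<eta> (\<Omega>L j) K"
  unfolding Omega_limit_def
proof (rule bij_betw_exchange[OF congruent_sets_eta[OF \<Omega>0_congruent[OF j]] \<Lambda>_limit_sub[OF j]])
  show "\<eta> (T j x) = \<eta> x" if "x \<in> \<Lambda>L j" for x
    using that \<Lambda>_limit_sub[OF j] \<Omega>0_W[OF j] by (intro eta_T[OF j]) blast
qed

text \<open>Inside \<open>W\<close>, a common point would have been removed in the first step from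
  the set with the larger index. Outside \<open>W\<close> it is an image under both maps, so
  \<open>T_separated\<close> makes the maps equal and the initial sets disjoint, and injectivity
  gives a contradiction.\<close>

lemma \<Omega>_limit_disjoint_same:
  assumes j: "j \<in> {1..N}" and k: "k \<in> {1..N}" and "k < j"
  shows "\<Omega>L j \<inter> \<Omega>L k = {}"
proof (rule ccontr)
  assume "\<Omega>L j \<inter> \<Omega>L k \<noteq> {}"
  then obtain \<gamma> where \<gamma>: "\<gamma> \<in> \<Omega>L j" "\<gamma> \<in> \<Omega>L k"
    by blast
  show False
  proof (cases "\<gamma> \<in> W")
    case True
    then have "\<gamma> \<in> \<Omega>0 j - \<Lambda>L j" "\<gamma> \<in> \<Omega>0 k"
      using \<Omega>_limit_W j k \<gamma> by blast+
    moreover from this have "\<gamma> \<in> \<Lambda>\<^sub>m (Suc 0) j"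
      using k \<open>k < j\<close> by auto
    moreover have "\<Lambda>\<^sub>m (Suc 0) j \<subseteq> \<Lambda>L j"
      unfolding Lambda_limit_def by (rule UN_upper) simp
    ultimately show False
      by blast
  next
    case False
    obtain a where a: "a \<in> \<Lambda>L j" "\<gamma> = T j a"
      using \<Omega>_limit_notin_W[OF j \<gamma>(1) False] by blast
    obtain b where b: "b \<in> \<Lambda>L k" "\<gamma> = T k b"
      using \<Omega>_limit_notin_W[OF k \<gamma>(2) False] by blast
    have mem: "a \<in> \<Omega>0 j" "b \<in> \<Omega>0 k"
      using a(1) b(1) \<Lambda>_limit_sub j k by blast+
    then have W: "a \<in> W" "b \<in> W"
      using \<Omega>0_W j k by blast+
    then have "T j ` W \<inter> T k ` W \<noteq> {}"
      using a(2) b(2) by blast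
    then have T: "\<forall>\<gamma>\<in>W. T j \<gamma> = T k \<gamma>" "\<Omega>0 j \<inter> \<Omega>0 k = {}"
      using T_separated[OF j k] \<open>k < j\<close> by auto
    then have "a = b"
      using inj_onD[OF T_inj[OF k], of a b] a(2) b(2) W by simp
    then show False
      using T(2) mem by blast
  qed
qed

text \<open>A later orbit point in a limit set already belongs to some stage \<open>m\<close>; the
  earlier point is then caught by the contractions of that stage and removed in the next
  step.\<close>

lemma \<Omega>_limit_dilates:
  assumes j: "j \<in> {1..N}" and k: "k \<in> {1..N}" and n: "n \<ge> 1"
    and \<gamma>: "\<gamma> \<in> \<Omega>L j" and \<delta>: "int_pow B n \<gamma> \<in> \<Omega>L k"
  shows False
proof -
  have "\<gamma> \<in> W"
    using pow_BW_imp_W[OF _ n] \<delta> \<Omega>_limit_BW[OF k] by blast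
  then have \<gamma>': "\<gamma> \<in> \<Omega>0 j" "\<gamma> \<notin> \<Lambda>L j"
    using \<Omega>_limit_W[OF j \<gamma>] by blast+
  \<comment> \<open>An original point is present at stage 0, and an image under \<open>T k\<close>
    from the stage at which its preimage was removed.\<close>
  obtain m where m: "int_pow B n \<gamma> \<in> \<Omega>\<^sub>m m k"
  proof (cases "int_pow B n \<gamma> \<in> \<Omega>0 k")
    case True
    then show ?thesis
      using that[of 0] by simp
  next
    case False
    then obtain a m where "a \<in> \<Lambda>u m k" "int_pow B n \<gamma> = T k a"
      using \<delta> unfolding Omega_limit_def \<Lambda>_limit_eq by blast
    then show ?thesis
      using that[of m] steps(2)[OF k, of m] by blast
  qed
  have "\<gamma> \<in> \<Omega>\<^sub>m m j"
    unfolding steps(2)[OF j] using \<gamma>' unfolding \<Lambda>_limit_eq by blast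
  moreover have "\<gamma> \<in> contractions B (\<Omega>t m)"
    unfolding mem_contractions[OF bij_B] \<Omega>t_def using m k n by (intro exI[of _ "nat n"]) auto
  ultimately have "\<gamma> \<in> \<Lambda>\<^sub>m (Suc m) j"
    using \<gamma>'(1) by (cases m) (auto simp: \<Omega>t_def)
  moreover have "\<Lambda>\<^sub>m (Suc m) j \<subseteq> \<Lambda>L j"
    unfolding Lambda_limit_def by (rule UN_upper) simp
  ultimately show False
    using \<gamma>'(2) by blast
qed

lemma \<Omega>_limit_disjoint:
  assumes j: "j \<in> {1..N}" and k: "k \<in> {1..N}" and ne: "(j, m) \<noteq> (k, n)"
  shows "int_pow B m ` \<Omega>L j \<inter> int_pow B n ` \<Omega>L k = {}"
proof (rule ccontr)
  assume "\<not> ?thesis"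
  then obtain \<gamma> where "\<gamma> \<in> int_pow B m ` \<Omega>L j" "\<gamma> \<in> int_pow B n ` \<Omega>L k"
    by blast
  then have \<gamma>: "int_pow B (- m) \<gamma> \<in> \<Omega>L j" "int_pow B (- n) \<gamma> \<in> \<Omega>L k"
    unfolding int_pow_image_iff[OF bij_B] .
  have mn: "int_pow B (- n) \<gamma> = int_pow B (m - n) (int_pow B (- m) \<gamma>)"
    "int_pow B (- m) \<gamma> = int_pow B (n - m) (int_pow B (- n) \<gamma>)"
    by (simp_all add: int_pow_add[OF bij_B, symmetric])
  consider "m > n" | "m < n" | "m = n" "j < k" | "m = n" "k < j"
    using ne by fastforce
  then show False
  proof cases
    case 1
    then show ?thesis
      using \<Omega>_limit_dilates[OF j k, of "m - n"] \<gamma> mn(1) by simp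
  next
    case 2
    then show ?thesis
      using \<Omega>_limit_dilates[OF k j, of "n - m"] \<gamma> mn(2) by simp
  next
    case 3
    then show ?thesis
      using \<Omega>_limit_disjoint_same[OF k j] \<gamma> by auto
  next
    case 4
    then show ?thesis
      using \<Omega>_limit_disjoint_same[OF j k] \<gamma> by auto
  qed
qed

section \<open>Measurability of the construction\<close>

lemma W_subgroup: "compact_open_subgroup W"
  unfolding W_def by (rule compact_open_subgroup_image[OF Gd.compact_open int_pow_Aut[OF B_Aut]])

lemma BW_compact: "compact (B ` W)"
  using compact_open_subgroup_image[OF W_subgroup B_Aut] by (simp add: compact_open_subgroup_def)

lemma W_sets: "W \<in> sets borel"
  using W_subgroup by (auto simp: compact_open_subgroup_def)

text \<open>Measurability of \<open>T j\<close> alone speaks about preimages. Images stay Borel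
  because \<open>T j\<close> is a translation on each of finitely many Borel pieces, fixed by the
  cosets of \<open>\<gamma>\<close> and of \<open>T j \<gamma>\<close>.\<close>

lemma T_image_sets:
  assumes j: "j \<in> {1..N}" and E: "E \<in> sets borel" "E \<subseteq> W"
  shows "T j ` E \<in> sets borel"
proof -
  define Q where "Q p = E \<inter> coset K (fst p) \<inter> (T j -` coset K (snd p) \<inter> W)" for p
  let ?I = "\<theta> ` W \<times> \<theta> ` (B ` W)"
  have "compact W"
    using W_subgroup by (simp add: compact_open_subgroup_def)
  then have I: "finite ?I"
    using finite_theta_image BW_compact by blast
  have Q: "Q p \<in> sets borel" for p
  proof -
    have "T j -` coset K (snd p) \<inter> W \<in> sets (restrict_space borel W)"
      using measurable_sets[OF T_measurable[OF j] Gd.coset_sets[of "snd p"]] by (simp add: space_restrict_space)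
    then have "T j -` coset K (snd p) \<inter> W \<in> sets borel"
      using W_sets by (simp add: sets_restrict_space_iff)
    then show ?thesis
      unfolding Q_def by (rule sets.Int[OF sets.Int[OF E(1) Gd.coset_sets]])
  qed
  have Q_image: "T j ` Q p = (+) (snd p - fst p) ` Q p" if p: "p \<in> ?I" for p
  proof (rule image_cong[OF refl])
    fix \<gamma> assume "\<gamma> \<in> Q p"
    then have \<gamma>: "\<gamma> \<in> W" "\<gamma> \<in> coset K (fst p)" "T j \<gamma> \<in> coset K (snd p)"
      by (auto simp: Q_def)
    have "fst p \<in> D" "snd p \<in> D"
      using p theta_in_D by auto
    then have "\<theta> \<gamma> = fst p" "\<theta> (T j \<gamma>) = snd p"
      using \<gamma> by (auto intro: theta_eqI)
    then have "snd p = T j \<gamma> - \<gamma> + fst p"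
      using theta_T[OF j \<gamma>(1)] by simp
    then show "T j \<gamma> = snd p - fst p + \<gamma>"
      by simp
  qed
  have "T j ` Q p \<in> sets borel" if p: "p \<in> ?I" for p
  proof -
    have "(+) (snd p - fst p) ` Q p = (+) (- (snd p - fst p)) -` Q p"
      by (rule Gd.plus_image)
    then show ?thesis
      unfolding Q_image[OF p] using measurable_sets[OF Gd.plus_measurable Q, of "- (snd p - fst p)" p]
      by (simp only: space_borel Int_UNIV_right)
  qed
  then have "(\<Union>p\<in>?I. T j ` Q p) \<in> sets borel"
    using I by (intro sets.finite_UN) auto
  moreover have "T j ` E = (\<Union>p\<in>?I. T j ` Q p)"
  proof -
    have "E = (\<Union>p\<in>?I. Q p)"
    proof (intro equalityI subsetI)
      fix \<gamma> assume \<gamma>: "\<gamma> \<in> E"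
      then have W: "\<gamma> \<in> W"
        using E(2) by blast
      have "\<gamma> \<in> Q (\<theta> \<gamma>, \<theta> (T j \<gamma>))"
        using \<gamma> W theta_coset by (simp add: Q_def)
      moreover have "(\<theta> \<gamma>, \<theta> (T j \<gamma>)) \<in> ?I"
        using W T_in_BW[OF j W] by blast
      ultimately show "\<gamma> \<in> (\<Union>p\<in>?I. Q p)"
        by (rule UN_I[rotated])
    qed (auto simp: Q_def)
    then show ?thesis
      by (metis image_UN)
  qed
  ultimately show ?thesis
    by simp
qed

lemma contractions_sets: "E \<in> sets borel \<Longrightarrow> contractions B E \<in> sets borel"
  unfolding contractions_def by (intro sets.countable_UN') (auto intro: B_pow_image_sets)

lemma step_sets_conj: "\<forall>j\<in>{1..N}. \<Lambda>\<^sub>m m j \<in> sets borel \<and> \<Omega>\<^sub>m m j \<in> sets borel"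
proof (induction m)
  case 0
  show ?case
    using \<Omega>0_sets by auto
next
  case (Suc m)
  have IH: "\<Omega>\<^sub>m m k \<in> sets borel" if "k \<in> {1..N}" for k
    using Suc that by blast
  have "\<Omega>t m \<in> sets borel"
    unfolding \<Omega>t_def using IH by (intro sets.finite_UN) auto
  then have c: "contractions B (\<Omega>t m) \<in> sets borel"
    by (rule contractions_sets)
  have \<Lambda>: "\<Lambda>\<^sub>m (Suc m) k \<in> sets borel" if k: "k \<in> {1..N}" for k
  proof (cases m)
    case 0
    have "(\<Union>i\<in>{1..<k}. \<Omega>0 i) \<in> sets borel"
      using k by (intro sets.finite_UN \<Omega>0_sets) auto
    then show ?thesis
      using c \<Omega>0_sets[OF k] by (simp add: 0 \<Omega>t_def sets.Int sets.Un)
  next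
    case (Suc m')
    then show ?thesis
      using c IH[OF k] by (simp add: \<Omega>t_def sets.Int del: Omega_step.simps)
  qed
  have "T j ` \<Lambda>\<^sub>m (Suc m) j \<in> sets borel" if j: "j \<in> {1..N}" for j
    using steps(1)[OF j] \<Omega>0_W[OF j] by (intro T_image_sets[OF j \<Lambda>[OF j]]) blast
  then have "\<Omega>\<^sub>m (Suc m) j \<in> sets borel" if j: "j \<in> {1..N}" for j
    unfolding Omega_step.simps(2) using j IH[OF j] \<Lambda>[OF j] by (intro sets.Un sets.Diff) auto
  with \<Lambda> show ?case
    by blast
qed

lemma step_sets: "j \<in> {1..N} \<Longrightarrow> \<Lambda>\<^sub>m m j \<in> sets borel"
  using step_sets_conj by blast

lemma \<Omega>_limit_sets:
  assumes j: "j \<in> {1..N}"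
  shows "\<Omega>L j \<in> sets borel"
proof -
  have \<Lambda>: "\<Lambda>L j \<in> sets borel"
    unfolding Lambda_limit_def using step_sets[OF j] by (intro sets.countable_UN') auto
  moreover have "T j ` \<Lambda>L j \<in> sets borel"
    using \<Lambda>_limit_sub[OF j] \<Omega>0_W[OF j] by (intro T_image_sets[OF j \<Lambda>]) blast
  ultimately show ?thesis
    unfolding Omega_limit_def using \<Omega>0_sets[OF j] by auto
qed

text \<open>Off the null set \<open>\<Inter>\<^sub>k B\<^sup>-\<^sup>k K\<close> an orbit meets \<open>\<Union>\<^sub>m \<Omega>t m\<close> for a last time;
  the point where this happens lies in no \<open>contractions B (\<Omega>t m)\<close> and is never moved again.\<close>

lemma \<Omega>_limit_cover:
  assumes \<gamma>: "\<gamma> \<notin> (\<Inter>k. int_pow B (- int k) ` K)"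
  shows "\<exists>n. \<exists>j\<in>{1..N}. \<gamma> \<in> int_pow B n ` \<Omega>L j"
proof -
  obtain k where k: "\<gamma> \<notin> int_pow B (- int k) ` K"
    using \<gamma> by blast
  define R where "R = {n. \<exists>m. int_pow B n \<gamma> \<in> \<Omega>t m}"
  have \<Omega>t_BW: "\<Omega>t m \<subseteq> B ` W" for m
    unfolding \<Omega>t_def
  proof (rule UN_least)
    fix i assume i: "i \<in> {1..N}"
    show "\<Omega>\<^sub>m m i \<subseteq> B ` W"
      unfolding steps(2)[OF i] using \<Omega>0_W[OF i] W_BW steps(3)[OF i, of m] T_in_BW[OF i] by blast
  qed
  \<comment> \<open>If \<open>int_pow B n \<gamma>\<close> still lies in the image of
    \<open>W\<close> for a larger \<open>n\<close>, then \<open>\<gamma>\<close> lies in a power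
    image of \<open>K\<close> below the one that it avoids.\<close>
  have bound: "n \<le> int M + 1 + int k" if n: "n \<in> R" for n
  proof (rule ccontr)
    assume *: "\<not> n \<le> int M + 1 + int k"
    have "int_pow B n \<gamma> \<in> B ` W"
      using n \<Omega>t_BW unfolding R_def by blast
    then have "\<gamma> \<in> int_pow B (int M + 1 - n) ` K"
      unfolding mem_BW .
    moreover have "int_pow B (int M + 1 - n) ` K \<subseteq> int_pow B (- int k) ` K"
      using * by (intro B_pow_mono) simp
    ultimately show False
      using k by blast
  qed
  \<comment> \<open>Some orbit point lies in \<open>K\<close>, and \<open>l\<close> more backward
    steps bring it into the region that the initial sets cover.\<close>
  obtain n0 where "\<gamma> \<in> int_pow B n0 ` K"
    using B_pow_exhaust by blast
  then have "int_pow B (- int l) (int_pow B (- n0) \<gamma>) \<in> int_pow B (- int l) ` K"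
    by (simp add: int_pow_image_iff[OF bij_B, of \<gamma>])
  then have "int_pow B (- int l - n0) \<gamma> \<in> \<Omega>t 0"
    using \<Omega>0_cover by (auto simp: \<Omega>t_def int_pow_add[OF bij_B, symmetric])
  then have n1: "- int l - n0 \<in> R"
    unfolding R_def by blast
  \<comment> \<open>The orbit may meet the sets at arbitrarily negative exponents, so
    \<open>R\<close> is cut off at a known member to obtain a finite set with a maximum.\<close>
  define R' where "R' = R \<inter> {- int l - n0..}"
  have "R' \<subseteq> {- int l - n0..int M + 1 + int k}"
    using bound by (auto simp: R'_def)
  then have R': "finite R'" "R' \<noteq> {}"
    using n1 by (auto simp: R'_def intro: finite_subset)
  define n where "n = Max R'"
  have "n \<in> R'"
    unfolding n_def by (rule Max_in[OF R'])
  then have nR: "n \<in> R" and n_ge: "- int l - n0 \<le> n"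
    by (auto simp: R'_def)
  have n_max: "i \<notin> R" if "i > n" for i
  proof
    assume "i \<in> R"
    then have "i \<in> R'"
      using that n_ge by (simp add: R'_def)
    then show False
      using Max_ge[OF R'(1)] that unfolding n_def by fastforce
  qed
  define \<delta> where "\<delta> = int_pow B n \<gamma>"
  have no_contr: "\<delta> \<notin> contractions B (\<Omega>t m)" for m
  proof
    assume "\<delta> \<in> contractions B (\<Omega>t m)"
    then obtain i where i: "i \<ge> 1" "int_pow B (int i) \<delta> \<in> \<Omega>t m"
      unfolding mem_contractions[OF bij_B] by blast
    then have "int i + n \<in> R"
      unfolding \<delta>_def int_pow_add[OF bij_B, symmetric] R_def by blast
    then show False
      using n_max i(1) by auto
  qed
  obtain m j where m: "m \<ge> 1" "j \<in> {1..N}" "\<delta> \<in> \<Omega>\<^sub>m m j"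
  proof -
    obtain m where m: "\<delta> \<in> \<Omega>t m"
      using nR by (auto simp: R_def \<delta>_def)
    show ?thesis
    proof (cases "m = 0")
      case True
      \<comment> \<open>Initial sets may overlap. The least index whose set contains
        \<open>\<delta>\<close> survives the removal of overlaps in the first step, which moves
        \<open>\<delta>\<close> to stage 1.\<close>
      define P where "P j \<longleftrightarrow> j \<in> {1..N} \<and> \<delta> \<in> \<Omega>0 j" for j
      define j where "j = (LEAST j. P j)"
      have "\<exists>j. P j"
        using m True by (auto simp: \<Omega>t_def P_def)
      then have j: "P j"
        unfolding j_def by (rule LeastI_ex)
      have "\<not> P i" if "i < j" for i
        using not_less_Least[of i P] that by (simp add: j_def)
      then have "\<delta> \<notin> (\<Union>i\<in>{1..<j}. \<Omega>0 i)"
        using j by (auto simp: P_def)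
      then have "\<delta> \<notin> \<Lambda>\<^sub>m (Suc 0) j"
        using no_contr[of 0] by (simp add: \<Omega>t_def)
      then have "\<delta> \<in> \<Omega>\<^sub>m (Suc 0) j"
        using j by (simp add: P_def)
      then show ?thesis
        using that[of "Suc 0" j] j by (simp add: P_def)
    next
      case False
      then show ?thesis
        using m that[of m] by (auto simp: \<Omega>t_def)
    qed
  qed
  have "\<delta> \<in> \<Omega>L j"
  proof (cases "\<delta> \<in> T j ` \<Lambda>u m j")
    case True
    then show ?thesis
      unfolding Omega_limit_def \<Lambda>_limit_eq by blast
  next
    case False
    then have \<delta>: "\<delta> \<in> \<Omega>0 j" "\<delta> \<notin> \<Lambda>u m j"
      using m(3) unfolding steps(2)[OF m(2)] by blast+
    have "\<delta> \<notin> \<Lambda>\<^sub>m i j" for i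
    proof (cases "i \<le> m")
      case True
      then show ?thesis
        using \<delta>(2) by (auto simp: \<Lambda>u_def)
    next
      case False
      \<comment> \<open>Here \<open>i > m \<ge> 1\<close>; from the second step on, points are
        removed only through \<open>contractions\<close> and no longer because of overlap.\<close>
      then obtain i' where "i = Suc (Suc i')"
        using m(1) by (metis Suc_le_D le_Suc_ex not_less_eq_eq One_nat_def nat_le_linear Suc_leI not_le less_imp_Suc_add add_Suc)
      then show ?thesis
        using no_contr[of "Suc i'"] by (simp add: \<Omega>t_def)
    qed
    then show ?thesis
      using \<delta>(1) by (auto simp: Omega_limit_def Lambda_limit_def)
  qed
  moreover have "\<gamma> = int_pow B (- n) \<delta>"
    by (simp add: \<delta>_def int_pow_inverse[OF bij_B])
  ultimately show ?thesis
    using m(2) by blast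
qed

theorem wavelet_collection_limit:
  "wavelet_collection H D (range (int_pow A1)) \<mu> \<nu> N \<Omega>L"
proof -
  have "AE \<gamma> in \<nu>. \<exists>n. \<exists>j\<in>{1..N}. \<gamma> \<in> int_pow B n ` \<Omega>L j"
    using AE_not_in[OF null_core] by eventually_elim (rule \<Omega>_limit_cover)
  then interpret L: wavelet_sets H \<mu> \<nu> D A1 N \<Omega>L "B ` W"
    by unfold_locales
      (use \<Omega>_limit_sets BW_compact \<Omega>_limit_BW \<Omega>_limit_eta \<Omega>_limit_disjoint in auto)
  show ?thesis
    by (rule L.wavelet_collection)
qed

end

theorem theorem4p2:
  fixes H :: "'a::{topological_ab_group_add,t2_space} set"
    and D :: "'a dual set"
    and A1 :: "'a \<Rightarrow> 'a"
    and \<mu> :: "'a measure"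
    and \<nu> :: "'a dual measure"
    and M N l :: nat
    and W :: "'a dual set"
    and T :: "nat \<Rightarrow> 'a dual \<Rightarrow> 'a dual"
    and \<Omega>0 :: "nat \<Rightarrow> 'a dual set"
  assumes "locally compact (UNIV :: 'a set)"
    and "compact_open_subgroup H"
    and "haar_measure \<mu>" and "emeasure \<mu> H = 1"
    and "haar_measure \<nu>" and "emeasure \<nu> (annihilator H) = 1"
    and "coset_representatives (annihilator H) D"
    and "expansive H A1"
    and W_def: "W = int_pow (adjoint_aut A1) (int M) ` annihilator H"
    and "N \<ge> 1"
    and "\<And>j. j \<in> {1..N} \<Longrightarrow> T j \<in> W \<rightarrow> (adjoint_aut A1 ` W) - W"
    and "\<And>j. j \<in> {1..N} \<Longrightarrow> T j \<in> borel_measurable (restrict_space borel W)"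
    and "\<And>j. j \<in> {1..N} \<Longrightarrow> inj_on (T j) W"
    and "\<And>j \<gamma>. j \<in> {1..N} \<Longrightarrow> \<gamma> \<in> W \<Longrightarrow>
           T j \<gamma> - \<gamma> + theta (annihilator H) D \<gamma> \<in> D \<inter> ((adjoint_aut A1 ` W) - W)"
    and "\<And>j. j \<in> {1..N} \<Longrightarrow> \<Omega>0 j \<subseteq> W"
    and "\<And>j. j \<in> {1..N} \<Longrightarrow> \<Omega>0 j \<in> sets borel"
    and "\<And>j. j \<in> {1..N} \<Longrightarrow>
           congruent_sets (annihilator H) D (\<Omega>0 j) (annihilator H)"
    and "int_pow (adjoint_aut A1) (- int l) ` annihilator H \<subseteq> (\<Union>j\<in>{1..N}. \<Omega>0 j)"
    and "\<And>j k. j \<in> {1..N} \<Longrightarrow> k \<in> {1..N} \<Longrightarrow> j \<noteq> k \<Longrightarrow>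
           T j ` W \<inter> T k ` W = {} \<or>
           ((\<forall>\<gamma>\<in>W. T j \<gamma> = T k \<gamma>) \<and> \<Omega>0 j \<inter> \<Omega>0 k = {})"
  shows "wavelet_collection H D (range (int_pow A1)) \<mu> \<nu> N
           (Omega_limit (adjoint_aut A1) N T \<Omega>0)"
proof -
  have "dual_pair H \<mu> \<nu>"
    by (rule dual_pair.intro[OF assms(2-6) expansive_separates[OF assms(2,8)]])
  then have "wavelet_setting H \<mu> \<nu> D A1"
    by (rule wavelet_setting.intro[OF _ wavelet_setting_axioms.intro[OF assms(7,8)]])
  then have "wavelet_construction H \<mu> \<nu> D A1 M N l T \<Omega>0 W"
  proof (rule wavelet_construction.intro)
    show "wavelet_construction_axioms H D A1 M N l T \<Omega>0 W"
    proof (rule wavelet_construction_axioms.intro[OF W_def assms(11-13) _ assms(15-19)])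
      show "T j \<gamma> - \<gamma> + theta (annihilator H) D \<gamma> \<in> D" if "j \<in> {1..N}" "\<gamma> \<in> W" for j \<gamma>
        using assms(14)[OF that] by (rule IntD1)
    qed
  qed
  then show ?thesis
    by (rule wavelet_construction.wavelet_collection_limit)
qed

end
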